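(* Let $y\in L^2(0,T;\mathbb{R}^r)$ and $p\in\mathbb{N}$ with $1\le p<\infty$. Then $$\|\widehat{x}_\theta-\widehat{x}_0\|_{W^{1,1}(0,T;\mathbb{R}^n)}\to0\quad\text{for }\theta\to0,\qquad \|\widehat{x}_\theta-\widehat{x}_\infty\|_{L^p(0,T;\mathbb{R}^n)}\to0\quad\text{for }\theta\to\infty.$$
   Context: Setting. Fix $T>0$, $n,m,r\in\mathbb{N}$, $B\in\mathbb{R}^{n\times m}$, $C\in\mathbb{R}^{r\times n}$, $x_0\in\mathbb{R}^n$. $\|\cdot\|$ is the Euclidean norm, and $\|x\|_M^2=x^\top M x$ for a symmetric positive definite matrix $M$. Let $\Sigma=\Sigma_A\times\Sigma_\Gamma\times\Sigma_R\times\Sigma_Q$ be a product of finite nonempty sets, $\Sigma=\{\sigma_1,\dots,\sigma_N\}$, $N=|\Sigma|$. To each $\sigma=(\sigma_A,\sigma_\Gamma,\sigma_R,\sigma_Q)$ are assigned matrices $A_\sigma\in\mathbb{R}^{n\times n}$ (depending on $\sigma_A$ only) and symmetric positive definite matrices $\Gamma_\sigma\in\mathbb{R}^{n\times n}$, $R_\sigma\in\mathbb{R}^{m\times m}$, $Q_\sigma\in\mathbb{R}^{r\times r}$ (depending only on $\sigma_\Gamma$, $\sigma_R$, $\sigma_Q$ respectively). Index $k$ means $\sigma=\sigma_k$. For each $k$, $\Pi_k$ is the unique solution on $[0,T]$ of $\dot\Pi_k = A_k\Pi_k+\Pi_kA_k^\top-\Pi_kC^\top Q_k^{-1}C\Pi_k+BR_kB^\top$,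 $\Pi_k(0)=\Gamma_k$ (symmetric positive definite for all $t$), $P_k(t)=\Pi_k(t)^{-1}$ (infinitely differentiable in $t$), and, for the given output $y$, $\widehat{x}_k\in H^1(0,T;\mathbb{R}^n)$ solves $\dot{\widehat{x}}_k=A_k\widehat{x}_k+\Pi_kC^\top Q_k^{-1}(y-C\widehat{x}_k)$, $\widehat{x}_k(0)=x_0$. Set $r_k(t)=\int_0^t\|y(s)-C\widehat{x}_k(s)\|_{Q_k^{-1}}^2\,ds$ and $\mathcal{V}_k(t,x)=\|x-\widehat{x}_k(t)\|_{P_k(t)}^2+r_k(t)$. Estimators (for each $t\in[0,T]$ each minimizer over $x\in\mathbb{R}^n$ exists and is unique): $\widehat{x}_0(t)$ minimizes $\frac1N\sum_{k=1}^N\mathcal{V}_k(t,x)$; $\widehat{x}_\infty(t)$ minimizes $\max_{k=1,\dots,N}\mathcal{V}_k(t,x)$; and for $\theta\in(0,\infty)$, $\widehat{x}_\theta(t)$ minimizes $\frac1\theta\ln\left(\frac1N\sum_{k=1}^Ne^{\theta\mathcal{V}_k(t,x)}\right)$. *)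

theory Defs
  imports "HOL-Analysis.Analysis"
begin

definition sym_pos_def :: "real ^ 'n ^ 'n \<Rightarrow> bool" where
  "sym_pos_def M \<longleftrightarrow> transpose M = M \<and> (\<forall>x. x \<noteq> 0 \<longrightarrow> 0 < x \<bullet> (M *v x))"

definition wnorm_sq :: "real ^ 'n ^ 'n \<Rightarrow> real ^ 'n \<Rightarrow> real" where
  "wnorm_sq M x = x \<bullet> (M *v x)"

text \<open>Elements of Lebesgue and Sobolev spaces are represented by functions rather than by
  classes modulo null sets; values outside the domain \<open>S\<close> are irrelevant.\<close>

definition Lp_space :: "nat \<Rightarrow> real set \<Rightarrow> (real \<Rightarrow> real ^ 'n) set" where
  "Lp_space p S = {f \<in> borel_measurable (lebesgue_on S).
     integrable (lebesgue_on S) (\<lambda>t. norm (f t) ^ p)}"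

definition Lp_norm :: "nat \<Rightarrow> real set \<Rightarrow> (real \<Rightarrow> real ^ 'n) \<Rightarrow> real" where
  "Lp_norm p S f = root p (\<integral>t. norm (f t) ^ p \<partial>lebesgue_on S)"

text \<open>Sobolev spaces on an open interval are defined through weak derivatives, with continuously
  differentiable, compactly supported test functions (as in Brezis, \<^emph>\<open>Functional Analysis, Sobolev
  Spaces and Partial Differential Equations\<close>, Section 8.2; smooth test functions give the same
  spaces).\<close>

definition test_functions :: "real set \<Rightarrow> (real \<Rightarrow> real) set" where
  "test_functions S = {\<phi>. \<phi> C1_differentiable_on UNIV \<and>
     compact (closure {t. \<phi> t \<noteq> 0}) \<and> closure {t. \<phi> t \<noteq> 0} \<subseteq> S}"

definition has_weak_deriv ::
    "real set \<Rightarrow> (real \<Rightarrow> real ^ 'n) \<Rightarrow> (real \<Rightarrow> real ^ 'n) \<Rightarrow> bool" where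
  "has_weak_deriv S f g \<longleftrightarrow>
     (\<forall>\<phi>\<in>test_functions S.
        (\<integral>t. deriv \<phi> t *\<^sub>R f t \<partial>lebesgue_on S) = - (\<integral>t. \<phi> t *\<^sub>R g t \<partial>lebesgue_on S))"

definition W1p_space :: "nat \<Rightarrow> real set \<Rightarrow> (real \<Rightarrow> real ^ 'n) set" where
  "W1p_space p S = {f \<in> Lp_space p S. \<exists>g\<in>Lp_space p S. has_weak_deriv S f g}"

definition weak_deriv :: "nat \<Rightarrow> real set \<Rightarrow> (real \<Rightarrow> real ^ 'n) \<Rightarrow> real \<Rightarrow> real ^ 'n" where
  "weak_deriv p S f = (SOME g. g \<in> Lp_space p S \<and> has_weak_deriv S f g)"

definition W1p_norm :: "nat \<Rightarrow> real set \<Rightarrow> (real \<Rightarrow> real ^ 'n) \<Rightarrow> real" where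
  "W1p_norm p S f = Lp_norm p S f + Lp_norm p S (weak_deriv p S f)"

definition riccati_solution ::
    "real \<Rightarrow> real ^ 'n ^ 'n \<Rightarrow> real ^ 'm ^ 'n \<Rightarrow> real ^ 'n ^ 'r \<Rightarrow> real ^ 'n ^ 'n \<Rightarrow>
     real ^ 'm ^ 'm \<Rightarrow> real ^ 'r ^ 'r \<Rightarrow> (real \<Rightarrow> real ^ 'n ^ 'n) \<Rightarrow> bool" where
  "riccati_solution T A B C \<Gamma> R Q Pm \<longleftrightarrow>
     Pm 0 = \<Gamma> \<and>
     (\<forall>t\<in>{0..T}. (Pm has_vector_derivative
        A ** Pm t + Pm t ** transpose A
        - Pm t ** transpose C ** matrix_inv Q ** C ** Pm t
        + B ** R ** transpose B) (at t within {0..T}))"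

text \<open>The observer is an \<open>H\<^sup>1\<close> function, taken in its continuous representative so that the
  initial value and the point values on \<open>[0, T]\<close> make sense.\<close>

definition observer ::
    "real \<Rightarrow> real ^ 'n ^ 'n \<Rightarrow> real ^ 'n ^ 'r \<Rightarrow> real ^ 'r ^ 'r \<Rightarrow> real ^ 'n \<Rightarrow>
     (real \<Rightarrow> real ^ 'r) \<Rightarrow> (real \<Rightarrow> real ^ 'n ^ 'n) \<Rightarrow> (real \<Rightarrow> real ^ 'n) \<Rightarrow> bool" where
  "observer T A C Q x\<^sub>0 y Pm xh \<longleftrightarrow>
     xh \<in> W1p_space 2 {0<..<T} \<and> continuous_on {0..T} xh \<and> xh 0 = x\<^sub>0 \<and>
     has_weak_deriv {0<..<T} xh
       (\<lambda>t. A *v xh t + (Pm t ** transpose C ** matrix_inv Q) *v (y t - C *v xh t))"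

definition residual ::
    "real ^ 'n ^ 'r \<Rightarrow> real ^ 'r ^ 'r \<Rightarrow> (real \<Rightarrow> real ^ 'r) \<Rightarrow> (real \<Rightarrow> real ^ 'n) \<Rightarrow>
     real \<Rightarrow> real" where
  "residual C Q y xh t =
     set_lebesgue_integral lebesgue {0..t} (\<lambda>s. wnorm_sq (matrix_inv Q) (y s - C *v xh s))"

definition value_fun ::
    "real ^ 'n ^ 'r \<Rightarrow> real ^ 'r ^ 'r \<Rightarrow> (real \<Rightarrow> real ^ 'r) \<Rightarrow>
     (real \<Rightarrow> real ^ 'n ^ 'n) \<Rightarrow> (real \<Rightarrow> real ^ 'n) \<Rightarrow> real \<Rightarrow> real ^ 'n \<Rightarrow> real" where
  "value_fun C Q y Pm xh t x =
     wnorm_sq (matrix_inv (Pm t)) (x - xh t) + residual C Q y xh t"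

definition mean_estimator ::
    "'k set \<Rightarrow> ('k \<Rightarrow> real \<Rightarrow> real ^ 'n \<Rightarrow> real) \<Rightarrow> real \<Rightarrow> real ^ 'n" where
  "mean_estimator I V t =
     (ARG_MIN (\<lambda>x. 1 / real (card I) * (\<Sum>k\<in>I. V k t x)) x. True)"

definition minimax_estimator ::
    "'k set \<Rightarrow> ('k \<Rightarrow> real \<Rightarrow> real ^ 'n \<Rightarrow> real) \<Rightarrow> real \<Rightarrow> real ^ 'n" where
  "minimax_estimator I V t = (ARG_MIN (\<lambda>x. MAX k\<in>I. V k t x) x. True)"

definition exp_estimator ::
    "'k set \<Rightarrow> ('k \<Rightarrow> real \<Rightarrow> real ^ 'n \<Rightarrow> real) \<Rightarrow> real \<Rightarrow> real \<Rightarrow> real ^ 'n" where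
  "exp_estimator I V \<theta> t =
     (ARG_MIN (\<lambda>x. 1 / \<theta> * ln (1 / real (card I) * (\<Sum>k\<in>I. exp (\<theta> * V k t x)))) x. True)"

end

theory Submission
  imports Defs
begin

text \<open>At a fixed time the value functions are \<open>V\<^sub>k x = (x - \<xi>\<^sub>k) \<bullet> M\<^sub>k (x - \<xi>\<^sub>k) + \<rho>\<^sub>k\<close> with positive definite
  \<open>M\<^sub>k = \<Pi>\<^sub>k\<^sup>-\<^sup>1\<close> and \<open>\<rho>\<^sub>k \<ge> 0\<close>. For \<open>\<theta> > 0\<close> the exponential estimator is the zero of
  \<open>G\<^sub>\<theta> x = (\<Sum>k. exp (\<theta> V\<^sub>k x) M\<^sub>k (x - \<xi>\<^sub>k))\<close>, and the mean estimator is the zero of \<open>G\<^sub>0\<close>, so that both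
  belong to one family with parameter \<open>\<theta> \<ge> 0\<close>. Since \<open>V\<^sub>k \<ge> 0\<close>, all weights are at least one and
  \<open>G\<^sub>\<theta>\<close> is strongly monotone with the coercivity constant \<open>c\<close> of the matrices, whatever \<open>\<theta>\<close> is
  (\<open>total_grad_strongly_monotone\<close>). Every continuity statement about zeros is a consequence of
  this one inequality: \<open>c \<bar>x - y\<bar> \<le> \<bar>G y\<bar>\<close> if \<open>G x = 0\<close>.
  
  The constant \<open>c\<close> is uniform in time because a Riccati solution that starts positive definite
  stays uniformly positive definite (\<open>riccati_solution_uniformly_positive\<close>) and is bounded.
  
  Small \<open>\<theta>\<close>. The observers and the residuals are indefinite integrals of integrable functions. For
  continuous integrands the zero \<open>x\<^sub>\<theta> t\<close> of \<open>G\<^sub>\<theta>\<close> is continuously differentiable in \<open>t\<close>, and its derivative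
  solves the linear system \<open>H v = - S\<close> obtained by differentiating \<open>G\<^sub>\<theta> = 0\<close>; here \<open>H\<close> is again
  coercive with constant \<open>c\<close>, and \<open>S\<close> is affine in the integrands. Approximating the integrands in
  \<open>L\<^sup>1\<close> shows that the same formula gives the weak derivative in general
  (\<open>critical_point_weak_deriv\<close>). Zeros and solutions of the linear system depend continuously on
  \<open>\<theta>\<close> down to and including \<open>\<theta> = 0\<close>, and for bounded \<open>\<theta>\<close> they are dominated by one integrable
  function. Dominated convergence gives the limit in \<open>W\<^sup>1\<^sup>,\<^sup>1\<close>.
  
  Large \<open>\<theta>\<close>. The exponential cost lies between \<open>max V\<^sub>k - ln N / \<theta>\<close> and \<open>max V\<^sub>k\<close>, and \<open>max V\<^sub>k\<close>
  grows at least like \<open>c / 2\<close> times the squared distance from its minimizer. Hence the exponential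
  and the minimax estimator differ by at most \<open>sqrt (2 ln N / (c \<theta>))\<close> at every time
  (\<open>exp_estimator_near_minimax\<close>), which gives convergence in every \<open>L\<^sup>p\<close>.\<close>

section \<open>Bilinear matrix operations, coercivity and implicit zeros\<close>

lemma has_vector_derivative_imp_continuous_on:
  assumes "\<And>t. t \<in> S \<Longrightarrow> (f has_vector_derivative f' t) (at t within S)"
  shows "continuous_on S f"
  using assms by (meson has_vector_derivative_continuous continuous_on_eq_continuous_within)

lemma norm_matrix_vector_mult_le:
  fixes A :: "real^'n^'m"
  shows "norm (A *v x) \<le> norm A * norm x"
proof -
  have "norm (A *v x) \<le> L2_set (\<lambda>i. norm (A $ i) * norm x) UNIV"
    unfolding norm_vec_def[of "A *v x"]
    by (rule L2_set_mono) (auto simp: matrix_vector_mul_component Cauchy_Schwarz_ineq2)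
  then show ?thesis
    by (simp add: norm_vec_def[of A] L2_set_left_distrib)
qed

lemma bounded_bilinear_matrix_vector_mult:
  "bounded_bilinear ((*v) :: real^'n^'m \<Rightarrow> real^'n \<Rightarrow> real^'m)"
proof
  show "\<exists>K. \<forall>(A :: real^'n^'m) x. norm (A *v x) \<le> norm A * norm x * K"
    by (rule exI[of _ 1]) (simp add: norm_matrix_vector_mult_le)
qed (simp_all add: matrix_vector_mult_add_rdistrib matrix_vector_right_distrib
      scaleR_matrix_vector_assoc matrix_vector_mult_scaleR)

interpretation matvec: bounded_bilinear "(*v) :: real^'n^'m \<Rightarrow> real^'n \<Rightarrow> real^'m"
  by (rule bounded_bilinear_matrix_vector_mult)

lemmas matvec_tendsto [tendsto_intros] = matvec.tendsto
lemmas matvec_continuous_on [continuous_intros] = matvec.continuous_on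

lemma bounded_bilinear_matrix_matrix_mult:
  "bounded_bilinear ((**) :: real^'n^'m \<Rightarrow> real^'k^'n \<Rightarrow> real^'k^'m)"
proof -
  have "bilinear ((**) :: real^'n^'m \<Rightarrow> real^'k^'n \<Rightarrow> real^'k^'m)"
    unfolding bilinear_def
    by (auto intro!: linearI simp: matrix_add_ldistrib scalar_matrix_assoc matrix_scalar_ac
        matrix_matrix_mult_def vec_eq_iff sum.distrib sum_distrib_left algebra_simps)
  then show ?thesis by (simp add: bilinear_conv_bounded_bilinear)
qed

interpretation matmul: bounded_bilinear "(**) :: real^'n^'m \<Rightarrow> real^'k^'n \<Rightarrow> real^'k^'m"
  by (rule bounded_bilinear_matrix_matrix_mult)

lemmas matmul_continuous_on [continuous_intros] = matmul.continuous_on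

lemma symmetric_inner:
  fixes M :: "real^'n^'n"
  assumes "transpose M = M"
  shows "(M *v x) \<bullet> y = x \<bullet> (M *v y)"
  by (metis assms dot_lmul_matrix transpose_matrix_vector)

lemma inner_transpose_matrix:
  fixes M :: "real^'n^'m"
  shows "(transpose M *v x) \<bullet> y = x \<bullet> (M *v y)"
  by (simp add: dot_lmul_matrix)

text \<open>The norm of a matrix is the Euclidean norm of its entries. An operator bound controls every entry,
  hence this norm up to the number of entries.\<close>
lemma norm_matrix_le:
  fixes A :: "real^'n^'m"
  assumes "\<And>x. norm (A *v x) \<le> b * norm x"
  shows "norm A \<le> real CARD('m) * real CARD('n) * b"
proof -
  have entry: "\<bar>A $ i $ j\<bar> \<le> b" for i j
  proof -
    have "\<bar>A $ i $ j\<bar> = \<bar>(A *v axis j 1) $ i\<bar>"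
      by (simp add: matrix_vector_mul_component inner_axis)
    also have "\<dots> \<le> norm (A *v axis j 1)" by (rule component_le_norm_cart)
    also have "\<dots> \<le> b" using assms[of "axis j 1"] by simp
    finally show ?thesis .
  qed
  have "norm A \<le> (\<Sum>i\<in>UNIV. norm (A $ i))" unfolding norm_vec_def by (rule L2_set_le_sum) simp
  also have "\<dots> \<le> (\<Sum>i\<in>UNIV. \<Sum>j\<in>UNIV. \<bar>A $ i $ j\<bar>)" by (intro sum_mono norm_le_l1_cart)
  also have "\<dots> \<le> (\<Sum>i\<in>(UNIV::'m set). \<Sum>j\<in>(UNIV::'n set). b)" by (intro sum_mono entry)
  finally show ?thesis by simp
qed

text \<open>The constant is the minimum of the quadratic form over the unit sphere, which is compact.\<close>
lemma pos_def_coercive: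
  fixes M :: "real^'n^'n"
  assumes "\<And>x. x \<noteq> 0 \<Longrightarrow> 0 < wnorm_sq M x"
  shows "\<exists>c>0. \<forall>x. c * (norm x)\<^sup>2 \<le> wnorm_sq M x"
proof -
  have "continuous_on (sphere 0 1) (wnorm_sq M)"
    unfolding wnorm_sq_def by (intro continuous_intros)
  moreover have "sphere (0::real^'n) 1 \<noteq> {}" by simp
  ultimately obtain z where z: "z \<in> sphere 0 1" "\<And>x. x \<in> sphere 0 1 \<Longrightarrow> wnorm_sq M z \<le> wnorm_sq M x"
    using continuous_attains_inf[OF compact_sphere] by blast
  show ?thesis
  proof (intro exI[of _ "wnorm_sq M z"] conjI allI)
    show "0 < wnorm_sq M z" using z assms[of z] by fastforce
    fix x
    show "wnorm_sq M z * (norm x)\<^sup>2 \<le> wnorm_sq M x"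
    proof (cases "x = 0")
      case False
      have "wnorm_sq M z \<le> wnorm_sq M (x /\<^sub>R norm x)" using False by (intro z) simp
      also have "\<dots> = wnorm_sq M x / (norm x)\<^sup>2"
        by (simp add: wnorm_sq_def matrix_vector_mult_scaleR power2_eq_square field_simps)
      finally show ?thesis using False by (simp add: field_simps)
    qed (simp add: wnorm_sq_def)
  qed
qed

lemma coercive_norm_ge:
  fixes M :: "real^'n^'n"
  assumes "c * (norm x)\<^sup>2 \<le> x \<bullet> y"
  shows "c * norm x \<le> norm (y :: real^'n)"
proof (cases "x = 0")
  case False
  have "(c * norm x) * norm x \<le> norm y * norm x"
    using assms norm_cauchy_schwarz[of x y] by (simp add: power2_eq_square mult_ac)
  then show ?thesis using False by simp
qed simp

lemma coercive_solution_exists: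
  fixes L :: "real^'n \<Rightarrow> real^'n"
  assumes "linear L" "0 < c" "\<And>v. c * (norm v)\<^sup>2 \<le> v \<bullet> L v"
  shows "\<exists>v. L v = b"
proof -
  have "inj L" unfolding linear_injective_0[OF assms(1)]
  proof (intro allI impI)
    fix v assume "L v = 0"
    then have "c * (norm v)\<^sup>2 \<le> 0" using assms(3)[of v] by simp
    with assms(2) show "v = 0" by (simp add: mult_le_0_iff)
  qed
  then have "surj L" using assms(1) by (intro linear_inj_imp_surj)
  then show ?thesis by (metis surj_def)
qed

text \<open>Expanding \<open>0 = G (s, x s) - G (t, x t)\<close> to first order gives
  \<open>L (x s - x t - (s - t) u) = o(\<bar>s - t\<bar> + \<bar>x s - x t\<bar>)\<close>. The lower bound on \<open>L\<close> lets the left-hand side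
  absorb the part of the error that is proportional to \<open>x s - x t\<close>.\<close>
lemma implicit_zero_has_vector_derivative:
  fixes G :: "real \<times> 'b::real_normed_vector \<Rightarrow> 'b" and x :: "real \<Rightarrow> 'b"
  assumes G: "(G has_derivative (\<lambda>(\<tau>, v). \<tau> *\<^sub>R a + L v)) (at (t, x t) within S \<times> UNIV)"
    and x: "(x \<longlongrightarrow> x t) (at t within S)"
    and zero: "\<And>s. s \<in> S \<Longrightarrow> G (s, x s) = 0"
    and t: "t \<in> S" and L: "linear L" and c: "0 < c" "\<And>v. c * norm v \<le> norm (L v)"
    and u: "L u = - a"
  shows "(x has_vector_derivative u) (at t within S)"
  unfolding has_vector_derivative_def has_derivative_within_alt
proof (intro conjI allI impI)
  show "bounded_linear (\<lambda>h. h *\<^sub>R u)" by (rule bounded_linear_scaleR_left)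
  fix e :: real assume e: "0 < e"
  \<comment> \<open>The first bound lets half of the left-hand side absorb the error, the second one yields the factor \<open>e\<close>.\<close>
  define e' where "e' = min (c / 2) (e * c / (2 * (1 + norm u)))"
  have nu: "0 < 1 + norm u" by (smt (verit) norm_ge_zero)
  have e': "0 < e'" unfolding e'_def using e c nu by (simp add: field_simps)
  from G e' obtain d where d: "0 < d"
    and Gd: "\<And>z. z \<in> S \<times> UNIV \<Longrightarrow> norm (z - (t, x t)) < d \<Longrightarrow>
      norm (G z - G (t, x t) - (\<lambda>(\<tau>, v). \<tau> *\<^sub>R a + L v) (z - (t, x t))) \<le> e' * norm (z - (t, x t))"
    unfolding has_derivative_within_alt by metis
  have "eventually (\<lambda>s. dist (x s) (x t) < d / 2) (at t within S)"
    using tendstoD[OF x, of "d/2"] d by simp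
  then obtain d1 where d1: "0 < d1"
    and xd: "\<And>s. s \<in> S \<Longrightarrow> s \<noteq> t \<Longrightarrow> dist s t < d1 \<Longrightarrow> dist (x s) (x t) < d / 2"
    unfolding eventually_at by auto
  show "\<exists>d>0. \<forall>y\<in>S. norm (y - t) < d \<longrightarrow> norm (x y - x t - (y - t) *\<^sub>R u) \<le> e * norm (y - t)"
  proof (intro exI[of _ "min d1 (d/2)"] conjI ballI impI)
    show "0 < min d1 (d/2)" using d d1 by simp
    fix s assume s: "s \<in> S" "norm (s - t) < min d1 (d/2)"
    let ?D = "x s - x t" and ?w = "x s - x t - (s - t) *\<^sub>R u"
    have near: "norm ?D < d/2"
      using xd[of s] s d by (cases "s = t") (auto simp: dist_norm)
    have pair: "norm (s - t, ?D) \<le> norm (s - t) + norm ?D" by (rule norm_Pair_le)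
    then have "norm ((s, x s) - (t, x t)) < d" using near s by simp
    then have "norm (G (s, x s) - G (t, x t) - (\<lambda>(\<tau>, v). \<tau> *\<^sub>R a + L v) ((s, x s) - (t, x t)))
        \<le> e' * norm ((s, x s) - (t, x t))" using s by (intro Gd) auto
    then have "norm ((s - t) *\<^sub>R a + L ?D) \<le> e' * norm (s - t, ?D)"
      using zero[OF s(1)] zero[OF t] by (simp flip: norm_minus_commute) (metis add_uminus_conv_diff minus_add_distrib norm_minus_cancel)
    also have "(s - t) *\<^sub>R a + L ?D = L ?w"
      using u by (simp add: linear_diff[OF L] linear_scale[OF L])
    finally have "c * norm ?w \<le> e' * norm (s - t, ?D)" using c(2) order_trans by blast
    also have "\<dots> \<le> e' * ((1 + norm u) * norm (s - t) + norm ?w)"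
    proof (intro mult_left_mono)
      have "norm ?D \<le> norm ?w + norm ((s - t) *\<^sub>R u)"
        by (metis diff_add_cancel norm_triangle_ineq)
      then show "norm (s - t, ?D) \<le> (1 + norm u) * norm (s - t) + norm ?w"
        using pair unfolding norm_scaleR real_norm_def distrib_right by argo
    qed (use e' in simp)
    also have "\<dots> \<le> e' * (1 + norm u) * norm (s - t) + c/2 * norm ?w"
    proof -
      have "e' \<le> c / 2" by (simp add: e'_def del: le_divide_eq_numeral1)
      then have "e' * norm ?w \<le> c/2 * norm ?w" by (intro mult_right_mono) simp_all
      then show ?thesis by (simp add: algebra_simps)
    qed
    finally have "c/2 * norm ?w \<le> e' * (1 + norm u) * norm (s - t)" by simp
    also have "\<dots> \<le> (e * c / (2 * (1 + norm u))) * (1 + norm u) * norm (s - t)"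
      by (intro mult_right_mono) (auto simp: e'_def nu less_imp_le)
    also have "\<dots> = c/2 * (e * norm (s - t))" using nu by (simp add: field_simps)
    finally show "norm ?w \<le> e * norm (s - t)" using c(1) by simp
  qed
qed

section \<open>Positivity of Riccati solutions\<close>

text \<open>The polynomial \<open>b (x + s y) (x + s y)\<close> in \<open>s\<close> is nonnegative and has no constant term, so its linear
  coefficient \<open>2 b x y\<close> vanishes.\<close>
lemma psd_isotropic_imp_kernel:
  fixes b :: "'a::real_vector \<Rightarrow> 'a \<Rightarrow> real"
  assumes "bilinear b" "\<And>u v. b u v = b v u" "\<And>u. 0 \<le> b u u" "b x x = 0"
  shows "b x y = 0"
proof (rule ccontr)
  assume nz: "b x y \<noteq> 0"
  \<comment> \<open>The summand one in the denominator keeps \<open>s\<close> well defined when \<open>b y y = 0\<close>.\<close>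
  define s where "s = - b x y / (1 + b y y)"
  have pos: "0 < 1 + b y y" using assms(3)[of y] by simp
  have "0 \<le> b (x + s *\<^sub>R y) (x + s *\<^sub>R y)" by (rule assms(3))
  also have "\<dots> = 2 * s * b x y + s\<^sup>2 * b y y"
    using assms(2)[of y x] assms(4)
    by (simp add: bilinear_ladd[OF assms(1)] bilinear_radd[OF assms(1)]
        bilinear_lmul[OF assms(1)] bilinear_rmul[OF assms(1)] power2_eq_square algebra_simps)
  also have "\<dots> \<le> 2 * s * b x y + s\<^sup>2 * (1 + b y y)" by (simp add: mult_left_mono)
  also have "\<dots> = - (b x y)\<^sup>2 / (1 + b y y)"
    using pos by (simp add: s_def power2_eq_square divide_simps)
  also have "\<dots> < 0" using nz pos by simp
  finally show False by simp
qed

lemma wnorm_sq_scaleR: "wnorm_sq M (a *\<^sub>R x) = a\<^sup>2 * wnorm_sq M x"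
  by (simp add: wnorm_sq_def matrix_vector_mult_scaleR power2_eq_square)

text \<open>A first-exit argument for \<open>X t - \<delta> t I\<close> with \<open>\<delta> t = c\<^sub>0 / 2 exp (- L t)\<close>. At the first time at which
  this matrix is not positive definite it is still positive semidefinite, and a unit vector \<open>x\<close> on which its
  form vanishes lies in its kernel, so the terms with \<open>M\<close> in the derivative of the quadratic form reduce to \<open>2 \<delta> x \<bullet> M x \<ge> - 2 K \<delta>\<close>. The
  decay of \<open>\<delta>\<close> contributes \<open>L \<delta>\<close> with \<open>L = 2 K + 1\<close>, so the derivative is strictly positive and the form was
  negative shortly before, a contradiction.\<close>
lemma lyapunov_uniformly_positive:
  fixes X M W :: "real \<Rightarrow> real^'n^'n"
  assumes der: "\<And>t. t \<in> {0..T} \<Longrightarrow>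
      (X has_vector_derivative M t ** X t + X t ** transpose (M t) + W t) (at t within {0..T})"
    and sym: "\<And>t. t \<in> {0..T} \<Longrightarrow> transpose (X t) = X t"
    and W: "\<And>t x. t \<in> {0..T} \<Longrightarrow> 0 \<le> wnorm_sq (W t) x"
    and M: "\<And>t. t \<in> {0..T} \<Longrightarrow> norm (M t) \<le> K" and K: "0 \<le> K"
    and X0: "sym_pos_def (X 0)"
  shows "\<exists>c>0. \<forall>t\<in>{0..T}. \<forall>x. c * (norm x)\<^sup>2 \<le> wnorm_sq (X t) x"
proof -
  obtain c0 where c0: "0 < c0" "\<And>x. c0 * (norm x)\<^sup>2 \<le> wnorm_sq (X 0) x"
    using pos_def_coercive[of "X 0"] X0 unfolding sym_pos_def_def wnorm_sq_def by blast
  define L where "L = 2 * K + 1"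
  define \<delta> where "\<delta> t = c0 / 2 * exp (- L * t)" for t
  define q where "q t x = wnorm_sq (X t) x - \<delta> t * (norm x)\<^sup>2" for t x
  have \<delta>pos: "0 < \<delta> t" for t using c0 by (simp add: \<delta>_def)
  have cont: "continuous_on {0..T} X"
    using der by (rule has_vector_derivative_imp_continuous_on)
  define Z where "Z = {p \<in> {0..T} \<times> sphere (0::real^'n) 1. q (fst p) (snd p) \<le> 0}"
  have cX: "continuous_on ({0..T} \<times> sphere (0::real^'n) 1) (\<lambda>p. X (fst p))"
    by (rule continuous_on_compose2[OF cont]) (auto intro!: continuous_intros)
  have contq: "continuous_on ({0..T} \<times> sphere (0::real^'n) 1) (\<lambda>p. q (fst p) (snd p))"
    unfolding q_def wnorm_sq_def \<delta>_def by (intro continuous_intros cX)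
  have "compact Z"
  proof -
    have "compact ({0..T} \<times> sphere (0::real^'n) 1)" by (intro compact_Times compact_Icc compact_sphere)
    moreover from this have "closed Z" unfolding Z_def
      by (intro continuous_on_closed_Collect_le[OF contq continuous_on_const] compact_imp_closed)
    moreover have "({0..T} \<times> sphere 0 1) \<inter> Z = Z" by (auto simp: Z_def)
    ultimately show ?thesis by (metis compact_Int_closed)
  qed
  have Zempty: "Z = {}"
  proof (rule ccontr)
    assume "Z \<noteq> {}"
    moreover have "compact (fst ` Z)"
      using \<open>compact Z\<close> by (intro compact_continuous_image continuous_intros)
    ultimately obtain t where tZ: "t \<in> fst ` Z" and tmin: "\<And>s. s \<in> fst ` Z \<Longrightarrow> t \<le> s"
      using compact_attains_inf[of "fst ` Z"] by blast
    then obtain x where tx: "t \<in> {0..T}" "norm x = 1" "q t x \<le> 0" by (auto simp: Z_def)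
    have before: "0 < q s y" if "s \<in> {0..T}" "s < t" "norm y = 1" for s y
    proof (rule ccontr)
      assume "\<not> 0 < q s y"
      then have "(s, y) \<in> Z" using that by (simp add: Z_def)
      then have "t \<le> s" by (intro tmin) force
      then show False using that by simp
    qed
    have "0 < q 0 y" if "norm y = 1" for y
      using c0(2)[of y] c0(1) that by (simp add: q_def \<delta>_def)
    then have t0: "0 < t" using tx by (cases "t = 0") (force, simp)
    have dX: "((\<lambda>s. q s y) has_real_derivative
        y \<bullet> ((M t ** X t + X t ** transpose (M t) + W t) *v y) + L * \<delta> t * (norm y)\<^sup>2) (at t within {0..T})" for y
    proof -
      have "((\<lambda>s. X s *v y) has_vector_derivative (M t ** X t + X t ** transpose (M t) + W t) *v y) (at t within {0..T})"
        using matvec.has_vector_derivative[OF der[OF tx(1)] has_vector_derivative_const[of y]] by simp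
      then have "((\<lambda>s. y \<bullet> (X s *v y)) has_vector_derivative y \<bullet> ((M t ** X t + X t ** transpose (M t) + W t) *v y)) (at t within {0..T})"
        by (rule bounded_linear.has_vector_derivative[OF bounded_linear_inner_right])
      then have "((\<lambda>s. y \<bullet> (X s *v y)) has_real_derivative y \<bullet> ((M t ** X t + X t ** transpose (M t) + W t) *v y)) (at t within {0..T})"
        by (simp add: has_real_derivative_iff_has_vector_derivative)
      then show ?thesis unfolding q_def wnorm_sq_def \<delta>_def
        by (auto intro!: derivative_eq_intros)
    qed
    have nonneg1: "0 \<le> q t y" if "norm y = 1" for y
    proof (rule ccontr)
      assume neg: "\<not> 0 \<le> q t y"
      have "continuous (at t within {0..T}) (\<lambda>s. q s y)"
        using dX DERIV_continuous by blast
      then have "\<forall>\<^sub>F s in at t within {0..T}. q s y < 0"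
        using neg by (intro order_tendstoD(2)[where a = 0]) (auto simp: continuous_within)
      then have "\<forall>\<^sub>F s in at t within {0..<t}. q s y < 0"
        using tx(1) by (auto elim!: filter_leD[rotated] intro!: at_le)
      moreover have "at t within {0..<t} \<noteq> bot"
        using t0 by (simp add: at_within_eq_bot_iff closure_atLeastLessThan)
      moreover have "\<forall>\<^sub>F s in at t within {0..<t}. s \<in> {0..<t}"
        by (simp add: eventually_at_filter)
      ultimately obtain s where "q s y < 0" "s \<in> {0..<t}"
        by (metis (mono_tags, lifting) eventually_conj eventually_happens)
      then show False using before[of s y] that tx(1) by auto
    qed
    define b where "b u v = u \<bullet> (X t *v v) - \<delta> t * (u \<bullet> v)" for u v
    have b: "b u u = q t u" for u by (simp add: b_def q_def wnorm_sq_def power2_norm_eq_inner)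
    have "b x (transpose (M t) *v x) = 0"
    proof (rule psd_isotropic_imp_kernel[where b = b])
      show "bilinear b" unfolding b_def bilinear_def
        by (auto intro!: linearI simp: algebra_simps inner_add_left inner_add_right matrix_vector_right_distrib matrix_vector_mult_scaleR)
      show "b u v = b v u" for u v
        using symmetric_inner[OF sym[OF tx(1)], of v u] by (simp add: b_def inner_commute)
      show "0 \<le> b u u" for u
      proof (cases "u = 0")
        case False
        have "0 \<le> q t (u /\<^sub>R norm u)" using False by (intro nonneg1) simp
        also have "\<dots> = q t u / (norm u)\<^sup>2"
          by (simp add: q_def wnorm_sq_scaleR power_divide divide_simps power2_eq_square)
        finally show ?thesis using False by (simp add: b zero_le_divide_iff)
      qed (simp add: b_def)
      show "b x x = 0" using tx nonneg1[of x] by (simp add: b)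
    qed
    then have Xx: "(transpose (M t) *v x) \<bullet> (X t *v x) = \<delta> t * (x \<bullet> (transpose (M t) *v x))"
      using symmetric_inner[OF sym[OF tx(1)], of x "transpose (M t) *v x"] by (simp add: b_def inner_commute)
    have "\<bar>x \<bullet> (transpose (M t) *v x)\<bar> = \<bar>x \<bullet> (M t *v x)\<bar>"
      by (metis inner_commute inner_transpose_matrix)
    also have "\<dots> \<le> norm x * (norm (M t) * norm x)"
      by (meson Cauchy_Schwarz_ineq2 mult_left_mono norm_ge_zero norm_matrix_vector_mult_le order_trans)
    also have "\<dots> \<le> K" using tx M[OF tx(1)] by simp
    finally have ge: "- K \<le> x \<bullet> (transpose (M t) *v x)" by simp
    have "x \<bullet> ((M t ** X t + X t ** transpose (M t) + W t) *v x)
        = 2 * ((transpose (M t) *v x) \<bullet> (X t *v x)) + wnorm_sq (W t) x"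
    proof -
      have "x \<bullet> (M t *v (X t *v x)) = (transpose (M t) *v x) \<bullet> (X t *v x)"
        by (simp only: inner_transpose_matrix)
      moreover have "x \<bullet> (X t *v (transpose (M t) *v x)) = (transpose (M t) *v x) \<bullet> (X t *v x)"
        by (metis inner_commute symmetric_inner[OF sym[OF tx(1)]])
      ultimately show ?thesis
        by (simp add: matrix_vector_mult_add_rdistrib inner_add_right wnorm_sq_def
            matrix_vector_mul_assoc[symmetric] del: transpose_matrix_vector)
    qed
    also have "\<dots> \<ge> 2 * (\<delta> t * (- K))"
      using W[OF tx(1), of x] ge \<delta>pos[of t] Xx by (smt (verit) mult_left_mono)
    finally have "0 < x \<bullet> ((M t ** X t + X t ** transpose (M t) + W t) *v x) + L * \<delta> t * (norm x)\<^sup>2"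
      using tx(2) \<delta>pos[of t] by (simp add: L_def algebra_simps)
    from has_real_derivative_pos_inc_left[OF dX this] obtain d where d: "0 < d"
      "\<And>h. 0 < h \<Longrightarrow> t - h \<in> {0..T} \<Longrightarrow> h < d \<Longrightarrow> q (t - h) x < q t x" by blast
    define h where "h = min (d/2) t"
    have "q (t - h) x < q t x" using d t0 tx(1) by (intro d) (auto simp: h_def)
    moreover have "0 < q (t - h) x" using d t0 tx by (intro before) (auto simp: h_def)
    ultimately show False using tx by simp
  qed
  show ?thesis
  proof (intro exI[of _ "c0 / 2 * exp (- L * T)"] conjI ballI allI)
    show "0 < c0 / 2 * exp (- L * T)" using c0 by simp
    fix t x assume t: "t \<in> {0..T}"
    show "c0 / 2 * exp (- L * T) * (norm x)\<^sup>2 \<le> wnorm_sq (X t) x"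
    proof (cases "x = 0")
      case False
      have "(t, x /\<^sub>R norm x) \<notin> Z" using Zempty by simp
      then have "0 < q t (x /\<^sub>R norm x)" using t False by (simp add: Z_def)
      also have "\<dots> = q t x / (norm x)\<^sup>2"
        by (simp add: q_def wnorm_sq_scaleR power_divide divide_simps power2_eq_square)
      finally have "0 < q t x" using False by (simp add: zero_less_divide_iff)
      then have "\<delta> t * (norm x)\<^sup>2 \<le> wnorm_sq (X t) x" by (simp add: q_def)
      moreover have "c0 / 2 * exp (- L * T) \<le> \<delta> t"
        using t c0 K by (simp add: \<delta>_def L_def mult_left_mono)
      ultimately show ?thesis by (smt (verit) mult_right_mono zero_le_power2)
    qed (simp add: wnorm_sq_def)
  qed
qed

text \<open>The function \<open>exp (- 2 K s) \<bar>D s\<bar>\<^sup>2\<close> is nonincreasing and vanishes at \<open>0\<close>.\<close>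
lemma gronwall_zero:
  fixes D D' :: "real \<Rightarrow> 'a::euclidean_space"
  assumes der: "\<And>t. t \<in> {0..T} \<Longrightarrow> (D has_vector_derivative D' t) (at t within {0..T})"
    and bound: "\<And>t. t \<in> {0..T} \<Longrightarrow> norm (D' t) \<le> K * norm (D t)"
    and D0: "D 0 = 0" and t: "t \<in> {0..T}"
  shows "D t = 0"
proof -
  define f where "f s = exp (- (2 * K) * s) * (D s \<bullet> D s)" for s
  have df: "(f has_real_derivative exp (- (2 * K) * s) * (2 * (D s \<bullet> D' s) - 2 * K * (D s \<bullet> D s))) (at s within {0..T})"
    if s: "s \<in> {0..T}" for s
  proof -
    have "((\<lambda>s. D s \<bullet> D s) has_real_derivative D s \<bullet> D' s + D' s \<bullet> D s) (at s within {0..T})"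
      unfolding has_real_derivative_iff_has_vector_derivative
      by (rule bounded_bilinear.has_vector_derivative[OF bounded_bilinear_inner der[OF s] der[OF s]])
    then show ?thesis unfolding f_def
      by (auto intro!: derivative_eq_intros simp: inner_commute algebra_simps)
  qed
  have "f t \<le> f 0"
  proof (rule DERIV_nonpos_imp_decreasing_open[where f = f and a = 0 and b = t])
    show "0 \<le> t" using t by simp
    show "continuous_on {0..t} f"
      using DERIV_continuous_on[OF df] t by (auto intro: continuous_on_subset)
    fix s assume s: "0 < s" "s < t"
    show "\<exists>y. (f has_real_derivative y) (at s) \<and> y \<le> 0"
    proof (intro exI conjI)
      have "at s within {0..T} = at s" using s t by (intro at_within_interior) auto
      then show "(f has_real_derivative exp (- (2 * K) * s) * (2 * (D s \<bullet> D' s) - 2 * K * (D s \<bullet> D s))) (at s)"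
        using df[of s] s t by simp
      have "D s \<bullet> D' s \<le> norm (D s) * (K * norm (D s))"
        using bound[of s] s t norm_cauchy_schwarz[of "D s" "D' s"]
        by (smt (verit) atLeastAtMost_iff mult_left_mono norm_ge_zero)
      also have "\<dots> = K * (D s \<bullet> D s)" by (simp add: dot_square_norm power2_eq_square)
      finally show "exp (- (2 * K) * s) * (2 * (D s \<bullet> D' s) - 2 * K * (D s \<bullet> D s)) \<le> 0"
        by (intro mult_nonneg_nonpos) auto
    qed
  qed
  then have "exp (- (2 * K) * t) * (D t \<bullet> D t) \<le> 0" by (simp add: f_def D0)
  then have "D t \<bullet> D t \<le> 0" by (simp add: mult_le_0_iff)
  then show ?thesis by (metis inner_ge_zero inner_eq_zero_iff order_antisym)
qed

lemma transpose_add: "transpose (A + B) = transpose A + transpose B"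
  and transpose_diff: "transpose (A - B) = transpose A - transpose (B :: real^'n^'m)"
  by (simp_all add: transpose_def vec_eq_iff)

lemma bounded_linear_transpose: "bounded_linear (transpose :: real^'n^'m \<Rightarrow> real^'m^'n)"
  unfolding linear_conv_bounded_linear[symmetric]
  by (auto intro!: linearI simp: transpose_add transpose_scalar)

lemma invertible_coercive:
  fixes M :: "real^'n^'n"
  assumes "0 < c" "\<And>x. c * (norm x)\<^sup>2 \<le> wnorm_sq M x"
  shows "M ** matrix_inv M = mat 1" "matrix_inv M ** M = mat 1"
proof -
  have "inj ((*v) M)"
    unfolding linear_injective_0[OF matrix_vector_mul_linear]
  proof (intro allI impI)
    fix x assume "M *v x = 0"
    then have "c * (norm x)\<^sup>2 \<le> 0" using assms(2)[of x] by (simp add: wnorm_sq_def)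
    with assms(1) show "x = 0" by (simp add: mult_le_0_iff)
  qed
  then obtain N where N: "N ** M = mat 1" by (metis matrix_left_invertible_injective)
  then have "\<exists>N. M ** N = mat 1 \<and> N ** M = mat 1" by (metis matrix_left_right_inverse)
  then have "M ** matrix_inv M = mat 1 \<and> matrix_inv M ** M = mat 1"
    unfolding matrix_inv_def by (rule someI_ex)
  then show "M ** matrix_inv M = mat 1" "matrix_inv M ** M = mat 1" by auto
qed

lemma symmetric_matrix_inv:
  fixes M :: "real^'n^'n"
  assumes "0 < c" "\<And>x. c * (norm x)\<^sup>2 \<le> wnorm_sq M x" "transpose M = M"
  shows "transpose (matrix_inv M) = matrix_inv M"
proof -
  note inv = invertible_coercive[OF assms(1,2)]
  have "transpose (matrix_inv M) ** M = mat 1"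
    by (metis assms(3) inv(1) matrix_transpose_mul transpose_mat)
  then show ?thesis by (metis inv(1) matrix_mul_assoc matrix_mul_lid matrix_mul_rid)
qed

text \<open>Substitute \<open>x = M z\<close>: the form of the inverse at \<open>x\<close> equals the form of \<open>M\<close> at \<open>z\<close>, and
  \<open>\<bar>x\<bar> \<le> K \<bar>z\<bar>\<close>.\<close>
lemma coercive_matrix_inv:
  fixes M :: "real^'n^'n"
  assumes c: "0 < c" "\<And>x. c * (norm x)\<^sup>2 \<le> wnorm_sq M x" and K: "norm M \<le> K"
  shows "norm (matrix_inv M *v x) \<le> norm x / c"
    and "0 < K" and "c / K\<^sup>2 * (norm x)\<^sup>2 \<le> wnorm_sq (matrix_inv M) x"
proof -
  let ?z = "matrix_inv M *v x"
  have Mz: "M *v ?z = x"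
    by (simp add: matrix_vector_mul_assoc invertible_coercive[OF c])
  have "c * norm ?z \<le> norm x"
    using coercive_norm_ge[of c ?z "M *v ?z"] c(2)[of ?z] by (simp add: wnorm_sq_def Mz)
  then show "norm ?z \<le> norm x / c" using c(1) by (simp add: field_simps)
  have "M \<noteq> 0"
  proof
    assume "M = 0"
    then have "c * (norm (axis undefined 1 :: real^'n))\<^sup>2 \<le> 0"
      using c(2)[of "axis undefined 1"] by (simp add: wnorm_sq_def)
    then show False using c(1) by simp
  qed
  then show "0 < K" using K by (smt (verit) zero_less_norm_iff)
  have "norm x \<le> K * norm ?z"
    using norm_matrix_vector_mult_le[of M ?z] K by (smt (verit) Mz mult_right_mono norm_ge_zero)
  then have "(norm x)\<^sup>2 \<le> K\<^sup>2 * (norm ?z)\<^sup>2" by (metis norm_ge_zero power_mono power_mult_distrib)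
  then have "c / K\<^sup>2 * (norm x)\<^sup>2 \<le> c * (norm ?z)\<^sup>2"
    using c(1) \<open>0 < K\<close> by (simp add: field_simps)
  also have "\<dots> \<le> wnorm_sq M ?z" by (rule c(2))
  also have "\<dots> = wnorm_sq (matrix_inv M) x" by (simp add: wnorm_sq_def Mz inner_commute)
  finally show "c / K\<^sup>2 * (norm x)\<^sup>2 \<le> wnorm_sq (matrix_inv M) x" .
qed

lemma sym_pos_def_matrix_inv:
  assumes "sym_pos_def M"
  shows "sym_pos_def (matrix_inv M)"
proof -
  obtain c where c: "0 < c" "\<And>x. c * (norm x)\<^sup>2 \<le> wnorm_sq M x"
    using pos_def_coercive[of M] assms unfolding sym_pos_def_def wnorm_sq_def by blast
  have K: "0 < norm M" using coercive_matrix_inv(2)[OF c order_refl] .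
  show ?thesis unfolding sym_pos_def_def
  proof (intro conjI allI impI)
    show "transpose (matrix_inv M) = matrix_inv M"
      using symmetric_matrix_inv[OF c] assms by (simp add: sym_pos_def_def)
    fix x :: "real^'a" assume "x \<noteq> 0"
    then have "0 < c / (norm M)\<^sup>2 * (norm x)\<^sup>2" using c K by simp
    then show "0 < x \<bullet> (matrix_inv M *v x)"
      using coercive_matrix_inv(3)[OF c order_refl, of x] by (simp add: wnorm_sq_def)
  qed
qed

text \<open>The inverse is the curve of zeros of \<open>V \<mapsto> X s V - 1\<close>. Its continuity comes from the identity
  \<open>X s\<^sup>-\<^sup>1 - X t\<^sup>-\<^sup>1 = X s\<^sup>-\<^sup>1 (X t - X s) X t\<^sup>-\<^sup>1\<close> and the uniform bound on the inverses.\<close>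
lemma matrix_inv_has_vector_derivative:
  fixes X :: "real \<Rightarrow> real^'n^'n"
  assumes c: "0 < c" "\<And>s x. s \<in> S \<Longrightarrow> c * (norm x)\<^sup>2 \<le> wnorm_sq (X s) x"
    and der: "(X has_vector_derivative X') (at t within S)" and t: "t \<in> S"
  shows "((\<lambda>s. matrix_inv (X s)) has_vector_derivative - (matrix_inv (X t) ** X' ** matrix_inv (X t)))
    (at t within S)"
proof -
  let ?P = "\<lambda>s. matrix_inv (X s)"
  define k where "k = real CARD('n) * real CARD('n) * (1 / c)"
  note inv = invertible_coercive[OF c(1) c(2)]
  have bnd: "norm (?P s) \<le> k" if "s \<in> S" for s
    unfolding k_def using coercive_matrix_inv(1)[OF c(1) c(2)[OF that] order_refl]
    by (intro norm_matrix_le) simp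
  obtain K where K: "0 < K" "\<And>(A :: real^'n^'n) (B :: real^'n^'n). norm (A ** B) \<le> norm A * norm B * K"
    using matmul.pos_bounded by blast
  have Xt: "(X \<longlongrightarrow> X t) (at t within S)"
    using has_vector_derivative_continuous[OF der] by (simp add: continuous_within)
  have lim: "(?P \<longlongrightarrow> ?P t) (at t within S)"
  proof (rule Lim_null_comparison[where f = "\<lambda>s. ?P s - ?P t", THEN LIM_zero_cancel])
    show "\<forall>\<^sub>F s in at t within S. norm (?P s - ?P t) \<le> k * norm (X t - X s) * K * k * K"
    proof (rule eventually_mono[of "\<lambda>s. s \<in> S"])
      show "\<forall>\<^sub>F s in at t within S. s \<in> S" by (simp add: eventually_at_filter)
      fix s assume s: "s \<in> S"
      have "?P s ** (X t - X s) ** ?P t = ?P s ** (X t ** ?P t) - (?P s ** X s) ** ?P t"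
        by (simp add: matmul.diff_left matmul.diff_right matrix_mul_assoc)
      then have "?P s - ?P t = ?P s ** (X t - X s) ** ?P t" using inv[OF s] inv[OF t] by simp
      also have "norm \<dots> \<le> norm (?P s ** (X t - X s)) * norm (?P t) * K" by (rule K(2))
      also have "\<dots> \<le> (k * norm (X t - X s) * K) * k * K"
      proof (intro mult_right_mono mult_mono)
        show "norm (?P s ** (X t - X s)) \<le> k * norm (X t - X s) * K"
          by (rule order_trans[OF K(2)]) (intro mult_right_mono bnd s; use K in simp)
        show "0 \<le> k * norm (X t - X s) * K" using K(1) c(1) by (simp add: k_def)
      qed (use K bnd t in auto)
      finally show "norm (?P s - ?P t) \<le> k * norm (X t - X s) * K * k * K" .
    qed
    show "((\<lambda>s. k * norm (X t - X s) * K * k * K) \<longlongrightarrow> 0) (at t within S)"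
      by (rule tendsto_eq_intros Xt | simp)+
  qed
  have k0: "0 < k" using c(1) by (simp add: k_def)
  show ?thesis
  proof (rule implicit_zero_has_vector_derivative[where G = "\<lambda>(s, V). X s ** V - mat 1"
        and a = "X' ** ?P t" and L = "\<lambda>V. X t ** V" and c = "1 / (k * K)" and x = ?P])
    have "((\<lambda>z. X (fst z) ** snd z - mat 1) has_derivative
        (\<lambda>h. X t ** snd h + (fst h *\<^sub>R X') ** ?P t - 0)) (at (t, ?P t) within S \<times> UNIV)"
    proof (rule has_derivative_diff)
      have "((\<lambda>z. X (fst z)) has_derivative (\<lambda>h. fst h *\<^sub>R X')) (at (t, ?P t) within S \<times> UNIV)"
      proof (rule has_derivative_in_compose[where g = X and g' = "\<lambda>h. h *\<^sub>R X'", OF has_derivative_fst[OF has_derivative_ident]])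
        have "fst ` (S \<times> (UNIV :: (real^'n^'n) set)) = S" by force
        then show "(X has_derivative (\<lambda>h. h *\<^sub>R X')) (at (fst (t, ?P t)) within (fst ` (S \<times> (UNIV :: (real^'n^'n) set))))"
          using der by (simp add: has_vector_derivative_def)
      qed
      from matmul.FDERIV[OF this has_derivative_snd[OF has_derivative_ident]]
      show "((\<lambda>z. X (fst z) ** snd z) has_derivative (\<lambda>h. X t ** snd h + (fst h *\<^sub>R X') ** ?P t)) (at (t, ?P t) within S \<times> UNIV)"
        by simp
    qed (rule has_derivative_const)
    then show "((\<lambda>(s, V). X s ** V - mat 1) has_derivative (\<lambda>(\<tau>, V). \<tau> *\<^sub>R (X' ** ?P t) + X t ** V)) (at (t, ?P t) within S \<times> UNIV)"
      by (simp add: case_prod_unfold matmul.scaleR_left add.commute)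
    show "linear (\<lambda>V :: real^'n^'n. X t ** V)" by (rule bounded_linear.linear[OF matmul.bounded_linear_right])
    show "1 / (k * K) * norm V \<le> norm (X t ** V)" for V :: "real^'n^'n"
    proof -
      have "norm V = norm (?P t ** (X t ** V))" by (simp add: matrix_mul_assoc inv[OF t])
      also have "\<dots> \<le> k * norm (X t ** V) * K"
        by (rule order_trans[OF K(2)]) (intro mult_right_mono bnd t; use K in simp)
      finally show ?thesis using k0 K(1) by (simp add: field_simps)
    qed
    show "X t ** - (?P t ** X' ** ?P t) = - (X' ** ?P t)"
    proof -
      have "X t ** (?P t ** X' ** ?P t) = X' ** ?P t" by (simp add: matrix_mul_assoc inv[OF t])
      then show ?thesis by (simp add: matmul.minus_right)
    qed
    show "(case (s, ?P s) of (s, V) \<Rightarrow> X s ** V - mat 1) = 0" if "s \<in> S" for s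
      using inv[OF that] by simp
  qed (use lim t k0 K(1) in auto)
qed

text \<open>The transpose of a solution solves the same equation with the same initial value. Both stay in a
  bounded set, where the right-hand side is Lipschitz, so their difference vanishes by Gronwall.\<close>
lemma riccati_solution_symmetric:
  fixes Pm :: "real \<Rightarrow> real^'n^'n" and B :: "real^'m^'n" and C :: "real^'n^'r"
  assumes ric: "riccati_solution T A B C \<Gamma> R Q Pm"
    and sym: "transpose \<Gamma> = \<Gamma>" "transpose R = R" "transpose (matrix_inv Q) = matrix_inv Q"
    and t: "t \<in> {0..T}"
  shows "transpose (Pm t) = Pm t"
proof -
  define S where "S = transpose C ** matrix_inv Q ** C"
  define W where "W = B ** R ** transpose B"
  define F where "F X = A ** X + X ** transpose A - X ** S ** X + W" for X :: "real^'n^'n"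
  have S: "transpose S = S" using sym by (simp add: S_def matrix_transpose_mul matrix_mul_assoc)
  have W: "transpose W = W" using sym by (simp add: W_def matrix_transpose_mul matrix_mul_assoc)
  have der: "(Pm has_vector_derivative F (Pm s)) (at s within {0..T})" if "s \<in> {0..T}" for s
    using ric that unfolding riccati_solution_def F_def S_def W_def by (simp add: matrix_mul_assoc)
  have tF: "transpose (F X) = F (transpose X)" for X
    by (simp add: F_def transpose_add transpose_diff matrix_transpose_mul matrix_mul_assoc S W)
  have der': "((\<lambda>s. transpose (Pm s)) has_vector_derivative F (transpose (Pm s))) (at s within {0..T})"
    if "s \<in> {0..T}" for s
    using bounded_linear.has_vector_derivative[OF bounded_linear_transpose der[OF that]] by (simp add: tF)
  have cont: "continuous_on {0..T} Pm"
    using der by (rule has_vector_derivative_imp_continuous_on)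
  then have "compact (Pm ` {0..T})" by (intro compact_continuous_image compact_Icc)
  then obtain b where b: "\<And>s. s \<in> {0..T} \<Longrightarrow> norm (Pm s) \<le> b"
    by (meson bounded_iff compact_imp_bounded imageI)
  obtain K1 where K1: "0 < K1" "\<And>X :: real^'n^'n. norm (transpose X) \<le> norm X * K1"
    using bounded_linear.pos_bounded[OF bounded_linear_transpose] by blast
  obtain K where K: "0 < K" "\<And>(X :: real^'n^'n) (Y :: real^'n^'n). norm (X ** Y) \<le> norm X * norm Y * K"
    using matmul.pos_bounded by blast
  define k where "k = norm A * K + norm (transpose A) * K + b * norm S * K * K + norm S * (b * K1) * K * K"
  have "Pm t - transpose (Pm t) = 0"
  proof (rule gronwall_zero[where T = T and K = k
        and D' = "\<lambda>s. F (Pm s) - F (transpose (Pm s))"])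
    fix s assume s: "s \<in> {0..T}"
    show "((\<lambda>s. Pm s - transpose (Pm s)) has_vector_derivative F (Pm s) - F (transpose (Pm s))) (at s within {0..T})"
      by (intro has_vector_derivative_diff der der' s)
    define X where "X = Pm s"
    define D where "D = X - transpose X"
    have bX: "norm X \<le> b" using b[OF s] by (simp add: X_def)
    then have bXt: "norm (transpose X) \<le> b * K1"
      using K1 by (meson mult_right_mono less_imp_le order_trans)
    have "F X - F (transpose X) = A ** D + D ** transpose A - X ** S ** D - D ** (S ** transpose X)"
      by (simp add: F_def D_def matmul.diff_left matmul.diff_right matrix_mul_assoc)
    also have "norm \<dots> \<le> norm (A ** D) + norm (D ** transpose A) + norm (X ** S ** D) + norm (D ** (S ** transpose X))"
      by (smt (verit) norm_triangle_ineq norm_triangle_ineq4)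
    also have "\<dots> \<le> norm A * norm D * K + norm D * norm (transpose A) * K
        + (b * norm S * K) * norm D * K + norm D * (norm S * (b * K1) * K) * K"
    proof (intro add_mono)
      have "norm (X ** S) \<le> b * norm S * K"
        by (rule order_trans[OF K(2)]) (intro mult_right_mono bX; use K in simp)
      then show "norm (X ** S ** D) \<le> (b * norm S * K) * norm D * K"
        by (rule order_trans[OF K(2) mult_right_mono[OF mult_right_mono]]) (use K in simp_all)
      have "norm (S ** transpose X) \<le> norm S * (b * K1) * K"
        by (rule order_trans[OF K(2)]) (intro mult_right_mono mult_left_mono bXt; use K in simp)
      then show "norm (D ** (S ** transpose X)) \<le> norm D * (norm S * (b * K1) * K) * K"
        by (rule order_trans[OF K(2) mult_right_mono[OF mult_left_mono]]) (use K in simp_all)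
    qed (rule K(2))+
    also have "\<dots> = k * norm D" by (simp add: k_def algebra_simps)
    finally show "norm (F (Pm s) - F (transpose (Pm s))) \<le> k * norm (Pm s - transpose (Pm s))"
      by (simp add: X_def D_def)
  next
    show "Pm 0 - transpose (Pm 0) = 0" using ric sym by (simp add: riccati_solution_def)
  qed (rule t)
  then show ?thesis by simp
qed

text \<open>Splitting the quadratic term as \<open>\<Pi> S \<Pi> = (\<Pi> S / 2) \<Pi> + \<Pi> (S \<Pi> / 2)\<close> turns the Riccati equation into
  \<open>\<Pi>' = M \<Pi> + \<Pi> M\<^sup>T + B R B\<^sup>T\<close> with \<open>M = A - \<Pi> S / 2\<close>, a Lyapunov equation with positive semidefinite forcing.\<close>
lemma riccati_solution_uniformly_positive:
  fixes Pm :: "real \<Rightarrow> real^'n^'n" and B :: "real^'m^'n" and C :: "real^'n^'r"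
  assumes ric: "riccati_solution T A B C \<Gamma> R Q Pm"
    and pd: "sym_pos_def \<Gamma>" "sym_pos_def R" "sym_pos_def Q"
  shows "\<exists>c>0. \<forall>t\<in>{0..T}. \<forall>x. c * (norm x)\<^sup>2 \<le> wnorm_sq (Pm t) x"
proof -
  define S where "S = transpose C ** matrix_inv Q ** C"
  have symQ: "transpose (matrix_inv Q) = matrix_inv Q"
    using sym_pos_def_matrix_inv[OF pd(3)] by (simp add: sym_pos_def_def)
  have S: "transpose S = S" using symQ by (simp add: S_def matrix_transpose_mul matrix_mul_assoc)
  have sym: "transpose (Pm t) = Pm t" if "t \<in> {0..T}" for t
    using pd symQ by (intro riccati_solution_symmetric[OF ric _ _ _ that]) (auto simp: sym_pos_def_def)
  define M where "M t = A - (1/2) *\<^sub>R (Pm t ** S)" for t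
  have der0: "(Pm has_vector_derivative A ** Pm t + Pm t ** transpose A
        - Pm t ** S ** Pm t + B ** R ** transpose B) (at t within {0..T})" if "t \<in> {0..T}" for t
    using ric that unfolding riccati_solution_def S_def by (simp add: matrix_mul_assoc)
  have cont: "continuous_on {0..T} Pm"
    using der0 by (rule has_vector_derivative_imp_continuous_on)
  have "continuous_on {0..T} M" unfolding M_def by (intro continuous_intros cont)
  then have "compact (M ` {0..T})" by (intro compact_continuous_image compact_Icc)
  then obtain K where K: "\<And>s. s \<in> {0..T} \<Longrightarrow> norm (M s) \<le> K"
    by (meson bounded_iff compact_imp_bounded imageI)
  show ?thesis
  proof (rule lyapunov_uniformly_positive[where M = M and W = "\<lambda>_. B ** R ** transpose B" and K = "max K 0"])
    fix t assume t: "t \<in> {0..T}"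
    have "M t ** Pm t + Pm t ** transpose (M t) = A ** Pm t + Pm t ** transpose A - Pm t ** S ** Pm t"
    proof -
      have tM: "transpose (M t) = transpose A - (1/2) *\<^sub>R (S ** Pm t)"
        by (simp add: M_def transpose_diff transpose_scalar matrix_transpose_mul S sym[OF t])
      have half: "(1/2) *\<^sub>R Z + (1/2) *\<^sub>R Z = Z" for Z :: "real^'n^'n"
        by (simp flip: scaleR_add_left)
      have "M t ** Pm t + Pm t ** transpose (M t) = A ** Pm t + Pm t ** transpose A
          - ((1/2) *\<^sub>R (Pm t ** S ** Pm t) + (1/2) *\<^sub>R (Pm t ** S ** Pm t))"
        unfolding tM unfolding M_def
        by (simp add: matmul.diff_left matmul.diff_right matmul.scaleR_left matmul.scaleR_right matrix_mul_assoc)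
      then show ?thesis by (simp only: half)
    qed
    then show "(Pm has_vector_derivative M t ** Pm t + Pm t ** transpose (M t) + B ** R ** transpose B) (at t within {0..T})"
      using der0[OF t] by simp
    show "0 \<le> wnorm_sq (B ** R ** transpose B) x" for x
    proof -
      have "wnorm_sq (B ** R ** transpose B) x = wnorm_sq R (transpose B *v x)"
        unfolding wnorm_sq_def matrix_vector_mul_assoc[symmetric] by (simp only: inner_transpose_matrix)
      then show ?thesis using pd(2)
        by (cases "transpose B *v x = 0") (auto simp: sym_pos_def_def wnorm_sq_def less_imp_le)
    qed
    show "norm (M t) \<le> max K 0" using K[OF t] by simp
  next
    show "sym_pos_def (Pm 0)" using ric pd by (simp add: riccati_solution_def)
  qed (use sym in auto)
qed

section \<open>Weak derivatives and absolutely continuous functions on an interval\<close>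

lemmas borel_measurable_norm_comp = measurable_compose[OF _ borel_measurable_norm]

text \<open>The function spaces live on the open interval, while indefinite integrals and continuous
  representatives are best handled on the closed one. The end points are a null set, so that
  integrability and integrals agree.\<close>
lemma integrable_lebesgue_on_Ioo_iff:
  fixes f :: "real \<Rightarrow> 'b::euclidean_space"
  shows "integrable (lebesgue_on {a<..<b}) f \<longleftrightarrow> f absolutely_integrable_on {a..b}"
  unfolding absolutely_integrable_on_Icc_iff_Ioo by (simp add: set_integrable_def integrable_restrict_space)

lemma integral_lebesgue_on_Ioo:
  fixes f :: "real \<Rightarrow> 'b::euclidean_space"
  assumes "f absolutely_integrable_on {a..b}"
  shows "integral\<^sup>L (lebesgue_on {a<..<b}) f = integral {a..b} f"
  using assms lebesgue_integral_eq_integral[of "{a<..<b}" f]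
  by (simp add: integrable_lebesgue_on_Ioo_iff integral_open_interval_real)

lemma norm_diff_integrable:
  fixes v w :: "real \<Rightarrow> 'b::euclidean_space"
  assumes "v absolutely_integrable_on S" "w absolutely_integrable_on S"
  shows "(\<lambda>t. norm (v t - w t)) integrable_on S"
  using set_integral_diff(1)[OF assms] by (simp add: absolutely_integrable_on_def)

text \<open>Truncation at a large radius \<open>m\<close> (the nearest point of the ball) changes \<open>f\<close> little in \<open>L\<^sup>1\<close>. A
  measurable function is almost everywhere a limit of continuous functions; truncating these keeps
  them continuous and makes them bounded, so that dominated convergence applies.\<close>
lemma L1_approx_continuous:
  fixes f :: "real \<Rightarrow> 'b::euclidean_space"
  assumes f: "f absolutely_integrable_on {a..b}" and e: "0 < e"
  shows "\<exists>g. continuous_on UNIV g \<and> integral {a..b} (\<lambda>t. norm (g t - f t)) < e"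
proof -
  let ?S = "{a..b}"
  have fm: "f \<in> borel_measurable (lebesgue_on ?S)"
    by (rule absolutely_integrable_imp_borel_measurable[OF f]) simp
  have fi: "(\<lambda>t. norm (f t)) integrable_on ?S" using f by (simp add: absolutely_integrable_on_def)
  define tr :: "nat \<Rightarrow> 'b \<Rightarrow> 'b" where "tr m = closest_point (cball 0 (real m))" for m
  have trc: "continuous_on UNIV (tr m)" for m
    unfolding tr_def by (intro continuous_on_closest_point) auto
  have trn: "norm (tr m v) \<le> real m" for m v
    using closest_point_in_set[of "cball 0 (real m)" v] by (simp add: tr_def dist_norm)
  have trd: "norm (tr m v - v) \<le> norm v" for m v
    using closest_point_le[of "cball 0 (real m)" 0 v] by (simp add: tr_def dist_norm norm_minus_commute)
  have tri: "norm v \<le> real m \<Longrightarrow> tr m v = v" for m v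
    unfolding tr_def by (intro closest_point_self) simp
  have trm: "(\<lambda>t. tr m (h t)) \<in> borel_measurable (lebesgue_on ?S)"
    if "h \<in> borel_measurable (lebesgue_on ?S)" for h m
    using measurable_compose[OF that borel_measurable_continuous_onI[OF trc]] by simp
  have di2: "(\<lambda>t. norm (tr m (f t) - f t)) integrable_on ?S" for m
  proof (rule measurable_bounded_by_integrable_imp_integrable[OF _ fi])
    show "(\<lambda>t. norm (tr m (f t) - f t)) \<in> borel_measurable (lebesgue_on ?S)"
      by (rule borel_measurable_norm_comp[OF borel_measurable_diff[OF trm[OF fm] fm]])
  qed (use trd in auto)
  have "(\<lambda>m. integral ?S (\<lambda>t. norm (tr m (f t) - f t))) \<longlonglongrightarrow> integral ?S (\<lambda>t. 0)"
  proof (rule dominated_convergence(2)[OF _ fi])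
    show "norm (norm (tr m (f t) - f t)) \<le> norm (f t)" for m t using trd by simp
    show "(\<lambda>t. norm (tr m (f t) - f t)) integrable_on ?S" for m by (rule di2)
    show "(\<lambda>m. norm (tr m (f t) - f t)) \<longlonglongrightarrow> 0" for t
    proof (rule tendsto_eventually)
      show "\<forall>\<^sub>F m in sequentially. norm (tr m (f t) - f t) = 0"
        using eventually_ge_at_top[of "nat \<lceil>norm (f t)\<rceil>"]
        by eventually_elim (simp add: tri nat_ceiling_le_eq)
    qed
  qed
  from order_tendstoD(2)[OF this, of "e / 2"] e
  have "\<forall>\<^sub>F m in sequentially. integral ?S (\<lambda>t. norm (tr m (f t) - f t)) < e / 2" by simp
  from eventually_happens'[OF sequentially_bot this]
  obtain m where m: "integral ?S (\<lambda>t. norm (tr m (f t) - f t)) < e / 2" ..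
  have "f measurable_on ?S" using fm by (simp add: measurable_on_iff_borel_measurable)
  then obtain N g where N: "negligible N" and g: "\<And>n. continuous_on UNIV (g n)"
    "\<And>t. t \<notin> N \<Longrightarrow> (\<lambda>n. g n t) \<longlonglongrightarrow> (if t \<in> ?S then f t else 0)"
    unfolding measurable_on_def by blast
  define h where "h n t = tr m (g n t)" for n t
  have hc: "continuous_on UNIV (h n)" for n
    unfolding h_def by (rule continuous_on_compose2[OF trc g(1)]) simp
  have hm: "h n \<in> borel_measurable (lebesgue_on ?S)" for n
    using hc by (intro continuous_imp_measurable_on_sets_lebesgue) (auto intro: continuous_on_subset)
  have di: "(\<lambda>t. norm (h n t - tr m (f t))) integrable_on ?S" for n
  proof (rule measurable_bounded_by_integrable_imp_integrable)
    show "(\<lambda>t. norm (h n t - tr m (f t))) \<in> borel_measurable (lebesgue_on ?S)"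
      by (rule borel_measurable_norm_comp[OF borel_measurable_diff[OF hm trm[OF fm]]])
    show "(\<lambda>t. 2 * real m) integrable_on ?S" by (rule integrable_const_ivl)
    show "norm (norm (h n t - tr m (f t))) \<le> 2 * real m" for t
      using norm_triangle_ineq4[of "h n t" "tr m (f t)"] trn[of m "g n t"] trn[of m "f t"]
      by (simp add: h_def)
  qed simp
  have sp: "integral (?S - N) F = integral ?S F" for F :: "real \<Rightarrow> real"
    by (rule integral_spike_set) (auto intro: negligible_subset[OF N])
  have "(\<lambda>n. integral (?S - N) (\<lambda>t. norm (h n t - tr m (f t)))) \<longlonglongrightarrow> integral (?S - N) (\<lambda>t. 0)"
  proof (rule dominated_convergence(2))
    show "(\<lambda>t. norm (h n t - tr m (f t))) integrable_on ?S - N" for n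
      by (rule integrable_spike_set[OF di]) (auto intro: negligible_subset[OF N])
    show "(\<lambda>t. 2 * real m) integrable_on ?S - N"
      by (rule integrable_spike_set[OF integrable_const_ivl]) (auto intro: negligible_subset[OF N])
    show "norm (norm (h n t - tr m (f t))) \<le> 2 * real m" for n t
      using norm_triangle_ineq4[of "h n t" "tr m (f t)"] trn[of m "g n t"] trn[of m "f t"]
      by (simp add: h_def)
    show "(\<lambda>n. norm (h n t - tr m (f t))) \<longlonglongrightarrow> 0" if t: "t \<in> ?S - N" for t
    proof -
      have "(\<lambda>n. g n t) \<longlonglongrightarrow> f t" using g(2)[of t] t by simp
      then have "(\<lambda>n. h n t) \<longlonglongrightarrow> tr m (f t)" unfolding h_def
        by (rule continuous_on_tendsto_compose[OF trc]) auto
      then show ?thesis by (metis LIM_zero tendsto_norm_zero)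
    qed
  qed
  then have "(\<lambda>n. integral ?S (\<lambda>t. norm (h n t - tr m (f t)))) \<longlonglongrightarrow> 0" by (simp add: sp)
  from order_tendstoD(2)[OF this, of "e / 2"] e
  have "\<forall>\<^sub>F n in sequentially. integral ?S (\<lambda>t. norm (h n t - tr m (f t))) < e / 2" by simp
  from eventually_happens'[OF sequentially_bot this]
  obtain n where n: "integral ?S (\<lambda>t. norm (h n t - tr m (f t))) < e / 2" ..
  have "integral ?S (\<lambda>t. norm (h n t - f t))
      \<le> integral ?S (\<lambda>t. norm (h n t - tr m (f t)) + norm (tr m (f t) - f t))"
  proof (rule integral_le)
    show s: "(\<lambda>t. norm (h n t - tr m (f t)) + norm (tr m (f t) - f t)) integrable_on ?S"
      by (intro integrable_add di di2)
    show *: "norm (h n t - f t) \<le> norm (h n t - tr m (f t)) + norm (tr m (f t) - f t)" for t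
      by (rule norm_triangle_sub[of "h n t - f t" "h n t - tr m (f t)", THEN order_trans])
        (simp add: algebra_simps)
    show "(\<lambda>t. norm (h n t - f t)) integrable_on ?S"
      by (rule measurable_bounded_by_integrable_imp_integrable[OF
            borel_measurable_norm_comp[OF borel_measurable_diff[OF hm fm]] s]) (use * in auto)
  qed
  also have "\<dots> = integral ?S (\<lambda>t. norm (h n t - tr m (f t))) + integral ?S (\<lambda>t. norm (tr m (f t) - f t))"
    by (rule integral_add[OF di di2])
  also have "\<dots> < e" using m n by simp
  finally show ?thesis using hc by blast
qed

lemma has_weak_derivD:
  assumes "has_weak_deriv S f g" "\<phi> \<in> test_functions S"
  shows "(\<integral>t. deriv \<phi> t *\<^sub>R f t \<partial>lebesgue_on S) = - (\<integral>t. \<phi> t *\<^sub>R g t \<partial>lebesgue_on S)"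
  using assms unfolding has_weak_deriv_def by blast

lemma test_functionD:
  assumes "\<phi> \<in> test_functions {a<..<b}"
  shows "(\<phi> has_real_derivative deriv \<phi> t) (at t)" "continuous_on UNIV (deriv \<phi>)"
    "continuous_on UNIV \<phi>" "\<phi> a = 0" "\<phi> b = 0"
proof -
  from assms obtain D where D: "\<And>x. (\<phi> has_vector_derivative D x) (at x)" "continuous_on UNIV D"
    by (auto simp: test_functions_def C1_differentiable_on_def)
  have "deriv \<phi> x = D x" for x
    using D(1)[of x] by (intro DERIV_imp_deriv) (simp add: has_real_derivative_iff_has_vector_derivative)
  then have e: "deriv \<phi> = D" by auto
  show d: "(\<phi> has_real_derivative deriv \<phi> t) (at t)" for t
    using D(1) by (simp add: e has_real_derivative_iff_has_vector_derivative)
  show "continuous_on UNIV (deriv \<phi>)" using D(2) e by simp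
  show "continuous_on UNIV \<phi>" using d by (intro DERIV_continuous_on) auto
  have "\<phi> x = 0" if "x \<notin> {a<..<b}" for x
    using assms that closure_subset[of "{t. \<phi> t \<noteq> 0}"] by (auto simp: test_functions_def)
  then show "\<phi> a = 0" "\<phi> b = 0" by auto
qed

lemma continuous_on_Icc_bounded:
  fixes f :: "real \<Rightarrow> 'b::real_normed_vector"
  assumes "continuous_on {a..b} f"
  obtains B where "0 \<le> B" "\<And>t. t \<in> {a..b} \<Longrightarrow> norm (f t) \<le> B"
proof -
  have "bounded (f ` {a..b})"
    using compact_continuous_image[OF assms compact_Icc] by (rule compact_imp_bounded)
  then obtain B where B: "\<And>t. t \<in> {a..b} \<Longrightarrow> norm (f t) \<le> B" unfolding bounded_iff by blast
  have "norm (f t) \<le> max B 0" if "t \<in> {a..b}" for t using B[OF that] by simp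
  then show thesis using that[of "max B 0"] by simp
qed

lemma has_weak_deriv_of_C1:
  fixes F u :: "real \<Rightarrow> real^'n"
  assumes T: "0 \<le> T" and F: "\<And>t. t \<in> {0..T} \<Longrightarrow> (F has_vector_derivative u t) (at t within {0..T})"
    and u: "continuous_on {0..T} u"
  shows "has_weak_deriv {0<..<T} F u"
  unfolding has_weak_deriv_def
proof
  fix \<phi> assume p: "\<phi> \<in> test_functions {0<..<T}"
  note \<phi> = test_functionD[OF p]
  have Fc: "continuous_on {0..T} F"
    using F by (rule has_vector_derivative_imp_continuous_on)
  have c1: "continuous_on {0..T} (\<lambda>t. deriv \<phi> t *\<^sub>R F t)" and c2: "continuous_on {0..T} (\<lambda>t. \<phi> t *\<^sub>R u t)"
    using \<phi>(2,3) Fc u by (auto intro!: continuous_intros intro: continuous_on_subset)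
  have "((\<lambda>t. \<phi> t *\<^sub>R u t + deriv \<phi> t *\<^sub>R F t) has_integral \<phi> T *\<^sub>R F T - \<phi> 0 *\<^sub>R F 0) {0..T}"
  proof (rule fundamental_theorem_of_calculus[OF T])
    fix t assume t: "t \<in> {0..T}"
    have "(\<phi> has_vector_derivative deriv \<phi> t) (at t within {0..T})"
      using \<phi>(1) by (simp add: has_field_derivative_at_within flip: has_real_derivative_iff_has_vector_derivative)
    from bounded_bilinear.has_vector_derivative[OF bounded_bilinear_scaleR this F[OF t]]
    show "((\<lambda>t. \<phi> t *\<^sub>R F t) has_vector_derivative \<phi> t *\<^sub>R u t + deriv \<phi> t *\<^sub>R F t) (at t within {0..T})" .
  qed
  then have "integral {0..T} (\<lambda>t. \<phi> t *\<^sub>R u t + deriv \<phi> t *\<^sub>R F t) = 0" using \<phi> by (simp add: integral_unique)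
  then have "integral {0..T} (\<lambda>t. deriv \<phi> t *\<^sub>R F t) = - integral {0..T} (\<lambda>t. \<phi> t *\<^sub>R u t)"
    using c1 c2 by (simp add: integral_add integrable_continuous_real eq_neg_iff_add_eq_0 add.commute)
  then show "(\<integral>t. deriv \<phi> t *\<^sub>R F t \<partial>lebesgue_on {0<..<T}) = - (\<integral>t. \<phi> t *\<^sub>R u t \<partial>lebesgue_on {0<..<T})"
    using c1 c2 by (simp add: integral_lebesgue_on_Ioo absolutely_integrable_continuous_real)
qed

lemma continuous_scaleR_absolutely_integrable:
  fixes w :: "real \<Rightarrow> real^'n"
  assumes w: "w absolutely_integrable_on {0..T}" and f: "continuous_on UNIV f"
  shows "(\<lambda>t. f t *\<^sub>R w t) absolutely_integrable_on {0..T}"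
proof -
  have c: "continuous_on {0..T} f" using f by (rule continuous_on_subset) simp
  show ?thesis
  proof (rule absolutely_integrable_bounded_measurable_product[where h = "(*\<^sub>R)" and f = f, OF _ _ _ _ w])
    show "bilinear ((*\<^sub>R) :: real \<Rightarrow> real^'n \<Rightarrow> real^'n)"
      by (simp add: bilinear_conv_bounded_bilinear bounded_bilinear_scaleR)
    show "bounded (f ` {0..T})" using c by (simp add: compact_continuous_image compact_imp_bounded)
    show "f \<in> borel_measurable (lebesgue_on {0..T})"
      by (intro continuous_imp_measurable_on_sets_lebesgue c) simp
  qed simp
qed

text \<open>Both sides of the defining identity pass to the limit: the left-hand side by dominated convergence,
  the right-hand side because test functions are bounded.\<close>
lemma has_weak_deriv_limit:
  fixes F U :: "nat \<Rightarrow> real \<Rightarrow> real^'n"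
  assumes wd: "\<And>n. has_weak_deriv {0<..<T} (F n) (U n)"
    and Fm: "\<And>n. F n \<in> borel_measurable (lebesgue_on {0..T})"
    and FB: "\<And>n t. t \<in> {0..T} \<Longrightarrow> norm (F n t) \<le> B"
    and lim: "\<And>t. t \<in> {0..T} \<Longrightarrow> (\<lambda>n. F n t) \<longlonglongrightarrow> f t"
    and U: "\<And>n. U n absolutely_integrable_on {0..T}"
    and u: "u absolutely_integrable_on {0..T}"
    and L1: "(\<lambda>n. integral {0..T} (\<lambda>t. norm (U n t - u t))) \<longlonglongrightarrow> 0"
  shows "has_weak_deriv {0<..<T} f u"
  unfolding has_weak_deriv_def
proof
  fix \<phi> assume p: "\<phi> \<in> test_functions {0<..<T}"
  note \<phi> = test_functionD[OF p]
  obtain b where b: "0 \<le> b" "\<And>t. t \<in> {0..T} \<Longrightarrow> norm (\<phi> t) \<le> b"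
    using continuous_on_Icc_bounded[OF continuous_on_subset[OF \<phi>(3)]] by blast
  obtain b' where b': "0 \<le> b'" "\<And>t. t \<in> {0..T} \<Longrightarrow> norm (deriv \<phi> t) \<le> b'"
    using continuous_on_Icc_bounded[OF continuous_on_subset[OF \<phi>(2)]] by blast
  have \<phi>m: "\<phi> \<in> borel_measurable (lebesgue_on {0..T})" "deriv \<phi> \<in> borel_measurable (lebesgue_on {0..T})"
    using \<phi>(2,3) by (auto intro!: continuous_imp_measurable_on_sets_lebesgue intro: continuous_on_subset)
  have mono: "norm (deriv \<phi> t *\<^sub>R F n t) \<le> b' * B" if "t \<in> {0..T}" for n t
    using b'(2)[OF that] FB[OF that] b'(1) by (simp add: mult_mono)
  have ab1: "(\<lambda>t. deriv \<phi> t *\<^sub>R F n t) absolutely_integrable_on {0..T}" for n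
    by (rule measurable_bounded_by_integrable_imp_absolutely_integrable[OF _ _ _ mono])
      (auto intro!: borel_measurable_scaleR \<phi>m Fm)
  have int1: "(\<lambda>t. deriv \<phi> t *\<^sub>R F n t) integrable_on {0..T}" for n
    using ab1 by (simp add: absolutely_integrable_on_def)
  note dc = dominated_convergence[where f = "\<lambda>n t. deriv \<phi> t *\<^sub>R F n t" and g = "\<lambda>t. deriv \<phi> t *\<^sub>R f t"
    and S = "{0..T}" and h = "\<lambda>_. b' * B", OF int1 _ mono]
  have lim': "(\<lambda>n. deriv \<phi> t *\<^sub>R F n t) \<longlonglongrightarrow> deriv \<phi> t *\<^sub>R f t" if "t \<in> {0..T}" for t
    by (intro tendsto_intros lim that)
  have int2: "(\<lambda>t. deriv \<phi> t *\<^sub>R f t) integrable_on {0..T}" and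
    l1: "(\<lambda>n. integral {0..T} (\<lambda>t. deriv \<phi> t *\<^sub>R F n t)) \<longlonglongrightarrow> integral {0..T} (\<lambda>t. deriv \<phi> t *\<^sub>R f t)"
    using dc lim' by auto
  have ab2: "(\<lambda>t. deriv \<phi> t *\<^sub>R f t) absolutely_integrable_on {0..T}"
  proof (rule absolutely_integrable_integrable_bound[OF _ int2])
    show "norm (deriv \<phi> t *\<^sub>R f t) \<le> b' * B" if "t \<in> {0..T}" for t
      using lim'[OF that] mono[OF that] by (intro Lim_bounded[OF tendsto_norm, of _ _ 0]) auto
  qed (rule integrable_const_ivl)
  note prod = continuous_scaleR_absolutely_integrable[OF _ \<phi>(3)]
  have l2: "(\<lambda>n. integral {0..T} (\<lambda>t. \<phi> t *\<^sub>R U n t)) \<longlonglongrightarrow> integral {0..T} (\<lambda>t. \<phi> t *\<^sub>R u t)"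
  proof (rule LIM_zero_cancel, rule Lim_null_comparison)
    show "\<forall>\<^sub>F n in sequentially. norm (integral {0..T} (\<lambda>t. \<phi> t *\<^sub>R U n t) - integral {0..T} (\<lambda>t. \<phi> t *\<^sub>R u t))
      \<le> b * integral {0..T} (\<lambda>t. norm (U n t - u t))"
    proof (intro always_eventually allI)
      fix n
      have d: "(\<lambda>t. U n t - u t) absolutely_integrable_on {0..T}"
        by (intro set_integral_diff U u)
      have "integral {0..T} (\<lambda>t. \<phi> t *\<^sub>R U n t) - integral {0..T} (\<lambda>t. \<phi> t *\<^sub>R u t)
          = integral {0..T} (\<lambda>t. \<phi> t *\<^sub>R (U n t - u t))"
        using prod[OF U[of n]] prod[OF u]
        by (simp add: scaleR_diff_right integral_diff absolutely_integrable_on_def)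
      also have "norm \<dots> \<le> integral {0..T} (\<lambda>t. b * norm (U n t - u t))"
      proof (rule integral_norm_bound_integral)
        show "(\<lambda>t. \<phi> t *\<^sub>R (U n t - u t)) integrable_on {0..T}"
          using prod[OF d] by (simp add: absolutely_integrable_on_def)
        show "(\<lambda>t. b * norm (U n t - u t)) integrable_on {0..T}"
          using d by (intro integrable_on_mult_right) (simp add: absolutely_integrable_on_def)
      qed (use b in \<open>auto intro!: mult_right_mono\<close>)
      finally show "norm (integral {0..T} (\<lambda>t. \<phi> t *\<^sub>R U n t) - integral {0..T} (\<lambda>t. \<phi> t *\<^sub>R u t))
        \<le> b * integral {0..T} (\<lambda>t. norm (U n t - u t))" by simp
    qed
    show "(\<lambda>n. b * integral {0..T} (\<lambda>t. norm (U n t - u t))) \<longlonglongrightarrow> 0"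
      by (rule tendsto_mult_right_zero[OF L1])
  qed
  have "integral {0..T} (\<lambda>t. deriv \<phi> t *\<^sub>R F n t) = - integral {0..T} (\<lambda>t. \<phi> t *\<^sub>R U n t)" for n
    using has_weak_derivD[OF wd[of n] p] unfolding integral_lebesgue_on_Ioo[OF ab1] integral_lebesgue_on_Ioo[OF prod[OF U]] .
  then have "integral {0..T} (\<lambda>t. deriv \<phi> t *\<^sub>R f t) = - integral {0..T} (\<lambda>t. \<phi> t *\<^sub>R u t)"
    using l1 tendsto_minus[OF l2] LIMSEQ_unique by simp
  then show "(\<integral>t. deriv \<phi> t *\<^sub>R f t \<partial>lebesgue_on {0<..<T}) = - (\<integral>t. \<phi> t *\<^sub>R u t \<partial>lebesgue_on {0<..<T})"
    unfolding integral_lebesgue_on_Ioo[OF ab2] integral_lebesgue_on_Ioo[OF prod[OF u]] .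
qed

lemma norm_diff_indefinite_integral_le:
  fixes G g :: "real \<Rightarrow> 'b::euclidean_space"
  assumes "G absolutely_integrable_on {0..T}" "g absolutely_integrable_on {0..T}" and t: "t \<in> {0..T}"
  shows "norm (integral {0..t} G - integral {0..t} g) \<le> integral {0..T} (\<lambda>s. norm (G s - g s))"
proof -
  have d: "(\<lambda>s. G s - g s) absolutely_integrable_on {0..T}" by (intro set_integral_diff assms)
  have sub: "w absolutely_integrable_on {0..t}" if "w absolutely_integrable_on {0..T}" for w :: "real \<Rightarrow> 'b"
    using t by (intro absolutely_integrable_on_subinterval[OF that]) auto
  note i = set_lebesgue_integral_eq_integral(1)[OF sub]
  have "integral {0..t} G - integral {0..t} g = integral {0..t} (\<lambda>s. G s - g s)"
    by (rule integral_diff[symmetric]) (intro i assms)+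
  also have "norm \<dots> \<le> integral {0..t} (\<lambda>s. norm (G s - g s))"
    using sub[OF d] by (intro integral_norm_bound_integral) (auto simp: absolutely_integrable_on_def)
  also have "\<dots> \<le> integral {0..T} (\<lambda>s. norm (G s - g s))"
    using t sub[OF d] d by (intro integral_subset_le) (auto simp: absolutely_integrable_on_def)
  finally show ?thesis .
qed

lemma L1_approx_continuous_seq:
  fixes g :: "real \<Rightarrow> 'b::euclidean_space"
  assumes g: "g absolutely_integrable_on {0..T}"
  shows "\<exists>G :: nat \<Rightarrow> real \<Rightarrow> 'b. (\<forall>n. continuous_on {0..T} (G n)) \<and>
    (\<forall>n. integral {0..T} (\<lambda>t. norm (G n t - g t)) \<le> inverse (real (Suc n)))"
proof -
  have "\<exists>h. continuous_on UNIV h \<and> integral {0..T} (\<lambda>t. norm (h t - g t)) < inverse (real (Suc n))" for n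
    by (rule L1_approx_continuous[OF g]) simp
  then have "\<exists>h. continuous_on {0..T} h \<and> integral {0..T} (\<lambda>t. norm (h t - g t)) \<le> inverse (real (Suc n))" for n
    by (meson continuous_on_subset less_imp_le subset_UNIV)
  then show ?thesis by metis
qed

text \<open>Taking absolute values does not increase the distance to a nonnegative function. Nonnegative
  approximations keep approximate residuals nonnegative, which preserves the coercivity constant.\<close>
lemma L1_approx_continuous_nonneg_seq:
  fixes h :: "real \<Rightarrow> real"
  assumes h: "h absolutely_integrable_on {0..T}" and nonneg: "\<And>t. t \<in> {0..T} \<Longrightarrow> 0 \<le> h t"
  shows "\<exists>H :: nat \<Rightarrow> real \<Rightarrow> real. (\<forall>n. continuous_on {0..T} (H n)) \<and> (\<forall>n t. 0 \<le> H n t) \<and>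
    (\<forall>n. integral {0..T} (\<lambda>t. norm (H n t - h t)) \<le> inverse (real (Suc n)))"
proof -
  obtain G where G: "\<And>n. continuous_on {0..T} (G n)"
    "\<And>n. integral {0..T} (\<lambda>t. norm (G n t - h t)) \<le> inverse (real (Suc n))"
    using L1_approx_continuous_seq[OF h] by blast
  have "integral {0..T} (\<lambda>t. norm (\<bar>G n t\<bar> - h t)) \<le> inverse (real (Suc n))" for n
  proof (rule order_trans[OF integral_le G(2)])
    have "(\<lambda>t. \<bar>G n t\<bar> - h t) absolutely_integrable_on {0..T}" "(\<lambda>t. G n t - h t) absolutely_integrable_on {0..T}"
      by (intro set_integral_diff h absolutely_integrable_continuous_real continuous_on_rabs G)+
    then show "(\<lambda>t. norm (\<bar>G n t\<bar> - h t)) integrable_on {0..T}" "(\<lambda>t. norm (G n t - h t)) integrable_on {0..T}"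
      by (simp_all add: absolutely_integrable_on_def)
    show "norm (\<bar>G n t\<bar> - h t) \<le> norm (G n t - h t)" if "t \<in> {0..T}" for t
      using nonneg[OF that] by (simp add: abs_if)
  qed
  then show ?thesis using G(1)
    by (intro exI[of _ "\<lambda>n t. \<bar>G n t\<bar>"]) (auto intro!: continuous_on_rabs)
qed

lemma inverse_Suc_le_one: "inverse (real (Suc n)) \<le> 1"
  using inverse_le_1_iff[of "real (Suc n)"] by simp

lemma indefinite_integral_C1:
  fixes G :: "real \<Rightarrow> 'b::euclidean_space"
  assumes "continuous_on {0..T} G" "t \<in> {0..T}"
  shows "((\<lambda>t. a + integral {0..t} G) has_vector_derivative G t) (at t within {0..T})"
  using has_vector_derivative_add[OF has_vector_derivative_const integral_has_vector_derivative[OF assms]]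
  by simp

lemma continuous_on_indefinite_integral:
  fixes f g :: "real \<Rightarrow> 'b::euclidean_space"
  assumes g: "g absolutely_integrable_on {0..T}"
    and f: "\<And>t. t \<in> {0..T} \<Longrightarrow> f t = f 0 + integral {0..t} g"
  shows "continuous_on {0..T} f"
proof -
  have "continuous_on {0..T} (\<lambda>t. f 0 + integral {0..t} g)"
    by (intro continuous_on_add[OF continuous_on_const indefinite_integral_continuous_1]
        set_lebesgue_integral_eq_integral(1)[OF g])
  then show ?thesis by (rule continuous_on_eq) (rule f[symmetric])
qed

lemma has_weak_deriv_indefinite_integral:
  fixes f g :: "real \<Rightarrow> real^'n"
  assumes T: "0 \<le> T" and g: "g absolutely_integrable_on {0..T}"
    and f: "\<And>t. t \<in> {0..T} \<Longrightarrow> f t = f 0 + integral {0..t} g"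
  shows "has_weak_deriv {0<..<T} f g"
proof -
  obtain G where G: "\<And>n. continuous_on {0..T} (G n)"
    "\<And>n. integral {0..T} (\<lambda>t. norm (G n t - g t)) \<le> inverse (real (Suc n))"
    using L1_approx_continuous_seq[OF g] by blast
  have Gi: "G n absolutely_integrable_on {0..T}" for n by (rule absolutely_integrable_continuous_real[OF G(1)])
  define F where "F n t = f 0 + integral {0..t} (G n)" for n t
  have dF: "(F n has_vector_derivative G n t) (at t within {0..T})" if "t \<in> {0..T}" for n t
    unfolding F_def by (rule indefinite_integral_C1[OF G(1) that])
  have diff: "norm (F n t - f t) \<le> inverse (real (Suc n))" if t: "t \<in> {0..T}" for n t
  proof -
    have "F n t - f t = integral {0..t} (G n) - integral {0..t} g" unfolding F_def f[OF t] by simp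
    then show ?thesis using order_trans[OF norm_diff_indefinite_integral_le[OF Gi[of n] g t] G(2)] by (simp only:)
  qed
  obtain B where B: "\<And>t. t \<in> {0..T} \<Longrightarrow> norm (f t) \<le> B"
    using continuous_on_Icc_bounded[OF continuous_on_indefinite_integral[where f = f, OF g f]] by blast
  show ?thesis
  proof (rule has_weak_deriv_limit[where F = F and U = G and B = "B + 1"])
    show "has_weak_deriv {0<..<T} (F n) (G n)" for n by (rule has_weak_deriv_of_C1[OF T dF G(1)])
    have "continuous_on {0..T} (F n)" for n
      using dF by (rule has_vector_derivative_imp_continuous_on)
    then show "F n \<in> borel_measurable (lebesgue_on {0..T})" for n
      by (intro continuous_imp_measurable_on_sets_lebesgue) auto
    show "norm (F n t) \<le> B + 1" if "t \<in> {0..T}" for n t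
      using diff[OF that, of n] inverse_Suc_le_one[of n] B[OF that] norm_triangle_sub[of "F n t" "f t"] by linarith
    show "(\<lambda>n. F n t) \<longlonglongrightarrow> f t" if "t \<in> {0..T}" for t
      by (rule LIM_zero_cancel, rule Lim_null_comparison[OF always_eventually LIMSEQ_inverse_real_of_nat])
        (use diff[OF that] in blast)
    have "0 \<le> integral {0..T} (\<lambda>t. norm (G n t - g t))" for n
      using set_integral_diff(1)[OF Gi g] by (intro integral_nonneg) (auto simp: absolutely_integrable_on_def)
    then show "(\<lambda>n. integral {0..T} (\<lambda>t. norm (G n t - g t))) \<longlonglongrightarrow> 0"
      by (intro Lim_null_comparison[OF always_eventually LIMSEQ_inverse_real_of_nat] allI) (use G(2) in simp)
  qed (rule Gi g)+
qed

text \<open>The squared positive part is the building block for continuously differentiable test functions with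
  piecewise linear derivative.\<close>
lemma has_real_derivative_pos_part_sq:
  "((\<lambda>x::real. (max 0 x)\<^sup>2) has_real_derivative 2 * max 0 x) (at x)"
proof -
  consider "x < 0" | "x = 0" | "0 < x" by linarith
  then show ?thesis
  proof cases
    case 1
    have "((\<lambda>x::real. 0) has_real_derivative 0) (at x)" by simp
    then have "((\<lambda>x::real. (max 0 x)\<^sup>2) has_real_derivative 0) (at x)"
      by (rule has_field_derivative_transform_within_open[of _ _ _ "{..<0}"]) (use 1 in auto)
    then show ?thesis using 1 by simp
  next
    case 2
    have "((\<lambda>h::real. (max 0 h)\<^sup>2 / h) \<longlongrightarrow> 0) (at 0)"
    proof (rule Lim_null_comparison)
      have "norm ((max 0 h)\<^sup>2 / h) \<le> \<bar>h\<bar>" for h :: real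
        by (cases "h \<le> 0") (auto simp: power2_eq_square)
      then show "\<forall>\<^sub>F h in at 0. norm ((max 0 h)\<^sup>2 / h) \<le> \<bar>h::real\<bar>" by simp
      show "((\<lambda>h::real. \<bar>h\<bar>) \<longlongrightarrow> 0) (at 0)" by (rule tendsto_eq_intros | simp)+
    qed
    then show ?thesis using 2 by (simp add: DERIV_def)
  next
    case 3
    have "((\<lambda>x::real. x\<^sup>2) has_real_derivative 2 * x) (at x)" by (auto intro!: derivative_eq_intros)
    then have "((\<lambda>x::real. (max 0 x)\<^sup>2) has_real_derivative 2 * x) (at x)"
      by (rule has_field_derivative_transform_within_open[of _ _ _ "{0<..}"]) (use 3 in auto)
    then show ?thesis using 3 by simp
  qed
qed

text \<open>The lemma of du Bois-Reymond. For two interior points \<open>r\<close> and \<open>s\<close> the test function is the difference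
  of two smoothed steps, whose derivative is a narrow tent at \<open>r\<close> minus the same tent at \<open>s\<close>. Hence
  the averages of \<open>D\<close> against both tents agree, and they are close to \<open>D r\<close> and \<open>D s\<close>.\<close>
lemma weak_deriv_zero_imp_constant:
  fixes D :: "real \<Rightarrow> real^'n"
  assumes T: "0 < T" and D: "continuous_on {0..T} D"
    and zero: "\<And>\<phi>. \<phi> \<in> test_functions {0<..<T} \<Longrightarrow> (\<integral>t. deriv \<phi> t *\<^sub>R D t \<partial>lebesgue_on {0<..<T}) = 0"
    and t: "t \<in> {0..T}"
  shows "D t = D 0"
proof -
  have const: "D r = D s" if r: "r \<in> {0<..<T}" and s: "s \<in> {0<..<T}" for r s
  proof -
    have "norm (D r - D s) \<le> e" if e: "0 < e" for e
    proof -
      have near: "\<exists>d>0. \<forall>u\<in>{0..T}. dist u c < d \<longrightarrow> dist (D u) (D c) < e / 2" if "c \<in> {0<..<T}" for c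
      proof -
        have "c \<in> {0..T}" "0 < e / 2" using that e by auto
        then show ?thesis using D unfolding continuous_on_iff by blast
      qed
      from near[OF r] obtain d1 where d1: "0 < d1"
        "\<And>u. u \<in> {0..T} \<Longrightarrow> dist u r < d1 \<Longrightarrow> dist (D u) (D r) < e / 2" by blast
      from near[OF s] obtain d2 where d2: "0 < d2"
        "\<And>u. u \<in> {0..T} \<Longrightarrow> dist u s < d2 \<Longrightarrow> dist (D u) (D s) < e / 2" by blast
      note d = d1 d2
      define h where "h = Min {d1, d2, r, s, T - r, T - s} / 2"
      have M: "0 < Min {d1, d2, r, s, T - r, T - s}" using d(1,3) r s by simp
      then have h0: "0 < h" unfolding h_def by (rule half_gt_zero)
      have hx: "h < x" if "x \<in> {d1, d2, r, s, T - r, T - s}" for x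
      proof -
        have "Min {d1, d2, r, s, T - r, T - s} \<le> x" by (rule Min_le[OF _ that]) simp
        then show ?thesis using M unfolding h_def by linarith
      qed
      have h: "0 < h" "h < d1" "h < d2" "h < r" "h < s" "h < T - r" "h < T - s"
        by (rule h0) (rule hx, simp)+
      define p :: "real \<Rightarrow> real" where "p x = (max 0 x)\<^sup>2" for x
      \<comment> \<open>A smooth step around \<open>c\<close>: zero left of \<open>c - h\<close>, constant right of \<open>c + h\<close>; its derivative \<open>k c\<close> is a tent.\<close>
      define \<Psi> where "\<Psi> c x = p (x - c + h) - 2 * p (x - c) + p (x - c - h)" for c x
      define k where "k c x = 2 * max 0 (x - c + h) - 4 * max 0 (x - c) + 2 * max 0 (x - c - h)" for c x :: real
      have d\<Psi>: "(\<Psi> c has_real_derivative k c x) (at x)" for c x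
      proof -
        have dp: "((\<lambda>x. p (x + a)) has_real_derivative 2 * max 0 (x + a)) (at x)" for a
          using DERIV_shift[of p "2 * max 0 (x + a)" x a] has_real_derivative_pos_part_sq[of "x + a"]
          by (simp add: p_def[abs_def])
        show ?thesis unfolding \<Psi>_def k_def
          using DERIV_add[OF DERIV_diff[OF dp[of "h - c"] DERIV_cmult[OF dp[of "- c"], of 2]] dp[of "- c - h"]]
          by (simp add: algebra_simps)
      qed
      have kc: "continuous_on A (k c)" for c A unfolding k_def by (intro continuous_intros)
      have k0: "0 \<le> k c x" for c x using h(1) by (simp add: k_def max_def)
      have kz: "k c x = 0" if "h \<le> \<bar>x - c\<bar>" for c x using that h(1) by (auto simp: k_def max_def)
      have \<Psi>0: "\<Psi> c x = 0" if "x \<le> c - h" for c x using that h(1) by (simp add: \<Psi>_def p_def)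
      have \<Psi>1: "\<Psi> c x = 2 * h\<^sup>2" if "c + h \<le> x" for c x
        using that h(1) by (simp add: \<Psi>_def p_def power2_eq_square algebra_simps)
      have ik: "integral {0..T} (k c) = 2 * h\<^sup>2" if "h < c" "h < T - c" for c
      proof -
        have "(k c has_integral \<Psi> c T - \<Psi> c 0) {0..T}"
          using T d\<Psi> by (intro fundamental_theorem_of_calculus)
            (auto simp: has_field_derivative_at_within simp flip: has_real_derivative_iff_has_vector_derivative)
        then show ?thesis using that by (simp add: integral_unique \<Psi>0 \<Psi>1)
      qed
      have avg: "norm (integral {0..T} (\<lambda>t. k c t *\<^sub>R D t) - (2 * h\<^sup>2) *\<^sub>R D c) \<le> e / 2 * (2 * h\<^sup>2)"
        if c: "h < c" "h < T - c" "\<And>u. u \<in> {0..T} \<Longrightarrow> dist u c < h \<Longrightarrow> dist (D u) (D c) < e / 2" for c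
      proof -
        have "integral {0..T} (\<lambda>t. k c t *\<^sub>R D c) = (2 * h\<^sup>2) *\<^sub>R D c"
          by (intro integral_unique has_integral_scaleR_left)
            (metis ik[OF c(1,2)] integrable_integral[OF integrable_continuous_real[OF kc]])
        then have "integral {0..T} (\<lambda>t. k c t *\<^sub>R D t) - (2 * h\<^sup>2) *\<^sub>R D c
           = integral {0..T} (\<lambda>t. k c t *\<^sub>R (D t - D c))"
          by (simp add: scaleR_diff_right integral_diff integrable_continuous_real continuous_on_scaleR kc D)
        also have "norm \<dots> \<le> integral {0..T} (\<lambda>t. k c t * (e / 2))"
        proof (rule integral_norm_bound_integral)
          show "norm (k c u *\<^sub>R (D u - D c)) \<le> k c u * (e / 2)" if u: "u \<in> {0..T}" for u
          proof (cases "h \<le> \<bar>u - c\<bar>")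
            case False
            then have "norm (D u - D c) \<le> e / 2" using c(3)[OF u] by (simp add: dist_norm)
            then show ?thesis using mult_left_mono[OF _ k0[of c u], of "norm (D u - D c)" "e / 2"] k0[of c u] by simp
          qed (simp add: kz)
        qed (intro integrable_continuous_real continuous_intros kc D)+
        also have "\<dots> = e / 2 * (2 * h\<^sup>2)"
          using ik[OF c(1,2)] by simp
        finally show ?thesis .
      qed
      define \<phi> where "\<phi> x = \<Psi> r x - \<Psi> s x" for x
      have d\<phi>: "(\<phi> has_real_derivative k r x - k s x) (at x)" for x
        unfolding \<phi>_def by (intro DERIV_diff d\<Psi>)
      then have dd: "deriv \<phi> x = k r x - k s x" for x by (rule DERIV_imp_deriv)
      have "\<phi> \<in> test_functions {0<..<T}"
      proof -
        have sub: "{x. \<phi> x \<noteq> 0} \<subseteq> {min r s - h..max r s + h}"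
        proof
          fix x assume "x \<in> {x. \<phi> x \<noteq> 0}"
          then have nz: "\<Psi> r x \<noteq> \<Psi> s x" by (simp add: \<phi>_def)
          have "\<not> x < min r s - h"
          proof
            assume "x < min r s - h"
            then show False using nz \<Psi>0[of x r] \<Psi>0[of x s] by simp
          qed
          moreover have "\<not> max r s + h < x"
          proof
            assume "max r s + h < x"
            then show False using nz \<Psi>1[of r x] \<Psi>1[of s x] by simp
          qed
          ultimately show "x \<in> {min r s - h..max r s + h}" by simp
        qed
        then have cl: "closure {x. \<phi> x \<noteq> 0} \<subseteq> {min r s - h..max r s + h}" by (rule closure_minimal) simp
        have "\<phi> C1_differentiable_on UNIV"
          unfolding C1_differentiable_on_def using d\<phi> kc
          by (intro exI[of _ "\<lambda>x. k r x - k s x"]) (auto simp flip: has_real_derivative_iff_has_vector_derivative intro!: continuous_intros)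
        moreover have "compact (closure {x. \<phi> x \<noteq> 0})"
          using sub bounded_subset[OF bounded_closed_interval] by (simp add: compact_closure)
        moreover have "{min r s - h..max r s + h} \<subseteq> {0<..<T}" using h by auto
        ultimately show ?thesis using cl by (auto simp: test_functions_def)
      qed
      from zero[OF this] have "integral {0..T} (\<lambda>t. (k r t - k s t) *\<^sub>R D t) = 0"
        by (simp add: dd integral_lebesgue_on_Ioo absolutely_integrable_continuous_real continuous_intros kc D)
      then have eq: "integral {0..T} (\<lambda>t. k r t *\<^sub>R D t) = integral {0..T} (\<lambda>t. k s t *\<^sub>R D t)"
        by (simp add: scaleR_diff_left integral_diff integrable_continuous_real continuous_on_scaleR kc D)
      have "norm ((2 * h\<^sup>2) *\<^sub>R (D r - D s)) \<le> e * (2 * h\<^sup>2)"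
      proof -
        let ?I = "integral {0..T} (\<lambda>t. k r t *\<^sub>R D t)"
        have "(2 * h\<^sup>2) *\<^sub>R (D r - D s) = (?I - (2 * h\<^sup>2) *\<^sub>R D s) - (?I - (2 * h\<^sup>2) *\<^sub>R D r)"
          by (simp add: scaleR_diff_right)
        also have "norm \<dots> \<le> norm (?I - (2 * h\<^sup>2) *\<^sub>R D s) + norm (?I - (2 * h\<^sup>2) *\<^sub>R D r)"
          by (rule norm_triangle_ineq4)
        also have "\<dots> \<le> e / 2 * (2 * h\<^sup>2) + e / 2 * (2 * h\<^sup>2)"
          using avg[of s] avg[of r] h d by (intro add_mono) (auto simp: eq)
        finally show ?thesis by (simp add: algebra_simps)
      qed
      then have "norm (D r - D s) * (2 * h\<^sup>2) \<le> e * (2 * h\<^sup>2)" by (simp add: mult_ac)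
      then show ?thesis by (rule mult_right_le_imp_le) (use h(1) in simp)
    qed
    then have "norm (D r - D s) \<le> 0" by (metis add_0 field_le_epsilon)
    then show ?thesis by simp
  qed
  have cl: "closure {0<..<T} = {0..T}" using T by simp
  have "D u = D (T/2)" if "u \<in> {0..T}" for u
  proof (rule continuous_constant_on_closure[of "{0<..<T}" D])
    show "continuous_on (closure {0<..<T}) D" "u \<in> closure {0<..<T}" using D that by (simp_all only: cl)
    show "D v = D (T/2)" if "v \<in> {0<..<T}" for v by (rule const[OF that]) (use T in simp)
  qed
  from this[OF t] this[of 0] T show ?thesis by simp
qed

text \<open>The function minus the indefinite integral of its weak derivative has weak derivative zero.\<close>
lemma weak_deriv_imp_indefinite_integral:
  fixes f g :: "real \<Rightarrow> real^'n"
  assumes T: "0 < T" and f: "continuous_on {0..T} f" and g: "g absolutely_integrable_on {0..T}"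
    and wd: "has_weak_deriv {0<..<T} f g" and t: "t \<in> {0..T}"
  shows "f t = f 0 + integral {0..t} g"
proof -
  define F where "F t = integral {0..t} g" for t
  have F: "continuous_on {0..T} F" unfolding F_def
    by (intro indefinite_integral_continuous_1 set_lebesgue_integral_eq_integral(1)[OF g])
  have wF: "has_weak_deriv {0<..<T} F g"
    by (rule has_weak_deriv_indefinite_integral[OF less_imp_le[OF T] g]) (simp add: F_def)
  have "(\<lambda>t. f t - F t) t = (\<lambda>t. f t - F t) 0"
  proof (rule weak_deriv_zero_imp_constant[OF T _ _ t])
    show "continuous_on {0..T} (\<lambda>t. f t - F t)" by (intro continuous_intros f F)
    fix \<phi> assume p: "\<phi> \<in> test_functions {0<..<T}"
    have c: "continuous_on {0..T} (deriv \<phi>)" using test_functionD(2)[OF p] by (rule continuous_on_subset) simp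
    have "integral {0..T} (\<lambda>t. deriv \<phi> t *\<^sub>R f t) = integral {0..T} (\<lambda>t. deriv \<phi> t *\<^sub>R F t)"
      using has_weak_derivD[OF wd p] has_weak_derivD[OF wF p]
      by (simp add: integral_lebesgue_on_Ioo absolutely_integrable_continuous_real continuous_intros c f F)
    then show "(\<integral>t. deriv \<phi> t *\<^sub>R (f t - F t) \<partial>lebesgue_on {0<..<T}) = 0"
      by (simp add: integral_lebesgue_on_Ioo absolutely_integrable_continuous_real continuous_intros c f F
        scaleR_diff_right integral_diff integrable_continuous_real)
  qed
  then show ?thesis by (simp add: F_def algebra_simps)
qed

text \<open>By Lebesgue's differentiation theorem the averages of \<open>d\<close> over \<open>[t, t + h]\<close> converge to \<open>d t\<close> for
  almost every \<open>t\<close>. The extension \<open>e\<close> by zero makes that theorem applicable on the whole line.\<close>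
lemma integral_zero_imp_negligible_support:
  fixes d :: "real \<Rightarrow> 'b::euclidean_space"
  assumes d: "d absolutely_integrable_on {0..T}"
    and zero: "\<And>t. t \<in> {0..T} \<Longrightarrow> integral {0..t} d = 0"
  shows "negligible {t \<in> {0..T}. d t \<noteq> 0}"
proof -
  define e where "e t = (if t \<in> {0..T} then d t else 0)" for t
  have "e integrable_on UNIV"
    unfolding e_def integrable_restrict_UNIV by (rule set_lebesgue_integral_eq_integral(1)[OF d])
  then have "e integrable_on cbox a b" for a b by (rule integrable_on_subcbox) simp
  then obtain N where N: "negligible N" "\<And>x r. \<lbrakk>x \<notin> N; 0 < r\<rbrakk> \<Longrightarrow>
       \<exists>\<delta>>0. \<forall>h. 0 < h \<and> h < \<delta> \<longrightarrow> norm (integral (cbox x (x + h *\<^sub>R One)) e /\<^sub>R h ^ DIM(real) - e x) < r"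
    by (rule integrable_ccontinuous_explicit) blast
  have "{t \<in> {0..T}. d t \<noteq> 0} \<subseteq> insert T N"
  proof
    fix t assume t: "t \<in> {t \<in> {0..T}. d t \<noteq> 0}"
    show "t \<in> insert T N"
    proof (rule ccontr)
      assume nt: "t \<notin> insert T N"
      then obtain \<delta> where \<delta>: "0 < \<delta>" "\<And>h. 0 < h \<Longrightarrow> h < \<delta> \<Longrightarrow> norm (integral {t..t + h} e /\<^sub>R h - e t) < norm (d t)"
        using N(2)[of t "norm (d t)"] t by auto
      define h where "h = min (\<delta> / 2) (T - t)"
      have h: "0 < h" "h < \<delta>" "t + h \<le> T" using \<delta>(1) t nt by (auto simp: h_def min_def)
      have "integral {t..t + h} e = integral {t..t + h} d"
        by (rule integral_cong) (use t h in \<open>auto simp: e_def\<close>)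
      also have "\<dots> = integral {0..t + h} d - integral {0..t} d"
        using Henstock_Kurzweil_Integration.integral_combine[of 0 t "t + h" d] t h
          absolutely_integrable_on_subinterval[OF d, of 0 "t + h"]
        by (simp add: absolutely_integrable_on_def eq_diff_eq add.commute)
      also have "\<dots> = 0" using t h by (simp add: zero)
      finally show False using \<delta>(2)[OF h(1,2)] t by (simp add: e_def)
    qed
  qed
  moreover have "negligible (insert T N)" using N(1) by simp
  ultimately show ?thesis by (metis negligible_subset)
qed

text \<open>The constant \<open>weak_deriv\<close> selects an arbitrary weak derivative. This lemma shows that norms do not
  depend on the selection. The difference of two weak derivatives is a weak derivative of zero, so
  its indefinite integral vanishes identically.\<close>
lemma weak_deriv_unique_ae:
  fixes f g1 g2 :: "real \<Rightarrow> real^'n"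
  assumes T: "0 < T" and g: "g1 absolutely_integrable_on {0..T}" "g2 absolutely_integrable_on {0..T}"
    and wd: "has_weak_deriv {0<..<T} f g1" "has_weak_deriv {0<..<T} f g2"
  shows "negligible {t \<in> {0..T}. g1 t \<noteq> g2 t}"
proof -
  define d where "d t = g1 t - g2 t" for t
  have d: "d absolutely_integrable_on {0..T}" unfolding d_def by (intro set_integral_diff g)
  note prod = continuous_scaleR_absolutely_integrable[OF _ test_functionD(3)]
  have "has_weak_deriv {0<..<T} (\<lambda>_. 0) d"
    unfolding has_weak_deriv_def
  proof
    fix \<phi> assume p: "\<phi> \<in> test_functions {0<..<T}"
    have "integral {0..T} (\<lambda>t. \<phi> t *\<^sub>R g1 t) = integral {0..T} (\<lambda>t. \<phi> t *\<^sub>R g2 t)"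
      using has_weak_derivD[OF wd(1) p] has_weak_derivD[OF wd(2) p]
      by (simp add: integral_lebesgue_on_Ioo prod[OF g(1) p] prod[OF g(2) p])
    then have "integral {0..T} (\<lambda>t. \<phi> t *\<^sub>R d t) = 0"
      using prod[OF g(1) p] prod[OF g(2) p]
      by (simp add: d_def scaleR_diff_right integral_diff absolutely_integrable_on_def)
    then show "(\<integral>t. deriv \<phi> t *\<^sub>R (0 :: real^'n) \<partial>lebesgue_on {0<..<T}) = - (\<integral>t. \<phi> t *\<^sub>R d t \<partial>lebesgue_on {0<..<T})"
      using prod[OF d p] by (simp add: integral_lebesgue_on_Ioo)
  qed
  then have "integral {0..t} d = 0" if "t \<in> {0..T}" for t
    using weak_deriv_imp_indefinite_integral[OF T _ d, of "\<lambda>_. 0" t] that by simp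
  then have "negligible {t \<in> {0..T}. d t \<noteq> 0}" by (rule integral_zero_imp_negligible_support[OF d])
  then show ?thesis by (simp add: d_def)
qed

section \<open>The three estimators at a fixed time\<close>

definition quad_value :: "real^'n^'n \<Rightarrow> real^'n \<Rightarrow> real \<Rightarrow> real^'n \<Rightarrow> real" where
  "quad_value M \<xi> \<rho> x = wnorm_sq M (x - \<xi>) + \<rho>"

text \<open>For \<open>\<theta> > 0\<close> this is the gradient of \<open>exp (\<theta> V) / (2 \<theta>)\<close> for \<open>V = quad_value M \<xi> \<rho>\<close>, and for \<open>\<theta> = 0\<close>
  the gradient of \<open>V / 2\<close>.\<close>
definition exp_grad :: "real \<Rightarrow> real^'n^'n \<Rightarrow> real^'n \<Rightarrow> real \<Rightarrow> real^'n \<Rightarrow> real^'n" where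
  "exp_grad \<theta> M \<xi> \<rho> x = exp (\<theta> * quad_value M \<xi> \<rho> x) *\<^sub>R (M *v (x - \<xi>))"

text \<open>The derivative of \<open>exp_grad\<close> in \<open>x\<close> in the direction \<open>v\<close>.\<close>
definition exp_hess :: "real \<Rightarrow> real^'n^'n \<Rightarrow> real^'n \<Rightarrow> real \<Rightarrow> real^'n \<Rightarrow> real^'n \<Rightarrow> real^'n" where
  "exp_hess \<theta> M \<xi> \<rho> x v = exp (\<theta> * quad_value M \<xi> \<rho> x) *\<^sub>R
     (M *v v + (2 * \<theta> * ((M *v (x - \<xi>)) \<bullet> v)) *\<^sub>R (M *v (x - \<xi>)))"

text \<open>The derivative of \<open>exp_grad\<close> at fixed \<open>x\<close> when \<open>M\<close>, \<open>\<xi>\<close> and \<open>\<rho>\<close> move with the velocities \<open>M'\<close>, \<open>\<eta>\<close>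
  and \<open>h\<close>.\<close>
definition exp_grad_dt :: "real \<Rightarrow> real^'n^'n \<Rightarrow> real^'n \<Rightarrow> real \<Rightarrow> real^'n \<Rightarrow>
    real^'n^'n \<Rightarrow> real^'n \<Rightarrow> real \<Rightarrow> real^'n" where
  "exp_grad_dt \<theta> M \<xi> \<rho> x M' \<eta> h = exp (\<theta> * quad_value M \<xi> \<rho> x) *\<^sub>R
     ((\<theta> * ((x - \<xi>) \<bullet> (M' *v (x - \<xi>)) - 2 * (\<eta> \<bullet> (M *v (x - \<xi>))) + h)) *\<^sub>R (M *v (x - \<xi>))
      + M' *v (x - \<xi>) - M *v \<eta>)"

definition total_grad :: "real \<Rightarrow> 'k set \<Rightarrow> ('k \<Rightarrow> real^'n^'n) \<Rightarrow> ('k \<Rightarrow> real^'n) \<Rightarrow> ('k \<Rightarrow> real) \<Rightarrow>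
    real^'n \<Rightarrow> real^'n" where
  "total_grad \<theta> I M \<xi> \<rho> x = (\<Sum>k\<in>I. exp_grad \<theta> (M k) (\<xi> k) (\<rho> k) x)"

definition coercive_family :: "real \<Rightarrow> 'k set \<Rightarrow> ('k \<Rightarrow> real^'n^'n) \<Rightarrow> ('k \<Rightarrow> real) \<Rightarrow> bool" where
  "coercive_family c I M \<rho> \<longleftrightarrow> finite I \<and> I \<noteq> {} \<and> 0 < c \<and>
     (\<forall>k\<in>I. transpose (M k) = M k \<and> (\<forall>x. c * (norm x)\<^sup>2 \<le> wnorm_sq (M k) x) \<and> 0 \<le> \<rho> k)"

lemma sym_wnorm_sq_diff:
  fixes M :: "real^'n^'n"
  assumes "transpose M = M"
  shows "wnorm_sq M (e - f) = wnorm_sq M e - 2 * (e \<bullet> (M *v f)) + wnorm_sq M f"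
  using symmetric_inner[OF assms, of e f]
  by (simp add: wnorm_sq_def inner_diff_left inner_diff_right matrix_vector_mult_diff_distrib inner_commute)

text \<open>Write \<open>e = x - \<xi>\<close>, \<open>f = y - \<xi>\<close>, and let \<open>a, b \<ge> 1\<close> be the two exponential weights. In the inner
  product of \<open>M\<close> the right-hand side equals
  \<open>(a + b) / 2 \<bar>e - f\<bar>\<^sup>2 + (a - b) (\<bar>e\<bar>\<^sup>2 - \<bar>f\<bar>\<^sup>2) / 2\<close>. The last product is nonnegative because the weight
  increases with the norm.\<close>
lemma exp_grad_strongly_monotone:
  fixes M :: "real^'n^'n"
  assumes sym: "transpose M = M" and c: "0 < c" "\<And>x. c * (norm x)\<^sup>2 \<le> wnorm_sq M x"
    and \<rho>: "0 \<le> \<rho>" and \<theta>: "0 \<le> \<theta>"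
  shows "c * (norm (x - y))\<^sup>2 \<le> (x - y) \<bullet> (exp_grad \<theta> M \<xi> \<rho> x - exp_grad \<theta> M \<xi> \<rho> y)"
proof -
  define e f where "e = x - \<xi>" and "f = y - \<xi>"
  define a b where "a = exp (\<theta> * (wnorm_sq M e + \<rho>))" and "b = exp (\<theta> * (wnorm_sq M f + \<rho>))"
  have nn: "0 \<le> wnorm_sq M v" for v using c by (meson mult_nonneg_nonneg less_imp_le order_trans zero_le_power2)
  have ab: "1 \<le> a" "1 \<le> b" using nn \<rho> \<theta> by (auto simp: a_def b_def)
  have ef: "(x - y) = e - f" by (simp add: e_def f_def)
  have cross: "f \<bullet> (M *v e) = e \<bullet> (M *v f)" using symmetric_inner[OF sym, of e f] by (simp add: inner_commute)
  have wx: "exp_grad \<theta> M \<xi> \<rho> x = a *\<^sub>R (M *v e)" and wy: "exp_grad \<theta> M \<xi> \<rho> y = b *\<^sub>R (M *v f)"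
    by (simp_all add: exp_grad_def quad_value_def a_def b_def e_def f_def)
  have "(x - y) \<bullet> (exp_grad \<theta> M \<xi> \<rho> x - exp_grad \<theta> M \<xi> \<rho> y)
      = a * wnorm_sq M e - (a + b) * (e \<bullet> (M *v f)) + b * wnorm_sq M f"
    unfolding ef wx wy by (simp add: cross wnorm_sq_def inner_diff_left inner_diff_right algebra_simps)
  also have "\<dots> = (a + b) / 2 * wnorm_sq M (e - f) + (a - b) * (wnorm_sq M e - wnorm_sq M f) / 2"
    unfolding sym_wnorm_sq_diff[OF sym] by (simp add: field_simps)
  finally have eq: "(x - y) \<bullet> (exp_grad \<theta> M \<xi> \<rho> x - exp_grad \<theta> M \<xi> \<rho> y) = \<dots>" .
  have "0 \<le> (a - b) * (wnorm_sq M e - wnorm_sq M f)"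
  proof (cases "wnorm_sq M e \<le> wnorm_sq M f")
    case True
    then have "a \<le> b" using \<theta> by (simp add: a_def b_def mult_left_mono)
    then show ?thesis using True by (intro mult_nonpos_nonpos) auto
  next
    case False
    then have "b \<le> a" using \<theta> by (simp add: a_def b_def mult_left_mono)
    then show ?thesis using False by (intro mult_nonneg_nonneg) auto
  qed
  moreover have "wnorm_sq M (e - f) \<le> (a + b) / 2 * wnorm_sq M (e - f)"
    using mult_right_mono[OF _ nn[of "e - f"], of 1 "(a + b) / 2"] ab by simp
  ultimately show ?thesis using eq c(2)[of "x - y"] unfolding ef by linarith
qed

lemma exp_hess_coercive:
  fixes M :: "real^'n^'n"
  assumes c: "0 < c" "\<And>x. c * (norm x)\<^sup>2 \<le> wnorm_sq M x" and \<rho>: "0 \<le> \<rho>" and \<theta>: "0 \<le> \<theta>"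
  shows "c * (norm v)\<^sup>2 \<le> v \<bullet> exp_hess \<theta> M \<xi> \<rho> x v"
proof -
  have nn: "0 \<le> wnorm_sq M v" for v using c by (meson mult_nonneg_nonneg less_imp_le order_trans zero_le_power2)
  let ?E = "exp (\<theta> * quad_value M \<xi> \<rho> x)" and ?p = "M *v (x - \<xi>)"
  have E: "1 \<le> ?E" using nn \<rho> \<theta> by (simp add: quad_value_def)
  have "v \<bullet> exp_hess \<theta> M \<xi> \<rho> x v = ?E * (wnorm_sq M v + 2 * \<theta> * (?p \<bullet> v)\<^sup>2)"
    by (simp add: exp_hess_def wnorm_sq_def inner_add_right power2_eq_square inner_commute mult_ac)
  also have "\<dots> \<ge> 1 * wnorm_sq M v"
    using E nn[of v] \<theta> by (intro mult_mono) auto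
  finally show ?thesis using c(2)[of v] by simp
qed

lemma linear_exp_hess: "linear (exp_hess \<theta> M \<xi> \<rho> x)"
  unfolding exp_hess_def
  by (intro linearI) (simp_all add: matrix_vector_right_distrib matrix_vector_mult_scaleR
      inner_add_right scaleR_add_left scaleR_add_right algebra_simps)

lemma total_grad_strongly_monotone:
  assumes F: "coercive_family c I M \<rho>" and \<theta>: "0 \<le> \<theta>"
  shows "c * (norm (x - y))\<^sup>2 \<le> (x - y) \<bullet> (total_grad \<theta> I M \<xi> \<rho> x - total_grad \<theta> I M \<xi> \<rho> y)"
proof -
  have fin: "finite I" "I \<noteq> {}" and c: "0 < c" using F by (auto simp: coercive_family_def)
  have "c * (norm (x - y))\<^sup>2 \<le> real (card I) * (c * (norm (x - y))\<^sup>2)"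
    using fin c mult_right_mono[of 1 "real (card I)" "c * (norm (x - y))\<^sup>2"]
    by (simp add: card_gt_0_iff Suc_le_eq)
  also have "\<dots> = (\<Sum>k\<in>I. c * (norm (x - y))\<^sup>2)" by simp
  also have "\<dots> \<le> (\<Sum>k\<in>I. (x - y) \<bullet> (exp_grad \<theta> (M k) (\<xi> k) (\<rho> k) x - exp_grad \<theta> (M k) (\<xi> k) (\<rho> k) y))"
    using F by (intro sum_mono exp_grad_strongly_monotone \<theta>) (auto simp: coercive_family_def)
  also have "\<dots> = (x - y) \<bullet> (total_grad \<theta> I M \<xi> \<rho> x - total_grad \<theta> I M \<xi> \<rho> y)"
    by (simp add: total_grad_def inner_sum_right flip: sum_subtractf)
  finally show ?thesis .
qed

text \<open>The source of all stability statements: the distance of a zero to any point is bounded by the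
  residual at that point.\<close>
lemma total_grad_zero_dist:
  assumes F: "coercive_family c I M \<rho>" and \<theta>: "0 \<le> \<theta>" and x: "total_grad \<theta> I M \<xi> \<rho> x = 0"
  shows "c * norm (x - y) \<le> norm (total_grad \<theta> I M \<xi> \<rho> y)"
  using coercive_norm_ge[OF total_grad_strongly_monotone[OF F \<theta>, where x = x and y = y and \<xi> = \<xi>]] x by simp

lemma quad_value_ge:
  assumes "coercive_family c I M \<rho>" "k \<in> I"
  shows "c * (norm (x - \<xi> k))\<^sup>2 \<le> quad_value (M k) (\<xi> k) (\<rho> k) x" "0 \<le> quad_value (M k) (\<xi> k) (\<rho> k) x"
proof -
  show 1: "c * (norm (x - \<xi> k))\<^sup>2 \<le> quad_value (M k) (\<xi> k) (\<rho> k) x"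
    using assms by (auto simp: coercive_family_def quad_value_def intro: add_increasing2)
  have "0 \<le> c * (norm (x - \<xi> k))\<^sup>2" using assms by (simp add: coercive_family_def)
  with 1 show "0 \<le> quad_value (M k) (\<xi> k) (\<rho> k) x" by linarith
qed

text \<open>Outside the ball of radius \<open>r\<close> around \<open>z\<close> the function exceeds \<open>f z\<close>, so the minimum over this ball is
  global and \<open>arg_min\<close> attains it.\<close>
lemma coercive_arg_min:
  fixes f :: "'a::euclidean_space \<Rightarrow> real"
  assumes f: "continuous_on UNIV f" and a: "0 < a" and ge: "\<And>x. a * (norm (x - z))\<^sup>2 - b \<le> f x"
  shows "f (arg_min f (\<lambda>_. True)) \<le> f y"
proof -
  define r where "r = (f z + b) / a + 1"
  have r1: "1 \<le> r" using ge[of z] a by (simp add: r_def)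
  obtain x where x: "x \<in> cball z r" "\<And>y. y \<in> cball z r \<Longrightarrow> f x \<le> f y"
    using continuous_attains_inf[OF compact_cball _ continuous_on_subset[OF f subset_UNIV], of z r] r1 by auto
  have "f x \<le> f y" for y
  proof (cases "y \<in> cball z r")
    case False
    then have "r \<le> norm (y - z)" by (simp add: dist_norm norm_minus_commute)
    then have "r\<^sup>2 \<le> (norm (y - z))\<^sup>2" using r1 by (intro power_mono) auto
    moreover have "r \<le> r\<^sup>2" using r1 by (simp add: power2_eq_square)
    ultimately have "a * r \<le> a * (norm (y - z))\<^sup>2" using a by simp
    moreover have "a * r = f z + b + a" using a by (simp add: r_def field_simps)
    ultimately have "f z \<le> f y" using ge[of y] a by linarith
    then show ?thesis using x(2)[of z] r1 by simp
  qed (use x in auto)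
  then have "is_arg_min f (\<lambda>_. True) x" by (auto simp: is_arg_min_def not_less)
  then have "is_arg_min f (\<lambda>_. True) (arg_min f (\<lambda>_. True))" unfolding arg_min_def by (rule someI)
  then show ?thesis by (auto simp: is_arg_min_def not_less)
qed

lemma quad_value_has_derivative:
  fixes M :: "real^'n^'n"
  assumes sym: "transpose M = M"
  shows "((\<lambda>s. quad_value M \<xi> \<rho> (x + s *\<^sub>R v)) has_real_derivative 2 * ((M *v (x - \<xi>)) \<bullet> v)) (at 0)"
proof -
  have "quad_value M \<xi> \<rho> (x + s *\<^sub>R v) = quad_value M \<xi> \<rho> x + s * (2 * ((M *v (x - \<xi>)) \<bullet> v)) + s\<^sup>2 * wnorm_sq M v" for s
  proof -
    define e where "e = x - \<xi>"
    have "x + s *\<^sub>R v - \<xi> = e + s *\<^sub>R v" by (simp add: e_def)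
    moreover have "e \<bullet> (M *v v) = (M *v e) \<bullet> v" "v \<bullet> (M *v e) = (M *v e) \<bullet> v"
      using symmetric_inner[OF sym, of e v] by (simp_all add: inner_commute)
    ultimately show ?thesis
      unfolding quad_value_def wnorm_sq_def e_def[symmetric]
      by (simp add: matrix_vector_right_distrib matrix_vector_mult_scaleR inner_add_left inner_add_right
          power2_eq_square algebra_simps)
  qed
  then show ?thesis by (auto intro!: derivative_eq_intros)
qed

lemma continuous_on_quad_value [continuous_intros]:
  "continuous_on A f \<Longrightarrow> continuous_on A (\<lambda>x. quad_value M \<xi> \<rho> (f x))"
  unfolding quad_value_def wnorm_sq_def by (intro continuous_intros)

text \<open>First-order condition, tested in the direction of the gradient itself.\<close>
lemma total_grad_mean_estimator:
  assumes F: "coercive_family c I M \<rho>" and V: "\<And>k x. k \<in> I \<Longrightarrow> V k t x = quad_value (M k) (\<xi> k) (\<rho> k) x"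
  shows "total_grad 0 I M \<xi> \<rho> (mean_estimator I V t) = 0"
proof -
  have fin: "finite I" and c: "0 < c" and sym: "\<And>k. k \<in> I \<Longrightarrow> transpose (M k) = M k"
    using F by (auto simp: coercive_family_def)
  obtain j where j: "j \<in> I" using F by (auto simp: coercive_family_def)
  then have N: "0 < card I" using fin by (auto simp: card_gt_0_iff)
  define f where "f x = 1 / real (card I) * (\<Sum>k\<in>I. quad_value (M k) (\<xi> k) (\<rho> k) x)" for x
  have fV: "(\<lambda>x. 1 / real (card I) * (\<Sum>k\<in>I. V k t x)) = f" by (auto simp: f_def V)
  let ?x = "mean_estimator I V t"
  have min: "f ?x \<le> f y" for y
    unfolding mean_estimator_def fV
  proof (rule coercive_arg_min[where a = "c / real (card I)" and z = "\<xi> j" and b = 0])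
    show "continuous_on UNIV f" unfolding f_def[abs_def] by (intro continuous_intros)
    show "0 < c / real (card I)" using c N by simp
    fix x
    have "quad_value (M j) (\<xi> j) (\<rho> j) x \<le> (\<Sum>k\<in>I. quad_value (M k) (\<xi> k) (\<rho> k) x)"
      using j fin quad_value_ge(2)[OF F] by (intro member_le_sum) auto
    then have "c * (norm (x - \<xi> j))\<^sup>2 \<le> (\<Sum>k\<in>I. quad_value (M k) (\<xi> k) (\<rho> k) x)"
      using quad_value_ge(1)[OF F j, where \<xi> = \<xi> and x = x] by linarith
    then show "c / real (card I) * (norm (x - \<xi> j))\<^sup>2 - 0 \<le> f x"
      using N by (simp add: f_def divide_right_mono)
  qed
  define v where "v = total_grad 0 I M \<xi> \<rho> ?x"
  have "((\<lambda>s. f (?x + s *\<^sub>R v)) has_real_derivative 1 / real (card I) * (\<Sum>k\<in>I. 2 * ((M k *v (?x - \<xi> k)) \<bullet> v))) (at 0)"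
    unfolding f_def by (intro DERIV_cmult DERIV_sum quad_value_has_derivative sym)
  then have "1 / real (card I) * (\<Sum>k\<in>I. 2 * ((M k *v (?x - \<xi> k)) \<bullet> v)) = 0"
    by (rule DERIV_local_min[of _ _ _ 1]) (use min in auto)
  then have "v \<bullet> v = 0"
    using N by (simp add: v_def total_grad_def exp_grad_def inner_sum_left flip: sum_distrib_left)
  then show ?thesis by (simp add: v_def)
qed

lemma sum_exp_bounds:
  assumes "finite I" "k \<in> I"
  shows "exp (u k) \<le> (\<Sum>k\<in>I. exp (u k :: real))" "0 < (\<Sum>k\<in>I. exp (u k))"
proof -
  show 1: "exp (u k) \<le> (\<Sum>k\<in>I. exp (u k))" using assms by (intro member_le_sum) auto
  show "0 < (\<Sum>k\<in>I. exp (u k))" by (rule less_le_trans[OF _ 1]) simp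
qed

text \<open>The cost of the exponential estimator as a function of the values \<open>u k\<close>. It is a smooth substitute
  for their maximum: the next two lemmas show that it differs from the maximum by at most
  \<open>ln (card I) / \<theta>\<close>.\<close>
definition log_mean_exp :: "real \<Rightarrow> 'k set \<Rightarrow> ('k \<Rightarrow> real) \<Rightarrow> real" where
  "log_mean_exp \<theta> I u = 1 / \<theta> * ln (1 / real (card I) * (\<Sum>k\<in>I. exp (\<theta> * u k)))"

lemma log_mean_exp_lower:
  assumes I: "finite I" "k \<in> I" and \<theta>: "0 < \<theta>"
  shows "u k - ln (real (card I)) / \<theta> \<le> log_mean_exp \<theta> I u"
proof -
  have N: "0 < real (card I)" using I by (auto simp: card_gt_0_iff)
  have "\<theta> * u k - ln (real (card I)) = ln (1 / real (card I) * exp (\<theta> * u k))"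
    using N by (simp add: ln_div)
  also have "\<dots> \<le> ln (1 / real (card I) * (\<Sum>k\<in>I. exp (\<theta> * u k)))"
    using sum_exp_bounds[OF I, of "\<lambda>k. \<theta> * u k"] N by (simp add: divide_right_mono)
  finally have "1 / \<theta> * (\<theta> * u k - ln (real (card I))) \<le> log_mean_exp \<theta> I u"
    unfolding log_mean_exp_def using \<theta> by (intro mult_left_mono) auto
  then show ?thesis using \<theta> by (simp add: field_simps)
qed

lemma log_mean_exp_upper:
  assumes I: "finite I" "I \<noteq> {}" and \<theta>: "0 < \<theta>" and m: "\<And>k. k \<in> I \<Longrightarrow> u k \<le> m"
  shows "log_mean_exp \<theta> I u \<le> m"
proof -
  have N: "0 < real (card I)" using I by (auto simp: card_gt_0_iff)
  obtain k where k: "k \<in> I" using I by auto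
  have "(\<Sum>k\<in>I. exp (\<theta> * u k)) \<le> (\<Sum>k\<in>I. exp (\<theta> * m))" using m \<theta> by (intro sum_mono) simp
  then have "1 / real (card I) * (\<Sum>k\<in>I. exp (\<theta> * u k)) \<le> exp (\<theta> * m)" using N by (simp add: field_simps)
  then have "ln (1 / real (card I) * (\<Sum>k\<in>I. exp (\<theta> * u k))) \<le> ln (exp (\<theta> * m))"
    using sum_exp_bounds(2)[OF I(1) k, of "\<lambda>k. \<theta> * u k"] N by (intro ln_mono) auto
  then have "log_mean_exp \<theta> I u \<le> 1 / \<theta> * (\<theta> * m)" unfolding log_mean_exp_def using \<theta> by (intro mult_left_mono) auto
  then show ?thesis using \<theta> by simp
qed

lemma exp_estimator_le:
  assumes F: "coercive_family c I M \<rho>" and V: "\<And>k x. k \<in> I \<Longrightarrow> V k t x = quad_value (M k) (\<xi> k) (\<rho> k) x"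
    and \<theta>: "0 < \<theta>"
  shows "log_mean_exp \<theta> I (\<lambda>k. quad_value (M k) (\<xi> k) (\<rho> k) (exp_estimator I V \<theta> t))
     \<le> log_mean_exp \<theta> I (\<lambda>k. quad_value (M k) (\<xi> k) (\<rho> k) y)"
proof -
  have fin: "finite I" and c: "0 < c"
    using F by (auto simp: coercive_family_def)
  obtain j where j: "j \<in> I" using F by (auto simp: coercive_family_def)
  then have N: "0 < real (card I)" using fin by (auto simp: card_gt_0_iff)
  define f where "f x = log_mean_exp \<theta> I (\<lambda>k. quad_value (M k) (\<xi> k) (\<rho> k) x)" for x
  have fV: "(\<lambda>x. 1 / \<theta> * ln (1 / real (card I) * (\<Sum>k\<in>I. exp (\<theta> * V k t x)))) = f"
    by (auto simp: f_def V log_mean_exp_def)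
  have "f (exp_estimator I V \<theta> t) \<le> f y"
    unfolding exp_estimator_def fV
  proof (rule coercive_arg_min[where a = c and z = "\<xi> j" and b = "ln (real (card I)) / \<theta>"])
    have "1 / real (card I) * (\<Sum>k\<in>I. exp (\<theta> * quad_value (M k) (\<xi> k) (\<rho> k) x)) \<noteq> 0" for x
      using N sum_exp_bounds(2)[OF fin j, of "\<lambda>k. \<theta> * quad_value (M k) (\<xi> k) (\<rho> k) x"] by simp
    then show "continuous_on UNIV f" unfolding f_def[abs_def] log_mean_exp_def by (intro continuous_intros) auto
    fix x
    show "c * (norm (x - \<xi> j))\<^sup>2 - ln (real (card I)) / \<theta> \<le> f x"
      unfolding f_def using log_mean_exp_lower[OF fin j \<theta>, of "\<lambda>k. quad_value (M k) (\<xi> k) (\<rho> k) x"]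
        quad_value_ge(1)[OF F j, where \<xi> = \<xi> and x = x] by linarith
  qed (rule c)
  then show ?thesis by (simp add: f_def)
qed

text \<open>Since the logarithm is increasing, the estimator also minimizes the sum of the exponentials, whose
  gradient is \<open>2 \<theta>\<close> times \<open>total_grad\<close>.\<close>
lemma total_grad_exp_estimator:
  assumes F: "coercive_family c I M \<rho>" and V: "\<And>k x. k \<in> I \<Longrightarrow> V k t x = quad_value (M k) (\<xi> k) (\<rho> k) x"
    and \<theta>: "0 < \<theta>"
  shows "total_grad \<theta> I M \<xi> \<rho> (exp_estimator I V \<theta> t) = 0"
proof -
  have fin: "finite I" and sym: "\<And>k. k \<in> I \<Longrightarrow> transpose (M k) = M k"
    using F by (auto simp: coercive_family_def)
  obtain j where j: "j \<in> I" using F by (auto simp: coercive_family_def)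
  then have N: "0 < real (card I)" using fin by (auto simp: card_gt_0_iff)
  let ?x = "exp_estimator I V \<theta> t"
  define f where "f x = (\<Sum>k\<in>I. exp (\<theta> * quad_value (M k) (\<xi> k) (\<rho> k) x))" for x
  have fpos: "0 < f x" for x unfolding f_def by (rule sum_exp_bounds(2)[OF fin j])
  have min: "f ?x \<le> f y" for y
  proof -
    have "ln (1 / real (card I) * f ?x) \<le> ln (1 / real (card I) * f y)"
      using exp_estimator_le[where V = V and t = t and \<xi> = \<xi> and y = y, OF F V \<theta>] \<theta> by (simp add: log_mean_exp_def f_def divide_le_cancel)
    then have "1 / real (card I) * f ?x \<le> 1 / real (card I) * f y"
      using N fpos by (subst (asm) ln_le_cancel_iff) (auto intro!: divide_pos_pos)
    then show ?thesis using N by (simp add: divide_le_cancel)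
  qed
  \<comment> \<open>Along the gradient itself the derivative is a positive multiple of its squared norm.\<close>
  define v where "v = total_grad \<theta> I M \<xi> \<rho> ?x"
  have "((\<lambda>s. f (?x + s *\<^sub>R v)) has_real_derivative
      (\<Sum>k\<in>I. exp (\<theta> * quad_value (M k) (\<xi> k) (\<rho> k) (?x + 0 *\<^sub>R v)) * (\<theta> * (2 * ((M k *v (?x - \<xi> k)) \<bullet> v))))) (at 0)"
    unfolding f_def by (intro DERIV_sum DERIV_fun_exp DERIV_cmult quad_value_has_derivative sym)
  then have "(\<Sum>k\<in>I. exp (\<theta> * quad_value (M k) (\<xi> k) (\<rho> k) (?x + 0 *\<^sub>R v)) * (\<theta> * (2 * ((M k *v (?x - \<xi> k)) \<bullet> v)))) = 0"
    by (rule DERIV_local_min[of _ _ _ 1]) (use min in auto)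
  moreover have "(\<Sum>k\<in>I. exp (\<theta> * quad_value (M k) (\<xi> k) (\<rho> k) (?x + 0 *\<^sub>R v)) * (\<theta> * (2 * ((M k *v (?x - \<xi> k)) \<bullet> v))))
      = 2 * \<theta> * (v \<bullet> v)"
    by (simp add: v_def total_grad_def exp_grad_def inner_sum_left sum_distrib_left mult_ac)
  ultimately show ?thesis using \<theta> by (simp add: v_def)
qed

lemma continuous_on_Max_image:
  fixes f :: "'k \<Rightarrow> 'a::topological_space \<Rightarrow> real"
  assumes "finite I" "I \<noteq> {}" "\<And>k. k \<in> I \<Longrightarrow> continuous_on A (f k)"
  shows "continuous_on A (\<lambda>x. MAX k\<in>I. f k x)"
  using assms
proof (induction I rule: finite_ne_induct)
  case (insert k I)
  have "(\<lambda>x. MAX k\<in>insert k I. f k x) = (\<lambda>x. max (f k x) (MAX k\<in>I. f k x))"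
    using insert by simp
  then show ?case using insert by (simp add: continuous_on_max)
qed simp

text \<open>By the parallelogram identity each quadratic function lies, at the midpoint \<open>w\<close> of \<open>x\<close> and the
  minimizer \<open>z\<close>, below the average of its values by at least \<open>c / 4 \<bar>x - z\<bar>\<^sup>2\<close>. The same holds for
  the maximum \<open>m\<close>, and \<open>m z \<le> m w\<close>.\<close>
lemma minimax_estimator_quadratic_growth:
  assumes F: "coercive_family c I M \<rho>" and V: "\<And>k x. k \<in> I \<Longrightarrow> V k t x = quad_value (M k) (\<xi> k) (\<rho> k) x"
  shows "c / 2 * (norm (x - minimax_estimator I V t))\<^sup>2
     \<le> (MAX k\<in>I. quad_value (M k) (\<xi> k) (\<rho> k) x)
       - (MAX k\<in>I. quad_value (M k) (\<xi> k) (\<rho> k) (minimax_estimator I V t))"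
proof -
  have fin: "finite I" and ne: "I \<noteq> {}" and c: "0 < c" and sym: "\<And>k. k \<in> I \<Longrightarrow> transpose (M k) = M k"
    and co: "\<And>k x. k \<in> I \<Longrightarrow> c * (norm x)\<^sup>2 \<le> wnorm_sq (M k) x"
    using F by (auto simp: coercive_family_def)
  obtain j where j: "j \<in> I" using ne by auto
  define q where "q k x = quad_value (M k) (\<xi> k) (\<rho> k) x" for k x
  define m where "m x = (MAX k\<in>I. q k x)" for x
  have qm: "q k x \<le> m x" if "k \<in> I" for k x unfolding m_def using fin that by simp
  have mV: "(\<lambda>x. MAX k\<in>I. V k t x) = m" by (auto simp: m_def q_def V intro!: arg_cong[where f = Max] image_cong)
  let ?z = "minimax_estimator I V t"
  have min: "m ?z \<le> m y" for y
    unfolding minimax_estimator_def mV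
  proof (rule coercive_arg_min[where a = c and z = "\<xi> j" and b = 0])
    show "continuous_on UNIV m" unfolding m_def[abs_def] q_def
      by (intro continuous_on_Max_image fin ne continuous_intros)
    show "c * (norm (x - \<xi> j))\<^sup>2 - 0 \<le> m x" for x
      using qm[OF j, of x] quad_value_ge(1)[OF F j, where \<xi> = \<xi> and x = x] by (simp add: q_def)
  qed (rule c)
  define w where "w = (1/2) *\<^sub>R (x + ?z)"
  have "m w \<le> (m x + m ?z) / 2 - c * (norm (x - ?z))\<^sup>2 / 4"
  proof -
    have "q k w \<le> (m x + m ?z) / 2 - c * (norm (x - ?z))\<^sup>2 / 4" if k: "k \<in> I" for k
    proof -
      define e f where "e = x - \<xi> k" and "f = ?z - \<xi> k"
      have wk: "w - \<xi> k = (1/2) *\<^sub>R (e - (- f))"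
        by (simp add: w_def e_def f_def scaleR_add_right scaleR_diff_right flip: scaleR_add_left)
      have "wnorm_sq (M k) (w - \<xi> k) = (wnorm_sq (M k) e + wnorm_sq (M k) f) / 2 - wnorm_sq (M k) (e - f) / 4"
        unfolding wk wnorm_sq_scaleR sym_wnorm_sq_diff[OF sym[OF k]]
        by (simp add: wnorm_sq_def power2_eq_square matvec.minus_right field_simps)
      then have "q k w = (q k x + q k ?z) / 2 - wnorm_sq (M k) (x - ?z) / 4"
        by (simp add: q_def quad_value_def e_def f_def field_simps)
      moreover have "(q k x + q k ?z) / 2 \<le> (m x + m ?z) / 2"
        using qm[OF k, of x] qm[OF k, of ?z] by simp
      moreover have "c * (norm (x - ?z))\<^sup>2 / 4 \<le> wnorm_sq (M k) (x - ?z) / 4"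
        using co[OF k, of "x - ?z"] by simp
      ultimately show ?thesis by (metis diff_mono)
    qed
    then show ?thesis unfolding m_def using fin ne by (simp add: Max_le_iff)
  qed
  with min[of w] have le: "m ?z \<le> (m x + m ?z) / 2 - c * (norm (x - ?z))\<^sup>2 / 4" by (rule order_trans)
  have "a \<le> (b + a) / 2 - d / 4 \<Longrightarrow> d / 2 \<le> b - a" for a b d :: real by (simp add: field_simps)
  from this[OF le] have "c * (norm (x - ?z))\<^sup>2 / 2 \<le> m x - m ?z" .
  then show ?thesis by (simp add: m_def q_def)
qed

text \<open>With \<open>m\<close> the maximum and \<open>J\<close> the exponential cost,
  \<open>m x - ln N / \<theta> \<le> J x \<le> J z \<le> m z\<close> for the exponential estimator \<open>x\<close> and the minimax estimator \<open>z\<close>.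
  Quadratic growth of \<open>m\<close> turns \<open>m x - m z \<le> ln N / \<theta>\<close> into a bound on the distance.\<close>
lemma exp_estimator_near_minimax:
  assumes F: "coercive_family c I M \<rho>" and V: "\<And>k x. k \<in> I \<Longrightarrow> V k t x = quad_value (M k) (\<xi> k) (\<rho> k) x"
    and \<theta>: "0 < \<theta>"
  shows "norm (exp_estimator I V \<theta> t - minimax_estimator I V t) \<le> sqrt (2 * ln (real (card I)) / (c * \<theta>))"
proof -
  have fin: "finite I" and ne: "I \<noteq> {}" and c: "0 < c" using F by (auto simp: coercive_family_def)
  define q where "q k x = quad_value (M k) (\<xi> k) (\<rho> k) x" for k x
  let ?x = "exp_estimator I V \<theta> t" and ?z = "minimax_estimator I V t"
  have "Max ((\<lambda>k. q k ?x) ` I) \<in> (\<lambda>k. q k ?x) ` I" using fin ne by (intro Max_in) auto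
  then obtain j where j: "j \<in> I" "(MAX k\<in>I. q k ?x) = q j ?x" by auto
  have "(MAX k\<in>I. q k ?x) - ln (real (card I)) / \<theta> \<le> log_mean_exp \<theta> I (\<lambda>k. q k ?x)"
    unfolding j(2) by (rule log_mean_exp_lower[OF fin j(1) \<theta>])
  also have "\<dots> \<le> log_mean_exp \<theta> I (\<lambda>k. q k ?z)" unfolding q_def by (rule exp_estimator_le[where V = V and t = t, OF F V \<theta>])
  also have "\<dots> \<le> (MAX k\<in>I. q k ?z)" using fin by (intro log_mean_exp_upper[OF fin ne \<theta>]) simp
  finally have "c / 2 * (norm (?x - ?z))\<^sup>2 \<le> ln (real (card I)) / \<theta>"
    using minimax_estimator_quadratic_growth[where x = ?x and V = V and t = t and \<xi> = \<xi>, OF F V] by (simp add: q_def)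
  then have "(norm (?x - ?z))\<^sup>2 \<le> 2 * ln (real (card I)) / (c * \<theta>)" using c \<theta> by (simp add: field_simps)
  then show ?thesis by (rule real_le_rsqrt)
qed

section \<open>Dependence of the critical point on the data\<close>

lemma exp_grad_tendsto [tendsto_intros]:
  assumes "(\<theta> \<longlongrightarrow> \<theta>l) F" "(M \<longlongrightarrow> Ml) F" "(\<xi> \<longlongrightarrow> \<xi>l) F" "(\<rho> \<longlongrightarrow> \<rho>l) F" "(x \<longlongrightarrow> xl) F"
  shows "((\<lambda>i. exp_grad (\<theta> i) (M i) (\<xi> i) (\<rho> i) (x i)) \<longlongrightarrow> exp_grad \<theta>l Ml \<xi>l \<rho>l xl) F"
  unfolding exp_grad_def quad_value_def wnorm_sq_def by (intro tendsto_intros assms)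

lemma exp_hess_tendsto [tendsto_intros]:
  assumes "(\<theta> \<longlongrightarrow> \<theta>l) F" "(M \<longlongrightarrow> Ml) F" "(\<xi> \<longlongrightarrow> \<xi>l) F" "(\<rho> \<longlongrightarrow> \<rho>l) F" "(x \<longlongrightarrow> xl) F"
    "(v \<longlongrightarrow> vl) F"
  shows "((\<lambda>i. exp_hess (\<theta> i) (M i) (\<xi> i) (\<rho> i) (x i) (v i)) \<longlongrightarrow> exp_hess \<theta>l Ml \<xi>l \<rho>l xl vl) F"
  unfolding exp_hess_def quad_value_def wnorm_sq_def by (intro tendsto_intros assms)

lemma exp_grad_dt_tendsto [tendsto_intros]:
  assumes "(\<theta> \<longlongrightarrow> \<theta>l) F" "(M \<longlongrightarrow> Ml) F" "(\<xi> \<longlongrightarrow> \<xi>l) F" "(\<rho> \<longlongrightarrow> \<rho>l) F" "(x \<longlongrightarrow> xl) F"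
    "(M' \<longlongrightarrow> M'l) F" "(\<eta> \<longlongrightarrow> \<eta>l) F" "(h \<longlongrightarrow> hl) F"
  shows "((\<lambda>i. exp_grad_dt (\<theta> i) (M i) (\<xi> i) (\<rho> i) (x i) (M' i) (\<eta> i) (h i)) \<longlongrightarrow> exp_grad_dt \<theta>l Ml \<xi>l \<rho>l xl M'l \<eta>l hl) F"
  unfolding exp_grad_dt_def quad_value_def wnorm_sq_def by (intro tendsto_intros assms)

definition total_hess :: "real \<Rightarrow> 'k set \<Rightarrow> ('k \<Rightarrow> real^'n^'n) \<Rightarrow> ('k \<Rightarrow> real^'n) \<Rightarrow> ('k \<Rightarrow> real) \<Rightarrow>
    real^'n \<Rightarrow> real^'n \<Rightarrow> real^'n" where
  "total_hess \<theta> I M \<xi> \<rho> x v = (\<Sum>k\<in>I. exp_hess \<theta> (M k) (\<xi> k) (\<rho> k) x v)"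

definition total_grad_dt :: "real \<Rightarrow> 'k set \<Rightarrow> ('k \<Rightarrow> real^'n^'n) \<Rightarrow> ('k \<Rightarrow> real^'n) \<Rightarrow> ('k \<Rightarrow> real) \<Rightarrow>
    real^'n \<Rightarrow> ('k \<Rightarrow> real^'n^'n) \<Rightarrow> ('k \<Rightarrow> real^'n) \<Rightarrow> ('k \<Rightarrow> real) \<Rightarrow> real^'n" where
  "total_grad_dt \<theta> I M \<xi> \<rho> x M' \<eta> h = (\<Sum>k\<in>I. exp_grad_dt \<theta> (M k) (\<xi> k) (\<rho> k) x (M' k) (\<eta> k) (h k))"

definition hess_solve :: "real \<Rightarrow> 'k set \<Rightarrow> ('k \<Rightarrow> real^'n^'n) \<Rightarrow> ('k \<Rightarrow> real^'n) \<Rightarrow> ('k \<Rightarrow> real) \<Rightarrow>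
    real^'n \<Rightarrow> real^'n \<Rightarrow> real^'n" where
  "hess_solve \<theta> I M \<xi> \<rho> x b = (SOME v. total_hess \<theta> I M \<xi> \<rho> x v = b)"

lemma total_hess_coercive:
  assumes F: "coercive_family c I M \<rho>" and \<theta>: "0 \<le> \<theta>"
  shows "c * (norm v)\<^sup>2 \<le> v \<bullet> total_hess \<theta> I M \<xi> \<rho> x v"
proof -
  have fin: "finite I" "I \<noteq> {}" and c: "0 < c" using F by (auto simp: coercive_family_def)
  have "c * (norm v)\<^sup>2 \<le> real (card I) * (c * (norm v)\<^sup>2)"
    using fin c mult_right_mono[of 1 "real (card I)" "c * (norm v)\<^sup>2"]
    by (simp add: card_gt_0_iff Suc_le_eq)
  also have "\<dots> = (\<Sum>k\<in>I. c * (norm v)\<^sup>2)" by simp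
  also have "\<dots> \<le> (\<Sum>k\<in>I. v \<bullet> exp_hess \<theta> (M k) (\<xi> k) (\<rho> k) x v)"
    using F by (intro sum_mono exp_hess_coercive \<theta>) (auto simp: coercive_family_def)
  also have "\<dots> = v \<bullet> total_hess \<theta> I M \<xi> \<rho> x v" by (simp add: total_hess_def inner_sum_right)
  finally show ?thesis .
qed

lemma linear_total_hess: "linear (total_hess \<theta> I M \<xi> \<rho> x)"
  unfolding total_hess_def[abs_def] by (intro linear_compose_sum ballI linear_exp_hess)

lemma total_hess_hess_solve:
  assumes F: "coercive_family c I M \<rho>" and \<theta>: "0 \<le> \<theta>"
  shows "total_hess \<theta> I M \<xi> \<rho> x (hess_solve \<theta> I M \<xi> \<rho> x b) = b"
  unfolding hess_solve_def
proof (rule someI_ex)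
  have "0 < c" using F by (simp add: coercive_family_def)
  then show "\<exists>v. total_hess \<theta> I M \<xi> \<rho> x v = b"
    by (rule coercive_solution_exists[OF linear_total_hess _ total_hess_coercive[OF F \<theta>]])
qed

text \<open>The analogue of \<open>total_grad_zero_dist\<close> for the linearized equation: any candidate \<open>v\<close> is as close to the
  solution as its residual is small.\<close>
lemma hess_solve_dist:
  assumes F: "coercive_family c I M \<rho>" and \<theta>: "0 \<le> \<theta>"
  shows "c * norm (hess_solve \<theta> I M \<xi> \<rho> x b - v) \<le> norm (b - total_hess \<theta> I M \<xi> \<rho> x v)"
proof -
  let ?w = "hess_solve \<theta> I M \<xi> \<rho> x b"
  have "total_hess \<theta> I M \<xi> \<rho> x (?w - v) = b - total_hess \<theta> I M \<xi> \<rho> x v"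
    by (simp add: linear_diff[OF linear_total_hess] total_hess_hess_solve[OF F \<theta>])
  then show ?thesis using coercive_norm_ge[OF total_hess_coercive[OF F \<theta>, where v = "?w - v"]] by metis
qed

lemma hess_solve_diff_le:
  assumes F: "coercive_family c I M \<rho>" and \<theta>: "0 \<le> \<theta>"
  shows "c * norm (hess_solve \<theta> I M \<xi> \<rho> x b - hess_solve \<theta> I M \<xi> \<rho> x b') \<le> norm (b - b')"
  using hess_solve_dist[OF F \<theta>, of \<xi> x b "hess_solve \<theta> I M \<xi> \<rho> x b'"] by (simp add: total_hess_hess_solve[OF F \<theta>])

lemma hess_solve_norm_le:
  assumes F: "coercive_family c I M \<rho>" and \<theta>: "0 \<le> \<theta>"
  shows "c * norm (hess_solve \<theta> I M \<xi> \<rho> x b) \<le> norm b"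
  using hess_solve_dist[OF F \<theta>, of \<xi> x b 0] by (simp add: linear_0[OF linear_total_hess])

lemma tendsto_of_coercive_bound:
  fixes v :: "'i \<Rightarrow> 'a::real_normed_vector" and w :: "'i \<Rightarrow> 'b::real_normed_vector"
  assumes c: "0 < c" and le: "\<forall>\<^sub>F i in F. c * norm (v i - vl) \<le> norm (w i)" and w: "(w \<longlongrightarrow> 0) F"
  shows "(v \<longlongrightarrow> vl) F"
proof (rule LIM_zero_cancel, rule Lim_null_comparison)
  show "\<forall>\<^sub>F i in F. norm (v i - vl) \<le> norm (w i) / c"
    using le by eventually_elim (use c in \<open>simp add: field_simps\<close>)
  show "((\<lambda>i. norm (w i) / c) \<longlongrightarrow> 0) F"
    using tendsto_divide_zero[OF tendsto_norm_zero[OF w]] .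
qed

lemma hess_solve_tendsto:
  assumes F: "\<forall>\<^sub>F i in F. coercive_family c I (M i) (\<rho> i)" and \<theta>: "\<forall>\<^sub>F i in F. 0 \<le> \<theta> i"
    and Fl: "coercive_family c I Ml \<rho>l" and \<theta>l: "0 \<le> \<theta>l"
    and lim: "(\<theta> \<longlongrightarrow> \<theta>l) F" "\<And>k. k \<in> I \<Longrightarrow> ((\<lambda>i. M i k) \<longlongrightarrow> Ml k) F" "\<And>k. k \<in> I \<Longrightarrow> ((\<lambda>i. \<xi> i k) \<longlongrightarrow> \<xi>l k) F"
      "\<And>k. k \<in> I \<Longrightarrow> ((\<lambda>i. \<rho> i k) \<longlongrightarrow> \<rho>l k) F" "(x \<longlongrightarrow> xl) F" "(b \<longlongrightarrow> bl) F"
  shows "((\<lambda>i. hess_solve (\<theta> i) I (M i) (\<xi> i) (\<rho> i) (x i) (b i)) \<longlongrightarrow> hess_solve \<theta>l I Ml \<xi>l \<rho>l xl bl) F"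
proof (rule tendsto_of_coercive_bound)
  let ?v = "hess_solve \<theta>l I Ml \<xi>l \<rho>l xl bl"
  show "0 < c" using Fl by (simp add: coercive_family_def)
  show "\<forall>\<^sub>F i in F. c * norm (hess_solve (\<theta> i) I (M i) (\<xi> i) (\<rho> i) (x i) (b i) - ?v)
      \<le> norm (b i - total_hess (\<theta> i) I (M i) (\<xi> i) (\<rho> i) (x i) ?v)"
    using F \<theta> by eventually_elim (rule hess_solve_dist)
  have "((\<lambda>i. b i - total_hess (\<theta> i) I (M i) (\<xi> i) (\<rho> i) (x i) ?v) \<longlongrightarrow> bl - total_hess \<theta>l I Ml \<xi>l \<rho>l xl ?v) F"
    unfolding total_hess_def by (intro tendsto_intros lim)
  then show "((\<lambda>i. b i - total_hess (\<theta> i) I (M i) (\<xi> i) (\<rho> i) (x i) ?v) \<longlongrightarrow> 0) F"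
    by (simp add: total_hess_hess_solve[OF Fl \<theta>l])
qed

lemma total_grad_dt_tendsto:
  assumes "(\<theta> \<longlongrightarrow> \<theta>l) F" "\<And>k. k \<in> I \<Longrightarrow> ((\<lambda>i. M i k) \<longlongrightarrow> Ml k) F" "\<And>k. k \<in> I \<Longrightarrow> ((\<lambda>i. \<xi> i k) \<longlongrightarrow> \<xi>l k) F"
      "\<And>k. k \<in> I \<Longrightarrow> ((\<lambda>i. \<rho> i k) \<longlongrightarrow> \<rho>l k) F" "(x \<longlongrightarrow> xl) F"
      "\<And>k. k \<in> I \<Longrightarrow> ((\<lambda>i. M' i k) \<longlongrightarrow> M'l k) F" "\<And>k. k \<in> I \<Longrightarrow> ((\<lambda>i. \<eta> i k) \<longlongrightarrow> \<eta>l k) F"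
      "\<And>k. k \<in> I \<Longrightarrow> ((\<lambda>i. h i k) \<longlongrightarrow> hl k) F"
  shows "((\<lambda>i. total_grad_dt (\<theta> i) I (M i) (\<xi> i) (\<rho> i) (x i) (M' i) (\<eta> i) (h i)) \<longlongrightarrow> total_grad_dt \<theta>l I Ml \<xi>l \<rho>l xl M'l \<eta>l hl) F"
  unfolding total_grad_dt_def by (intro tendsto_intros assms)

lemma total_grad_zero_tendsto:
  assumes F: "\<forall>\<^sub>F i in F. coercive_family c I (M i) (\<rho> i)" and \<theta>: "\<forall>\<^sub>F i in F. 0 \<le> \<theta> i" and c: "0 < c"
    and lim: "(\<theta> \<longlongrightarrow> \<theta>l) F" "\<And>k. k \<in> I \<Longrightarrow> ((\<lambda>i. M i k) \<longlongrightarrow> Ml k) F" "\<And>k. k \<in> I \<Longrightarrow> ((\<lambda>i. \<xi> i k) \<longlongrightarrow> \<xi>l k) F"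
      "\<And>k. k \<in> I \<Longrightarrow> ((\<lambda>i. \<rho> i k) \<longlongrightarrow> \<rho>l k) F"
    and x: "\<forall>\<^sub>F i in F. total_grad (\<theta> i) I (M i) (\<xi> i) (\<rho> i) (x i) = 0" and xl: "total_grad \<theta>l I Ml \<xi>l \<rho>l xl = 0"
  shows "(x \<longlongrightarrow> xl) F"
proof (rule tendsto_of_coercive_bound[OF c])
  show "\<forall>\<^sub>F i in F. c * norm (x i - xl) \<le> norm (total_grad (\<theta> i) I (M i) (\<xi> i) (\<rho> i) xl)"
    using F \<theta> x by eventually_elim (rule total_grad_zero_dist)
  have "((\<lambda>i. total_grad (\<theta> i) I (M i) (\<xi> i) (\<rho> i) xl) \<longlongrightarrow> total_grad \<theta>l I Ml \<xi>l \<rho>l xl) F"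
    unfolding total_grad_def by (intro tendsto_intros lim)
  then show "((\<lambda>i. total_grad (\<theta> i) I (M i) (\<xi> i) (\<rho> i) xl) \<longlongrightarrow> 0) F" by (simp add: xl)
qed

lemma total_grad_zero_exists:
  assumes F: "coercive_family c I M \<rho>" and \<theta>: "0 \<le> \<theta>"
  shows "\<exists>x. total_grad \<theta> I M \<xi> \<rho> x = 0"
proof (cases "\<theta> = 0")
  case True
  then show ?thesis
    using total_grad_mean_estimator[where V = "\<lambda>k _ x. quad_value (M k) (\<xi> k) (\<rho> k) x" and \<xi> = \<xi> and t = "0::real", OF F] by auto
next
  case False
  then show ?thesis
    using total_grad_exp_estimator[where V = "\<lambda>k _ x. quad_value (M k) (\<xi> k) (\<rho> k) x" and \<xi> = \<xi> and t = "0::real" and \<theta> = \<theta>, OF F] \<theta> by auto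
qed

lemma exp_grad_dt_diff: "exp_grad_dt \<theta> M \<xi> \<rho> x M' \<eta> h - exp_grad_dt \<theta> M \<xi> \<rho> x M' \<eta>' h' = exp_grad_dt \<theta> M \<xi> \<rho> x 0 (\<eta> - \<eta>') (h - h')"
proof -
  have "M *v (\<eta> - \<eta>') = M *v \<eta> - M *v \<eta>'" by (rule matvec.diff_right)
  then show ?thesis
    unfolding exp_grad_dt_def scaleR_diff_right[symmetric]
    by (simp add: inner_diff_left algebra_simps)
qed

lemma exp_grad_dt_scale: "exp_grad_dt \<theta> M \<xi> \<rho> x 0 (s *\<^sub>R \<eta>) (s * h) = s *\<^sub>R exp_grad_dt \<theta> M \<xi> \<rho> x 0 \<eta> h"
  by (simp add: exp_grad_dt_def matrix_vector_mult_scaleR algebra_simps)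

text \<open>The map \<open>exp_grad_dt\<close> is affine in \<open>(\<eta>, h)\<close>. On bounded sets of the remaining data and for \<open>(\<eta>, h)\<close> in
  the unit balls it is bounded by compactness. Homogeneity of the linear part extends this to all \<open>(\<eta>, h)\<close>
  and gives the Lipschitz bound as well.\<close>
lemma exp_grad_dt_growth:
  fixes b \<Theta> :: real
  obtains K where "0 \<le> K"
    "\<And>\<theta> (M :: real^'n^'n) M' \<xi> \<rho> x \<eta> h. \<theta> \<in> {0..\<Theta>} \<Longrightarrow> norm M \<le> b \<Longrightarrow> norm M' \<le> b \<Longrightarrow>
      norm \<xi> \<le> b \<Longrightarrow> \<bar>\<rho>\<bar> \<le> b \<Longrightarrow> norm x \<le> b \<Longrightarrow>
      norm (exp_grad_dt \<theta> M \<xi> \<rho> x M' \<eta> h) \<le> K * (1 + norm \<eta> + \<bar>h\<bar>)"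
    "\<And>\<theta> (M :: real^'n^'n) M' \<xi> \<rho> x \<eta> h \<eta>' h'. \<theta> \<in> {0..\<Theta>} \<Longrightarrow> norm M \<le> b \<Longrightarrow> norm M' \<le> b \<Longrightarrow>
      norm \<xi> \<le> b \<Longrightarrow> \<bar>\<rho>\<bar> \<le> b \<Longrightarrow> norm x \<le> b \<Longrightarrow>
      norm (exp_grad_dt \<theta> M \<xi> \<rho> x M' \<eta> h - exp_grad_dt \<theta> M \<xi> \<rho> x M' \<eta>' h') \<le> K * (norm (\<eta> - \<eta>') + \<bar>h - h'\<bar>)"
proof -
  let ?D = "{0..\<Theta>} \<times> cball (0 :: real^'n^'n) b \<times> cball (0 :: real^'n^'n) b \<times> cball (0 :: real^'n) b \<times> cball (0 :: real) b
    \<times> cball (0 :: real^'n) b \<times> cball (0 :: real^'n) 1 \<times> cball (0 :: real) 1"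
  let ?f = "\<lambda>(\<theta>, M, M', \<xi>, \<rho>, x, \<eta>, h). exp_grad_dt \<theta> M \<xi> \<rho> x M' \<eta> h"
  have "continuous_on ?D ?f"
    unfolding exp_grad_dt_def quad_value_def wnorm_sq_def case_prod_unfold by (intro continuous_intros)
  moreover have "compact ?D" by (intro compact_Times compact_cball compact_Icc)
  ultimately have "bounded (?f ` ?D)" by (intro compact_imp_bounded compact_continuous_image)
  then obtain K where K0: "0 < K" and K: "\<And>z. z \<in> ?D \<Longrightarrow> norm (?f z) \<le> K" unfolding bounded_pos by blast
  show thesis
  proof (rule that[OF less_imp_le[OF K0]])
    fix \<theta> \<rho> h :: real and M M' :: "real^'n^'n" and \<xi> x \<eta> :: "real^'n"
    assume b: "\<theta> \<in> {0..\<Theta>}" "norm M \<le> b" "norm M' \<le> b" "norm \<xi> \<le> b" "\<bar>\<rho>\<bar> \<le> b" "norm x \<le> b"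
    have lin: "norm (exp_grad_dt \<theta> M \<xi> \<rho> x 0 \<eta> h) \<le> K * (norm \<eta> + \<bar>h\<bar>)" for \<eta> h
    proof -
      define s where "s = norm \<eta> + \<bar>h\<bar>"
      consider "s = 0" | "0 < s" unfolding s_def by (smt (verit) norm_ge_zero)
      then show ?thesis
      proof cases
        case 1
        then have "\<eta> = 0" "h = 0" unfolding s_def by (smt (verit) norm_ge_zero norm_eq_zero)+
        then show ?thesis using exp_grad_dt_scale[of \<theta> M \<xi> \<rho> x 0 0 0] by simp
      next
        case 2
        have le: "norm \<eta> \<le> s" "\<bar>h\<bar> \<le> s" by (simp_all add: s_def)
        have "0 \<le> b" using b(2) norm_ge_zero[of M] by linarith
        then have "(\<theta>, M, 0, \<xi>, \<rho>, x, inverse s *\<^sub>R \<eta>, inverse s * h) \<in> ?D"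
          using b le 2 by (simp add: abs_mult field_simps)
        from K[OF this] have "s * norm (exp_grad_dt \<theta> M \<xi> \<rho> x 0 (inverse s *\<^sub>R \<eta>) (inverse s * h)) \<le> s * K"
          using 2 by simp
        also have "s * norm (exp_grad_dt \<theta> M \<xi> \<rho> x 0 (inverse s *\<^sub>R \<eta>) (inverse s * h)) = norm (exp_grad_dt \<theta> M \<xi> \<rho> x 0 \<eta> h)"
          unfolding exp_grad_dt_scale using 2 by simp
        finally show ?thesis by (simp add: s_def mult.commute)
      qed
    qed
    show "norm (exp_grad_dt \<theta> M \<xi> \<rho> x M' \<eta> h) \<le> K * (1 + norm \<eta> + \<bar>h\<bar>)"
    proof -
      have "norm (exp_grad_dt \<theta> M \<xi> \<rho> x M' 0 0) \<le> K" using K[of "(\<theta>, M, M', \<xi>, \<rho>, x, 0, 0)"] b by simp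
      moreover have "exp_grad_dt \<theta> M \<xi> \<rho> x M' \<eta> h = exp_grad_dt \<theta> M \<xi> \<rho> x M' 0 0 + exp_grad_dt \<theta> M \<xi> \<rho> x 0 \<eta> h"
        using exp_grad_dt_diff[of \<theta> M \<xi> \<rho> x M' \<eta> h 0 0] by (simp add: algebra_simps)
      ultimately show ?thesis
        using lin[of \<eta> h] norm_triangle_ineq[of "exp_grad_dt \<theta> M \<xi> \<rho> x M' 0 0" "exp_grad_dt \<theta> M \<xi> \<rho> x 0 \<eta> h"]
        by (simp add: algebra_simps)
    qed
    fix \<eta>' h'
    show "norm (exp_grad_dt \<theta> M \<xi> \<rho> x M' \<eta> h - exp_grad_dt \<theta> M \<xi> \<rho> x M' \<eta>' h') \<le> K * (norm (\<eta> - \<eta>') + \<bar>h - h'\<bar>)"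
      unfolding exp_grad_dt_diff by (rule lin)
  qed
qed

lemma total_grad_dt_growth:
  fixes I :: "'k set" and b \<Theta> :: real
  obtains K where "0 \<le> K"
    "\<And>\<theta> (M :: 'k \<Rightarrow> real^'n^'n) M' \<xi> \<rho> x \<eta> h. \<theta> \<in> {0..\<Theta>} \<Longrightarrow>
      (\<And>k. k \<in> I \<Longrightarrow> norm (M k) \<le> b \<and> norm (M' k) \<le> b \<and> norm (\<xi> k) \<le> b \<and> \<bar>\<rho> k\<bar> \<le> b) \<Longrightarrow> norm x \<le> b \<Longrightarrow>
      norm (total_grad_dt \<theta> I M \<xi> \<rho> x M' \<eta> h) \<le> K * (\<Sum>k\<in>I. 1 + norm (\<eta> k) + \<bar>h k\<bar>)"
    "\<And>\<theta> (M :: 'k \<Rightarrow> real^'n^'n) M' \<xi> \<rho> x \<eta> h \<eta>' h'. \<theta> \<in> {0..\<Theta>} \<Longrightarrow>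
      (\<And>k. k \<in> I \<Longrightarrow> norm (M k) \<le> b \<and> norm (M' k) \<le> b \<and> norm (\<xi> k) \<le> b \<and> \<bar>\<rho> k\<bar> \<le> b) \<Longrightarrow> norm x \<le> b \<Longrightarrow>
      norm (total_grad_dt \<theta> I M \<xi> \<rho> x M' \<eta> h - total_grad_dt \<theta> I M \<xi> \<rho> x M' \<eta>' h')
         \<le> K * (\<Sum>k\<in>I. norm (\<eta> k - \<eta>' k) + \<bar>h k - h' k\<bar>)"
proof -
  show thesis
  proof (rule exp_grad_dt_growth[where 'n = 'n and \<Theta> = \<Theta> and b = b])
    fix K assume K0: "0 \<le> K" and K1: "\<And>\<theta> (M :: real^'n^'n) M' \<xi> \<rho> x \<eta> h. \<theta> \<in> {0..\<Theta>} \<Longrightarrow> norm M \<le> b \<Longrightarrow> norm M' \<le> b \<Longrightarrow>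
      norm \<xi> \<le> b \<Longrightarrow> \<bar>\<rho>\<bar> \<le> b \<Longrightarrow> norm x \<le> b \<Longrightarrow>
      norm (exp_grad_dt \<theta> M \<xi> \<rho> x M' \<eta> h) \<le> K * (1 + norm \<eta> + \<bar>h\<bar>)" and K2: "\<And>\<theta> (M :: real^'n^'n) M' \<xi> \<rho> x \<eta> h \<eta>' h'. \<theta> \<in> {0..\<Theta>} \<Longrightarrow> norm M \<le> b \<Longrightarrow> norm M' \<le> b \<Longrightarrow>
      norm \<xi> \<le> b \<Longrightarrow> \<bar>\<rho>\<bar> \<le> b \<Longrightarrow> norm x \<le> b \<Longrightarrow>
      norm (exp_grad_dt \<theta> M \<xi> \<rho> x M' \<eta> h - exp_grad_dt \<theta> M \<xi> \<rho> x M' \<eta>' h') \<le> K * (norm (\<eta> - \<eta>') + \<bar>h - h'\<bar>)"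
    show thesis
    proof (rule that[OF K0])
      fix \<theta> :: real and M M' :: "'k \<Rightarrow> real^'n^'n" and \<xi> \<eta> :: "'k \<Rightarrow> real^'n" and \<rho> h :: "'k \<Rightarrow> real" and x :: "real^'n"
      assume b: "\<theta> \<in> {0..\<Theta>}" "\<And>k. k \<in> I \<Longrightarrow> norm (M k) \<le> b \<and> norm (M' k) \<le> b \<and> norm (\<xi> k) \<le> b \<and> \<bar>\<rho> k\<bar> \<le> b" "norm x \<le> b"
      show "norm (total_grad_dt \<theta> I M \<xi> \<rho> x M' \<eta> h) \<le> K * (\<Sum>k\<in>I. 1 + norm (\<eta> k) + \<bar>h k\<bar>)"
        unfolding total_grad_dt_def sum_distrib_left
        by (intro sum_norm_le K1[OF b(1) _ _ _ _ b(3)]) (use b(2) in auto)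
      fix \<eta>' h'
      show "norm (total_grad_dt \<theta> I M \<xi> \<rho> x M' \<eta> h - total_grad_dt \<theta> I M \<xi> \<rho> x M' \<eta>' h')
         \<le> K * (\<Sum>k\<in>I. norm (\<eta> k - \<eta>' k) + \<bar>h k - h' k\<bar>)"
        unfolding total_grad_dt_def sum_distrib_left sum_subtractf[symmetric]
        by (intro sum_norm_le K2[OF b(1) _ _ _ _ b(3)]) (use b(2) in auto)
    qed
  qed
qed

lemma total_grad_zero_bound:
  fixes I :: "'k set" and b \<Theta> c :: real
  obtains E where "\<And>\<theta> (M :: 'k \<Rightarrow> real^'n^'n) \<xi> \<rho> x. coercive_family c I M \<rho> \<Longrightarrow> \<theta> \<in> {0..\<Theta>} \<Longrightarrow>
    (\<And>k. k \<in> I \<Longrightarrow> norm (M k) \<le> b \<and> norm (\<xi> k) \<le> b \<and> \<bar>\<rho> k\<bar> \<le> b) \<Longrightarrow> total_grad \<theta> I M \<xi> \<rho> x = 0 \<Longrightarrow> norm x \<le> E"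
proof -
  let ?D = "{0..\<Theta>} \<times> cball (0 :: real^'n^'n) b \<times> cball (0 :: real^'n) b \<times> cball (0 :: real) b"
  let ?f = "\<lambda>(\<theta>, M, \<xi>, \<rho>). exp_grad \<theta> M \<xi> \<rho> 0"
  have "continuous_on ?D ?f"
    unfolding exp_grad_def quad_value_def wnorm_sq_def case_prod_unfold by (intro continuous_intros)
  moreover have "compact ?D" by (intro compact_Times compact_cball compact_Icc)
  ultimately have "bounded (?f ` ?D)" by (intro compact_imp_bounded compact_continuous_image)
  then obtain K where K: "\<And>z. z \<in> ?D \<Longrightarrow> norm (?f z) \<le> K" unfolding bounded_iff by blast
  show thesis
  proof (rule that)
    fix \<theta> and M :: "'k \<Rightarrow> real^'n^'n" and \<xi> \<rho> x
    assume F: "coercive_family c I M \<rho>" and \<theta>: "\<theta> \<in> {0..\<Theta>}" and x: "total_grad \<theta> I M \<xi> \<rho> x = 0"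
      and b: "\<And>k. k \<in> I \<Longrightarrow> norm (M k) \<le> b \<and> norm (\<xi> k) \<le> b \<and> \<bar>\<rho> k\<bar> \<le> b"
    have "norm (total_grad \<theta> I M \<xi> \<rho> 0) \<le> (\<Sum>k\<in>I. K)"
      unfolding total_grad_def
    proof (rule sum_norm_le)
      show "norm (exp_grad \<theta> (M k) (\<xi> k) (\<rho> k) 0) \<le> K" if "k \<in> I" for k
        using K[of "(\<theta>, M k, \<xi> k, \<rho> k)"] b[OF that] \<theta> by simp
    qed
    then have "c * norm x \<le> real (card I) * K"
      using total_grad_zero_dist[OF F _ x, of 0] \<theta> by simp
    then show "norm x \<le> real (card I) * K / c"
      using F by (simp add: coercive_family_def field_simps)
  qed
qed

text \<open>Product and chain rule. The symmetry of \<open>M t\<close> merges the two terms in which the quadratic form is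
  differentiated through \<open>x - \<xi>\<close>.\<close>
lemma exp_grad_has_derivative:
  fixes M :: "real \<Rightarrow> real^'n^'n" and \<xi> :: "real \<Rightarrow> real^'n" and \<rho> :: "real \<Rightarrow> real"
  assumes sym: "transpose (M t) = M t"
    and M: "(M has_vector_derivative M') (at t within S)"
    and \<xi>: "(\<xi> has_vector_derivative \<eta>) (at t within S)"
    and \<rho>: "(\<rho> has_vector_derivative h) (at t within S)"
  shows "((\<lambda>z. exp_grad \<theta> (M (fst z)) (\<xi> (fst z)) (\<rho> (fst z)) (snd z)) has_derivative
     (\<lambda>z. fst z *\<^sub>R exp_grad_dt \<theta> (M t) (\<xi> t) (\<rho> t) x M' \<eta> h + exp_hess \<theta> (M t) (\<xi> t) (\<rho> t) x (snd z)))
     (at (t, x) within S \<times> UNIV)"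
proof -
  let ?F = "at (t, x) within S \<times> (UNIV :: (real^'n) set)"
  have lift: "((\<lambda>z. f (fst z)) has_derivative (\<lambda>z. fst z *\<^sub>R f')) ?F"
    if f: "(f has_vector_derivative f') (at t within S)" for f :: "real \<Rightarrow> 'b::real_normed_vector" and f'
  proof (rule has_derivative_in_compose[where g = f and g' = "\<lambda>h. h *\<^sub>R f'", OF has_derivative_fst[OF has_derivative_ident]])
    have "fst ` (S \<times> (UNIV :: (real^'n) set)) = S" by force
    then show "(f has_derivative (\<lambda>h. h *\<^sub>R f')) (at (fst (t, x)) within (fst ` (S \<times> (UNIV :: (real^'n) set))))"
      using f by (simp add: has_vector_derivative_def)
  qed
  define e where "e = x - \<xi> t"
  define p where "p = M t *v e"
  have de: "((\<lambda>z. snd z - \<xi> (fst z)) has_derivative (\<lambda>z. snd z - fst z *\<^sub>R \<eta>)) ?F"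
    by (intro has_derivative_diff has_derivative_snd has_derivative_ident lift \<xi>)
  have dp: "((\<lambda>z. M (fst z) *v (snd z - \<xi> (fst z))) has_derivative
      (\<lambda>z. M t *v (snd z - fst z *\<^sub>R \<eta>) + (fst z *\<^sub>R M') *v e)) ?F"
    using matvec.FDERIV[OF lift[OF M] de] by (simp add: e_def)
  have dq: "((\<lambda>z. quad_value (M (fst z)) (\<xi> (fst z)) (\<rho> (fst z)) (snd z)) has_derivative
      (\<lambda>z. fst z * (e \<bullet> (M' *v e) - 2 * (\<eta> \<bullet> p) + h) + 2 * (p \<bullet> snd z))) ?F"
  proof -
    have "((\<lambda>z. quad_value (M (fst z)) (\<xi> (fst z)) (\<rho> (fst z)) (snd z)) has_derivative
      (\<lambda>z. e \<bullet> (M t *v (snd z - fst z *\<^sub>R \<eta>) + (fst z *\<^sub>R M') *v e) + (snd z - fst z *\<^sub>R \<eta>) \<bullet> p + fst z *\<^sub>R h)) ?F"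
      unfolding quad_value_def wnorm_sq_def
      using has_derivative_add[OF has_derivative_inner[OF de dp] lift[OF \<rho>]] by (simp add: e_def p_def)
    moreover have "e \<bullet> (M t *v w) = p \<bullet> w" for w unfolding p_def by (rule symmetric_inner[OF sym, symmetric])
    ultimately show ?thesis
      by (simp add: inner_add_right inner_diff_left inner_diff_right matvec.scaleR_left inner_commute algebra_simps)
  qed
  let ?E = "exp (\<theta> * quad_value (M t) (\<xi> t) (\<rho> t) x)"
  have dE: "((\<lambda>z. exp (\<theta> * quad_value (M (fst z)) (\<xi> (fst z)) (\<rho> (fst z)) (snd z))) has_derivative
      (\<lambda>z. (\<theta> * (fst z * (e \<bullet> (M' *v e) - 2 * (\<eta> \<bullet> p) + h) + 2 * (p \<bullet> snd z))) * ?E)) ?F"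
    using has_derivative_exp[OF has_derivative_mult_right[OF dq, of \<theta>]] by simp
  have "((\<lambda>z. exp_grad \<theta> (M (fst z)) (\<xi> (fst z)) (\<rho> (fst z)) (snd z)) has_derivative
     (\<lambda>z. ?E *\<^sub>R (M t *v (snd z - fst z *\<^sub>R \<eta>) + (fst z *\<^sub>R M') *v e)
        + ((\<theta> * (fst z * (e \<bullet> (M' *v e) - 2 * (\<eta> \<bullet> p) + h) + 2 * (p \<bullet> snd z))) * ?E) *\<^sub>R p)) ?F"
    unfolding exp_grad_def using has_derivative_scaleR[OF dE dp] by (simp add: e_def p_def)
  moreover have "(\<lambda>z. ?E *\<^sub>R (M t *v (snd z - fst z *\<^sub>R \<eta>) + (fst z *\<^sub>R M') *v e)
        + ((\<theta> * (fst z * (e \<bullet> (M' *v e) - 2 * (\<eta> \<bullet> p) + h) + 2 * (p \<bullet> snd z))) * ?E) *\<^sub>R p)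
     = (\<lambda>z. fst z *\<^sub>R exp_grad_dt \<theta> (M t) (\<xi> t) (\<rho> t) x M' \<eta> h + exp_hess \<theta> (M t) (\<xi> t) (\<rho> t) x (snd z))"
    unfolding exp_grad_dt_def exp_hess_def e_def[symmetric] p_def[symmetric]
    by (rule ext) (simp add: matvec.diff_right matvec.scaleR_right matvec.scaleR_left algebra_simps)
  ultimately show ?thesis by simp
qed

text \<open>Implicit differentiation of \<open>total_grad = 0\<close> in time: continuity of the zeros comes from strong
  monotonicity, and the partial derivative in \<open>x\<close> is the coercive map \<open>total_hess\<close>.\<close>
lemma total_grad_zero_has_vector_derivative:
  fixes M :: "'k \<Rightarrow> real \<Rightarrow> real^'n^'n"
  assumes F: "\<And>s. s \<in> S \<Longrightarrow> coercive_family c I (\<lambda>k. M k s) (\<lambda>k. \<rho> k s)" and \<theta>: "0 \<le> \<theta>" and t: "t \<in> S"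
    and M: "\<And>k. k \<in> I \<Longrightarrow> (M k has_vector_derivative M' k) (at t within S)"
    and \<xi>: "\<And>k. k \<in> I \<Longrightarrow> (\<xi> k has_vector_derivative \<eta> k) (at t within S)"
    and \<rho>: "\<And>k. k \<in> I \<Longrightarrow> (\<rho> k has_vector_derivative h k) (at t within S)"
    and x: "\<And>s. s \<in> S \<Longrightarrow> total_grad \<theta> I (\<lambda>k. M k s) (\<lambda>k. \<xi> k s) (\<lambda>k. \<rho> k s) (x s) = 0"
  shows "(x has_vector_derivative hess_solve \<theta> I (\<lambda>k. M k t) (\<lambda>k. \<xi> k t) (\<lambda>k. \<rho> k t) (x t)
      (- total_grad_dt \<theta> I (\<lambda>k. M k t) (\<lambda>k. \<xi> k t) (\<lambda>k. \<rho> k t) (x t) M' \<eta> h)) (at t within S)"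
proof -
  have c: "0 < c" using F[OF t] by (simp add: coercive_family_def)
  have inS: "\<forall>\<^sub>F s in at t within S. s \<in> S" by (simp add: eventually_at_filter)
  have lim: "(f \<longlongrightarrow> f t) (at t within S)" if "(f has_vector_derivative f') (at t within S)"
    for f :: "real \<Rightarrow> 'b::real_normed_vector" and f'
    using has_vector_derivative_continuous[OF that] by (simp add: continuous_within)
  let ?H = "total_hess \<theta> I (\<lambda>k. M k t) (\<lambda>k. \<xi> k t) (\<lambda>k. \<rho> k t) (x t)"
  let ?a = "total_grad_dt \<theta> I (\<lambda>k. M k t) (\<lambda>k. \<xi> k t) (\<lambda>k. \<rho> k t) (x t) M' \<eta> h"
  show ?thesis
  proof (rule implicit_zero_has_vector_derivative[where L = ?H and a = ?a and c = c
      and G = "\<lambda>z. total_grad \<theta> I (\<lambda>k. M k (fst z)) (\<lambda>k. \<xi> k (fst z)) (\<lambda>k. \<rho> k (fst z)) (snd z)"])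
    have "((\<lambda>z. total_grad \<theta> I (\<lambda>k. M k (fst z)) (\<lambda>k. \<xi> k (fst z)) (\<lambda>k. \<rho> k (fst z)) (snd z)) has_derivative
      (\<lambda>z. \<Sum>k\<in>I. fst z *\<^sub>R exp_grad_dt \<theta> (M k t) (\<xi> k t) (\<rho> k t) (x t) (M' k) (\<eta> k) (h k)
         + exp_hess \<theta> (M k t) (\<xi> k t) (\<rho> k t) (x t) (snd z))) (at (t, x t) within S \<times> UNIV)"
      unfolding total_grad_def using F[OF t]
      by (intro has_derivative_sum exp_grad_has_derivative M \<xi> \<rho>) (auto simp: coercive_family_def)
    then show "((\<lambda>z. total_grad \<theta> I (\<lambda>k. M k (fst z)) (\<lambda>k. \<xi> k (fst z)) (\<lambda>k. \<rho> k (fst z)) (snd z)) has_derivative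
      (\<lambda>(\<tau>, v). \<tau> *\<^sub>R ?a + ?H v)) (at (t, x t) within S \<times> UNIV)"
      by (simp add: case_prod_unfold total_grad_dt_def total_hess_def sum.distrib scaleR_sum_right)
    show "(x \<longlongrightarrow> x t) (at t within S)"
    proof (rule total_grad_zero_tendsto[where c = c and I = I and \<theta> = "\<lambda>_. \<theta>" and \<theta>l = \<theta>
          and M = "\<lambda>s k. M k s" and \<xi> = "\<lambda>s k. \<xi> k s" and \<rho> = "\<lambda>s k. \<rho> k s"])
      show "\<forall>\<^sub>F s in at t within S. coercive_family c I (\<lambda>k. M k s) (\<lambda>k. \<rho> k s)"
        using inS by eventually_elim (rule F)
      show "\<forall>\<^sub>F s in at t within S. total_grad \<theta> I (\<lambda>k. M k s) (\<lambda>k. \<xi> k s) (\<lambda>k. \<rho> k s) (x s) = 0"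
        using inS by eventually_elim (rule x)
    qed (use \<theta> c lim[OF M] lim[OF \<xi>] lim[OF \<rho>] x[OF t] in auto)
    show "c * norm v \<le> norm (?H v)" for v
      by (rule coercive_norm_ge[OF total_hess_coercive[OF F[OF t] \<theta>]])
    show "?H (hess_solve \<theta> I (\<lambda>k. M k t) (\<lambda>k. \<xi> k t) (\<lambda>k. \<rho> k t) (x t) (- ?a)) = - ?a"
      by (rule total_hess_hess_solve[OF F[OF t] \<theta>])
  qed (use x t c linear_total_hess in auto)
qed

section \<open>Weak differentiability of the estimators in time\<close>

definition critical_point :: "real \<Rightarrow> 'k set \<Rightarrow> ('k \<Rightarrow> real \<Rightarrow> real^'n^'n) \<Rightarrow> ('k \<Rightarrow> real \<Rightarrow> real^'n) \<Rightarrow>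
    ('k \<Rightarrow> real \<Rightarrow> real) \<Rightarrow> real \<Rightarrow> real^'n" where
  "critical_point \<theta> I P \<xi> r t = (SOME x. total_grad \<theta> I (\<lambda>k. P k t) (\<lambda>k. \<xi> k t) (\<lambda>k. r k t) x = 0)"

text \<open>The formal time derivative of \<open>critical_point\<close>: the solution of the linearized equation when \<open>P\<close>, \<open>\<xi>\<close> and
  \<open>r\<close> move with the velocities \<open>P'\<close>, \<open>g\<close> and \<open>h\<close>.\<close>
definition critical_velocity :: "real \<Rightarrow> 'k set \<Rightarrow> ('k \<Rightarrow> real \<Rightarrow> real^'n^'n) \<Rightarrow> ('k \<Rightarrow> real \<Rightarrow> real^'n) \<Rightarrow>
    ('k \<Rightarrow> real \<Rightarrow> real) \<Rightarrow> ('k \<Rightarrow> real \<Rightarrow> real^'n^'n) \<Rightarrow> ('k \<Rightarrow> real \<Rightarrow> real^'n) \<Rightarrow>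
    ('k \<Rightarrow> real \<Rightarrow> real) \<Rightarrow> real \<Rightarrow> real^'n" where
  "critical_velocity \<theta> I P \<xi> r P' g h t = hess_solve \<theta> I (\<lambda>k. P k t) (\<lambda>k. \<xi> k t) (\<lambda>k. r k t) (critical_point \<theta> I P \<xi> r t)
     (- total_grad_dt \<theta> I (\<lambda>k. P k t) (\<lambda>k. \<xi> k t) (\<lambda>k. r k t) (critical_point \<theta> I P \<xi> r t)
        (\<lambda>k. P' k t) (\<lambda>k. g k t) (\<lambda>k. h k t))"

lemma borel_measurable_matvec:
  fixes M :: "'a \<Rightarrow> real^'n^'m" and f :: "'a \<Rightarrow> real^'n"
  assumes "M \<in> borel_measurable N" "f \<in> borel_measurable N"
  shows "(\<lambda>x. M x *v f x) \<in> borel_measurable N"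
  by (rule borel_measurable_continuous_Pair[OF assms]) (intro continuous_intros)

lemma total_grad_dt_measurable:
  assumes "\<And>k. k \<in> I \<Longrightarrow> (\<lambda>t. M t k) \<in> borel_measurable N" "\<And>k. k \<in> I \<Longrightarrow> (\<lambda>t. \<xi> t k) \<in> borel_measurable N"
    "\<And>k. k \<in> I \<Longrightarrow> (\<lambda>t. \<rho> t k) \<in> borel_measurable N" "x \<in> borel_measurable N"
    "\<And>k. k \<in> I \<Longrightarrow> (\<lambda>t. M' t k) \<in> borel_measurable N" "\<And>k. k \<in> I \<Longrightarrow> (\<lambda>t. \<eta> t k) \<in> borel_measurable N"
    "\<And>k. k \<in> I \<Longrightarrow> (\<lambda>t. h t k) \<in> borel_measurable N"
  shows "(\<lambda>t. total_grad_dt \<theta> I (M t) (\<xi> t) (\<rho> t) (x t) (M' t) (\<eta> t) (h t)) \<in> borel_measurable N"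
  unfolding total_grad_dt_def exp_grad_dt_def quad_value_def wnorm_sq_def
  by (intro borel_measurable_sum borel_measurable_scaleR borel_measurable_add borel_measurable_diff
      borel_measurable_times borel_measurable_inner borel_measurable_matvec borel_measurable_const
      measurable_compose[OF _ borel_measurable_exp] assms)

text \<open>Time-dependent quadratic value functions \<open>(x - \<xi>\<^sub>k t) \<bullet> P\<^sub>k t (x - \<xi>\<^sub>k t) + r\<^sub>k t\<close> with continuously
  differentiable matrices and with \<open>\<xi>\<^sub>k\<close> and \<open>r\<^sub>k\<close> given as indefinite integrals. The locale is
  instantiated both by the observers and by their smooth approximations, which share \<open>P\<close> and \<open>c\<close>.\<close>
locale quadratic_family =
  fixes T c :: real and I :: "'k set" and P P' :: "'k \<Rightarrow> real \<Rightarrow> real^'n^'n"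
    and \<xi> g :: "'k \<Rightarrow> real \<Rightarrow> real^'n" and r h :: "'k \<Rightarrow> real \<Rightarrow> real"
  assumes T: "0 < T" and fin: "finite I" and ne: "I \<noteq> {}" and c: "0 < c"
    and sym: "\<And>k t. k \<in> I \<Longrightarrow> t \<in> {0..T} \<Longrightarrow> transpose (P k t) = P k t"
    and coercive: "\<And>k t x. k \<in> I \<Longrightarrow> t \<in> {0..T} \<Longrightarrow> c * (norm x)\<^sup>2 \<le> wnorm_sq (P k t) x"
    and P_deriv: "\<And>k t. k \<in> I \<Longrightarrow> t \<in> {0..T} \<Longrightarrow> (P k has_vector_derivative P' k t) (at t within {0..T})"
    and P'_cont: "\<And>k. k \<in> I \<Longrightarrow> continuous_on {0..T} (P' k)"
    and g_int: "\<And>k. k \<in> I \<Longrightarrow> g k absolutely_integrable_on {0..T}"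
    and \<xi>_eq: "\<And>k t. k \<in> I \<Longrightarrow> t \<in> {0..T} \<Longrightarrow> \<xi> k t = \<xi> k 0 + integral {0..t} (g k)"
    and h_int: "\<And>k. k \<in> I \<Longrightarrow> h k absolutely_integrable_on {0..T}"
    and h_nonneg: "\<And>k t. k \<in> I \<Longrightarrow> t \<in> {0..T} \<Longrightarrow> 0 \<le> h k t"
    and r_eq: "\<And>k t. k \<in> I \<Longrightarrow> t \<in> {0..T} \<Longrightarrow> r k t = integral {0..t} (h k)"
begin

lemma r_nonneg: "k \<in> I \<Longrightarrow> t \<in> {0..T} \<Longrightarrow> 0 \<le> r k t"
  unfolding r_eq
  by (rule integral_nonneg[OF set_lebesgue_integral_eq_integral(1)[OF absolutely_integrable_on_subinterval[OF h_int]]])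
    (auto intro: h_nonneg)

lemma family: "t \<in> {0..T} \<Longrightarrow> coercive_family c I (\<lambda>k. P k t) (\<lambda>k. r k t)"
  using fin ne c sym coercive r_nonneg by (simp add: coercive_family_def)

lemma P_cont: "k \<in> I \<Longrightarrow> continuous_on {0..T} (P k)"
  using P_deriv by (rule has_vector_derivative_imp_continuous_on)

lemma \<xi>_cont: "k \<in> I \<Longrightarrow> continuous_on {0..T} (\<xi> k)"
  by (rule continuous_on_indefinite_integral[OF g_int \<xi>_eq])

lemma r_cont: assumes "k \<in> I" shows "continuous_on {0..T} (r k)"
proof (rule continuous_on_indefinite_integral[OF h_int[OF assms]])
  have "r k 0 = 0" using r_eq[OF assms, of 0] T by simp
  then show "r k t = r k 0 + integral {0..t} (h k)" if "t \<in> {0..T}" for t using r_eq[OF assms that] by simp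
qed

lemma critical_point_zero:
  assumes "0 \<le> \<theta>" "t \<in> {0..T}"
  shows "total_grad \<theta> I (\<lambda>k. P k t) (\<lambda>k. \<xi> k t) (\<lambda>k. r k t) (critical_point \<theta> I P \<xi> r t) = 0"
  unfolding critical_point_def by (rule someI_ex) (rule total_grad_zero_exists[OF family[OF assms(2)] assms(1)])

lemma critical_point_unique:
  assumes "0 \<le> \<theta>" "t \<in> {0..T}" "total_grad \<theta> I (\<lambda>k. P k t) (\<lambda>k. \<xi> k t) (\<lambda>k. r k t) x = 0"
  shows "x = critical_point \<theta> I P \<xi> r t"
proof -
  have "c * norm (x - critical_point \<theta> I P \<xi> r t) \<le> 0"
    using total_grad_zero_dist[OF family[OF assms(2)] assms(1,3), of "critical_point \<theta> I P \<xi> r t"] critical_point_zero[OF assms(1,2)] by simp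
  then show ?thesis using c by (simp add: mult_le_0_iff)
qed

lemma data_bounded:
  "\<exists>b. \<forall>k\<in>I. \<forall>t\<in>{0..T}. norm (P k t) \<le> b \<and> norm (P' k t) \<le> b \<and> norm (\<xi> k t) \<le> b \<and> \<bar>r k t\<bar> \<le> b"
proof -
  have "\<exists>b\<ge>0. \<forall>t\<in>{0..T}. norm (P k t) \<le> b \<and> norm (P' k t) \<le> b \<and> norm (\<xi> k t) \<le> b \<and> \<bar>r k t\<bar> \<le> b"
    if k: "k \<in> I" for k
  proof -
    obtain b1 where b1: "0 \<le> b1" "\<And>t. t \<in> {0..T} \<Longrightarrow> norm (P k t) \<le> b1"
      using continuous_on_Icc_bounded[OF P_cont[OF k]] by blast
    obtain b2 where b2: "0 \<le> b2" "\<And>t. t \<in> {0..T} \<Longrightarrow> norm (P' k t) \<le> b2"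
      using continuous_on_Icc_bounded[OF P'_cont[OF k]] by blast
    obtain b3 where b3: "0 \<le> b3" "\<And>t. t \<in> {0..T} \<Longrightarrow> norm (\<xi> k t) \<le> b3"
      using continuous_on_Icc_bounded[OF \<xi>_cont[OF k]] by blast
    obtain b4 where b4: "0 \<le> b4" "\<And>t. t \<in> {0..T} \<Longrightarrow> norm (r k t) \<le> b4"
      using continuous_on_Icc_bounded[OF r_cont[OF k]] by blast
    have "norm (P k t) \<le> b1 + b2 + b3 + b4 \<and> norm (P' k t) \<le> b1 + b2 + b3 + b4
        \<and> norm (\<xi> k t) \<le> b1 + b2 + b3 + b4 \<and> \<bar>r k t\<bar> \<le> b1 + b2 + b3 + b4" if t: "t \<in> {0..T}" for t
      using b1(1) b2(1) b3(1) b4(1) b1(2)[OF t] b2(2)[OF t] b3(2)[OF t] b4(2)[OF t] by simp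
    moreover have "0 \<le> b1 + b2 + b3 + b4" using b1(1) b2(1) b3(1) b4(1) by simp
    ultimately show ?thesis by blast
  qed
  then obtain B where B0: "\<And>k. k \<in> I \<Longrightarrow> 0 \<le> B k" and B: "\<And>k t. k \<in> I \<Longrightarrow> t \<in> {0..T} \<Longrightarrow>
      norm (P k t) \<le> B k \<and> norm (P' k t) \<le> B k \<and> norm (\<xi> k t) \<le> B k \<and> \<bar>r k t\<bar> \<le> B k" by metis
  have le: "B k \<le> sum B I" if "k \<in> I" for k using member_le_sum[OF that _ fin, of B] B0 by simp
  show ?thesis
    by (intro exI[of _ "sum B I"] conjI ballI) (use B le order_trans in blast)+
qed

lemma critical_point_tendsto:
  assumes "0 \<le> \<theta>" "t \<in> {0..T}"
  shows "(critical_point \<theta> I P \<xi> r \<longlongrightarrow> critical_point \<theta> I P \<xi> r t) (at t within {0..T})"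
proof (rule total_grad_zero_tendsto[where c = c and I = I and \<theta> = "\<lambda>_. \<theta>" and \<theta>l = \<theta>
      and M = "\<lambda>s k. P k s" and \<xi> = "\<lambda>s k. \<xi> k s" and \<rho> = "\<lambda>s k. r k s"])
  have inS: "\<forall>\<^sub>F s in at t within {0..T}. s \<in> {0..T}" by (simp add: eventually_at_filter)
  show "\<forall>\<^sub>F s in at t within {0..T}. coercive_family c I (\<lambda>k. P k s) (\<lambda>k. r k s)"
    using inS by eventually_elim (rule family)
  show "\<forall>\<^sub>F s in at t within {0..T}. total_grad \<theta> I (\<lambda>k. P k s) (\<lambda>k. \<xi> k s) (\<lambda>k. r k s) (critical_point \<theta> I P \<xi> r s) = 0"
    using inS by eventually_elim (rule critical_point_zero[OF assms(1)])
  show "total_grad \<theta> I (\<lambda>k. P k t) (\<lambda>k. \<xi> k t) (\<lambda>k. r k t) (critical_point \<theta> I P \<xi> r t) = 0" by (rule critical_point_zero[OF assms])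
qed (use assms c P_cont \<xi>_cont r_cont in \<open>auto simp: continuous_on_def\<close>)

lemma critical_point_cont: "0 \<le> \<theta> \<Longrightarrow> continuous_on {0..T} (critical_point \<theta> I P \<xi> r)"
  using critical_point_tendsto by (simp add: continuous_on_def)

text \<open>The solution of the linear system is jointly continuous in time and in the right-hand side. It is
  therefore measurable along a measurable choice of the right-hand side.\<close>
lemma hess_solve_total_grad_dt_measurable:
  assumes \<theta>: "0 \<le> \<theta>" and G: "\<And>k. k \<in> I \<Longrightarrow> G k \<in> borel_measurable (lebesgue_on {0..T})"
    and H: "\<And>k. k \<in> I \<Longrightarrow> H k \<in> borel_measurable (lebesgue_on {0..T})"
  shows "(\<lambda>t. hess_solve \<theta> I (\<lambda>k. P k t) (\<lambda>k. \<xi> k t) (\<lambda>k. r k t) (critical_point \<theta> I P \<xi> r t)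
     (- total_grad_dt \<theta> I (\<lambda>k. P k t) (\<lambda>k. \<xi> k t) (\<lambda>k. r k t) (critical_point \<theta> I P \<xi> r t)
        (\<lambda>k. P' k t) (\<lambda>k. G k t) (\<lambda>k. H k t))) \<in> borel_measurable (lebesgue_on {0..T})"
proof -
  have cm: "f \<in> borel_measurable (lebesgue_on {0..T})" if "continuous_on {0..T} f" for f :: "real \<Rightarrow> 'b::euclidean_space"
    by (rule continuous_imp_measurable_on_sets_lebesgue[OF that]) simp
  define b where "b t = - total_grad_dt \<theta> I (\<lambda>k. P k t) (\<lambda>k. \<xi> k t) (\<lambda>k. r k t) (critical_point \<theta> I P \<xi> r t)
        (\<lambda>k. P' k t) (\<lambda>k. G k t) (\<lambda>k. H k t)" for t
  have bm: "b \<in> borel_measurable (lebesgue_on {0..T})"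
    unfolding b_def
    by (intro borel_measurable_uminus total_grad_dt_measurable cm P_cont P'_cont \<xi>_cont r_cont critical_point_cont \<theta> G H)
  define S where "S p = hess_solve \<theta> I (\<lambda>k. P k (fst p)) (\<lambda>k. \<xi> k (fst p)) (\<lambda>k. r k (fst p)) (critical_point \<theta> I P \<xi> r (fst p)) (snd p)" for p
  have "continuous_on ({0..T} \<times> UNIV) S"
    unfolding continuous_on_def
  proof
    fix p assume p: "p \<in> {0..T} \<times> (UNIV :: (real^'n) set)"
    then have t: "fst p \<in> {0..T}" by auto
    have inS: "\<forall>\<^sub>F q in at p within {0..T} \<times> UNIV. fst q \<in> {0..T}"
    proof (rule eventually_mono)
      show "\<forall>\<^sub>F q in at p within {0..T} \<times> UNIV. q \<in> {0..T} \<times> UNIV" by (simp add: eventually_at_filter)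
    qed auto
    have lim: "((\<lambda>q. f (fst q)) \<longlongrightarrow> f (fst p)) (at p within {0..T} \<times> UNIV)" if "continuous_on {0..T} f"
      for f :: "real \<Rightarrow> 'b::real_normed_vector"
      using continuous_on_compose2[OF that continuous_on_fst[OF continuous_on_id], of "{0..T} \<times> (UNIV :: (real^'n) set)"] p
      by (auto simp: continuous_on_def)
    show "(S \<longlongrightarrow> S p) (at p within {0..T} \<times> UNIV)"
      unfolding S_def
    proof (rule hess_solve_tendsto[where c = c])
      show "\<forall>\<^sub>F q in at p within {0..T} \<times> UNIV. coercive_family c I (\<lambda>k. P k (fst q)) (\<lambda>k. r k (fst q))"
        using inS by eventually_elim (rule family)
      show "coercive_family c I (\<lambda>k. P k (fst p)) (\<lambda>k. r k (fst p))" by (rule family[OF t])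
      show "(snd \<longlongrightarrow> snd p) (at p within {0..T} \<times> UNIV)" by (intro tendsto_intros)
    qed (use \<theta> lim[OF P_cont] lim[OF \<xi>_cont] lim[OF r_cont] lim[OF critical_point_cont[OF \<theta>]] in auto)
  qed
  then have Sm: "S \<in> borel_measurable (restrict_space borel ({0..T} \<times> UNIV))"
    by (rule borel_measurable_continuous_on_restrict)
  have "(\<lambda>t. (t, b t)) \<in> measurable (lebesgue_on {0..T}) (restrict_space borel ({0..T} \<times> UNIV))"
  proof (rule measurable_restrict_space2)
    show "(\<lambda>t. (t, b t)) \<in> space (lebesgue_on {0..T}) \<rightarrow> {0..T} \<times> UNIV" by auto
    show "(\<lambda>t. (t, b t)) \<in> borel_measurable (lebesgue_on {0..T})"
      by (intro borel_measurable_Pair bm cm continuous_on_id)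
  qed
  from measurable_compose[OF this Sm] show ?thesis by (simp add: S_def b_def)
qed

lemma dominating_integrable:
  "(\<lambda>t. \<Sum>k\<in>I. 1 + norm (g k t) + \<bar>h k t\<bar>) integrable_on {0..T}"
proof (rule integrable_sum[OF fin])
  fix k assume k: "k \<in> I"
  have "(\<lambda>t. norm (g k t)) integrable_on {0..T}" "(\<lambda>t. \<bar>h k t\<bar>) integrable_on {0..T}"
    using g_int[OF k] h_int[OF k] by (simp_all add: absolutely_integrable_on_def)
  then show "(\<lambda>t. 1 + norm (g k t) + \<bar>h k t\<bar>) integrable_on {0..T}"
    by (intro integrable_add integrable_const_ivl)
qed

lemma critical_point_has_vector_derivative:
  assumes \<theta>: "0 \<le> \<theta>" and g: "\<And>k. k \<in> I \<Longrightarrow> continuous_on {0..T} (g k)"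
    and h: "\<And>k. k \<in> I \<Longrightarrow> continuous_on {0..T} (h k)" and t: "t \<in> {0..T}"
  shows "(critical_point \<theta> I P \<xi> r has_vector_derivative critical_velocity \<theta> I P \<xi> r P' g h t) (at t within {0..T})"
  unfolding critical_velocity_def
proof (rule total_grad_zero_has_vector_derivative[where c = c])
  fix k assume k: "k \<in> I"
  show "(\<xi> k has_vector_derivative g k t) (at t within {0..T})"
    by (rule has_vector_derivative_transform[OF t _ indefinite_integral_C1[OF g[OF k] t, of "\<xi> k 0"]])
      (rule \<xi>_eq[OF k])
  show "(r k has_vector_derivative h k t) (at t within {0..T})"
    by (rule has_vector_derivative_transform[OF t _ indefinite_integral_C1[OF h[OF k] t, of 0]])
      (simp add: r_eq[OF k])
qed (use family \<theta> t P_deriv critical_point_zero in auto)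

lemma critical_velocity_cont:
  assumes \<theta>: "0 \<le> \<theta>" and g: "\<And>k. k \<in> I \<Longrightarrow> continuous_on {0..T} (g k)"
    and h: "\<And>k. k \<in> I \<Longrightarrow> continuous_on {0..T} (h k)"
  shows "continuous_on {0..T} (critical_velocity \<theta> I P \<xi> r P' g h)"
  unfolding continuous_on_def critical_velocity_def
proof
  fix t assume t: "t \<in> {0..T}"
  have inS: "\<forall>\<^sub>F s in at t within {0..T}. s \<in> {0..T}" by (simp add: eventually_at_filter)
  have lim: "(f \<longlongrightarrow> f t) (at t within {0..T})" if "continuous_on {0..T} f" for f :: "real \<Rightarrow> 'b::real_normed_vector"
    using that t by (simp add: continuous_on_def)
  show "((\<lambda>t. hess_solve \<theta> I (\<lambda>k. P k t) (\<lambda>k. \<xi> k t) (\<lambda>k. r k t) (critical_point \<theta> I P \<xi> r t)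
     (- total_grad_dt \<theta> I (\<lambda>k. P k t) (\<lambda>k. \<xi> k t) (\<lambda>k. r k t) (critical_point \<theta> I P \<xi> r t)
        (\<lambda>k. P' k t) (\<lambda>k. g k t) (\<lambda>k. h k t))) \<longlongrightarrow>
     hess_solve \<theta> I (\<lambda>k. P k t) (\<lambda>k. \<xi> k t) (\<lambda>k. r k t) (critical_point \<theta> I P \<xi> r t)
     (- total_grad_dt \<theta> I (\<lambda>k. P k t) (\<lambda>k. \<xi> k t) (\<lambda>k. r k t) (critical_point \<theta> I P \<xi> r t)
        (\<lambda>k. P' k t) (\<lambda>k. g k t) (\<lambda>k. h k t))) (at t within {0..T})"
  proof (rule hess_solve_tendsto[where c = c])
    show "\<forall>\<^sub>F s in at t within {0..T}. coercive_family c I (\<lambda>k. P k s) (\<lambda>k. r k s)"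
      using inS by eventually_elim (rule family)
  qed (intro tendsto_minus total_grad_dt_tendsto tendsto_const lim P_cont P'_cont \<xi>_cont r_cont critical_point_cont \<theta> g h family[OF t]
      always_eventually allI, assumption?)+
qed

text \<open>Replace the integrands \<open>g\<close> and \<open>h\<close> by continuous functions \<open>G n\<close> and \<open>H n\<close> that converge in \<open>L\<^sup>1\<close>. The
  approximate critical points \<open>X n\<close> are continuously differentiable with derivative \<open>U n\<close>, and
  \<open>X n\<close> converges pointwise. For the convergence of \<open>U n\<close> in \<open>L\<^sup>1\<close>, let \<open>V n\<close> be the solution of the
  linear system at the approximate state with the original velocities \<open>g\<close> and \<open>h\<close>. Then
  \<open>U n - V n\<close> is bounded by the \<open>L\<^sup>1\<close> errors of the integrands, while \<open>V n\<close> converges pointwise with an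
  integrable bound.\<close>
theorem critical_point_weak_deriv:
  assumes \<theta>: "0 \<le> \<theta>"
  shows "has_weak_deriv {0<..<T} (critical_point \<theta> I P \<xi> r) (critical_velocity \<theta> I P \<xi> r P' g h)"
    and "critical_velocity \<theta> I P \<xi> r P' g h absolutely_integrable_on {0..T}"
proof -
  have "\<exists>G :: nat \<Rightarrow> real \<Rightarrow> real^'n. (\<forall>n. continuous_on {0..T} (G n)) \<and>
    (\<forall>n. integral {0..T} (\<lambda>t. norm (G n t - g k t)) \<le> inverse (real (Suc n)))" if "k \<in> I" for k
    by (rule L1_approx_continuous_seq[OF g_int[OF that]])
  then obtain G :: "'k \<Rightarrow> nat \<Rightarrow> real \<Rightarrow> real^'n" where G: "\<And>k n. k \<in> I \<Longrightarrow> continuous_on {0..T} (G k n)"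
    "\<And>k n. k \<in> I \<Longrightarrow> integral {0..T} (\<lambda>t. norm (G k n t - g k t)) \<le> inverse (real (Suc n))"
    by metis
  have "\<exists>H :: nat \<Rightarrow> real \<Rightarrow> real. (\<forall>n. continuous_on {0..T} (H n)) \<and> (\<forall>n t. 0 \<le> H n t) \<and>
    (\<forall>n. integral {0..T} (\<lambda>t. norm (H n t - h k t)) \<le> inverse (real (Suc n)))" if "k \<in> I" for k
    by (rule L1_approx_continuous_nonneg_seq[OF h_int[OF that] h_nonneg[OF that]])
  then obtain H :: "'k \<Rightarrow> nat \<Rightarrow> real \<Rightarrow> real" where H: "\<And>k n. k \<in> I \<Longrightarrow> continuous_on {0..T} (H k n)"
    "\<And>k n t. k \<in> I \<Longrightarrow> 0 \<le> H k n t"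
    "\<And>k n. k \<in> I \<Longrightarrow> integral {0..T} (\<lambda>t. norm (H k n t - h k t)) \<le> inverse (real (Suc n))"
    by metis
  note Gi = absolutely_integrable_continuous_real[OF G(1)]
  note Hi = absolutely_integrable_continuous_real[OF H(1)]
  define \<xi>n where "\<xi>n n k t = \<xi> k 0 + integral {0..t} (G k n)" for n k t
  define rn where "rn n k t = integral {0..t} (H k n)" for n k t
  have bank: "quadratic_family T c I P P' (\<xi>n n) (\<lambda>k. G k n) (rn n) (\<lambda>k. H k n)" for n
    by unfold_locales (use T fin ne c sym coercive P_deriv P'_cont Gi Hi H(2) in \<open>auto simp: \<xi>n_def rn_def\<close>)
  have \<xi>d: "norm (\<xi>n n k t - \<xi> k t) \<le> inverse (real (Suc n))" if k: "k \<in> I" and t: "t \<in> {0..T}" for n k t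
  proof -
    have "\<xi>n n k t - \<xi> k t = integral {0..t} (G k n) - integral {0..t} (g k)"
      unfolding \<xi>n_def \<xi>_eq[OF k t] by simp
    then show ?thesis
      using order_trans[OF norm_diff_indefinite_integral_le[OF Gi[OF k, of n] g_int[OF k] t] G(2)[OF k]] by (simp only:)
  qed
  have rd: "norm (rn n k t - r k t) \<le> inverse (real (Suc n))" if k: "k \<in> I" and t: "t \<in> {0..T}" for n k t
    unfolding rn_def r_eq[OF k t]
    by (rule order_trans[OF norm_diff_indefinite_integral_le[OF Hi[OF k, of n] h_int[OF k] t] H(3)[OF k]])
  have \<xi>lim: "(\<lambda>n. \<xi>n n k t) \<longlonglongrightarrow> \<xi> k t" if k: "k \<in> I" and t: "t \<in> {0..T}" for k t
    by (rule LIM_zero_cancel, rule Lim_null_comparison[OF always_eventually LIMSEQ_inverse_real_of_nat])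
      (use \<xi>d[OF that] in blast)
  have rlim: "(\<lambda>n. rn n k t) \<longlonglongrightarrow> r k t" if k: "k \<in> I" and t: "t \<in> {0..T}" for k t
    by (rule LIM_zero_cancel, rule Lim_null_comparison[OF always_eventually LIMSEQ_inverse_real_of_nat])
      (use rd[OF that] in blast)
  define X where "X n = critical_point \<theta> I P (\<xi>n n) (rn n)" for n
  define U where "U n = critical_velocity \<theta> I P (\<xi>n n) (rn n) P' (\<lambda>k. G k n) (\<lambda>k. H k n)" for n
  define V where "V n t = hess_solve \<theta> I (\<lambda>k. P k t) (\<lambda>k. \<xi>n n k t) (\<lambda>k. rn n k t) (X n t)
     (- total_grad_dt \<theta> I (\<lambda>k. P k t) (\<lambda>k. \<xi>n n k t) (\<lambda>k. rn n k t) (X n t)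
        (\<lambda>k. P' k t) (\<lambda>k. g k t) (\<lambda>k. h k t))" for n t
  let ?x = "critical_point \<theta> I P \<xi> r" and ?u = "critical_velocity \<theta> I P \<xi> r P' g h"
  have Xlim: "(\<lambda>n. X n t) \<longlonglongrightarrow> ?x t" if t: "t \<in> {0..T}" for t
    unfolding X_def
    by (rule total_grad_zero_tendsto[where c = c and I = I and \<theta> = "\<lambda>_. \<theta>" and \<theta>l = \<theta>
      and M = "\<lambda>n k. P k t" and \<xi> = "\<lambda>n k. \<xi>n n k t" and \<rho> = "\<lambda>n k. rn n k t"])
      (use \<theta> c quadratic_family.family[OF bank t] \<xi>lim[OF _ t] rlim[OF _ t] critical_point_zero[OF \<theta> t]
        quadratic_family.critical_point_zero[OF bank \<theta> t] in auto)
  have Vlim: "(\<lambda>n. V n t) \<longlonglongrightarrow> ?u t" if t: "t \<in> {0..T}" for t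
    unfolding V_def critical_velocity_def
  proof (rule hess_solve_tendsto[where c = c])
    show "\<forall>\<^sub>F n in sequentially. coercive_family c I (\<lambda>k. P k t) (\<lambda>k. rn n k t)"
      using quadratic_family.family[OF bank t] by simp
    show "coercive_family c I (\<lambda>k. P k t) (\<lambda>k. r k t)" by (rule family[OF t])
    show "(\<lambda>n. - total_grad_dt \<theta> I (\<lambda>k. P k t) (\<lambda>k. \<xi>n n k t) (\<lambda>k. rn n k t) (X n t)
        (\<lambda>k. P' k t) (\<lambda>k. g k t) (\<lambda>k. h k t)) \<longlonglongrightarrow> - total_grad_dt \<theta> I (\<lambda>k. P k t) (\<lambda>k. \<xi> k t) (\<lambda>k. r k t) (?x t)
        (\<lambda>k. P' k t) (\<lambda>k. g k t) (\<lambda>k. h k t)"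
      by (intro tendsto_minus total_grad_dt_tendsto tendsto_const \<xi>lim rlim Xlim t)
  qed (use \<theta> \<xi>lim[OF _ t] rlim[OF _ t] Xlim[OF t] in auto)
  obtain b where b: "\<And>k t. k \<in> I \<Longrightarrow> t \<in> {0..T} \<Longrightarrow>
      norm (P k t) \<le> b \<and> norm (P' k t) \<le> b \<and> norm (\<xi> k t) \<le> b \<and> \<bar>r k t\<bar> \<le> b"
    using data_bounded by blast
  obtain E where E: "\<And>(M :: 'k \<Rightarrow> real^'n^'n) \<zeta> \<rho> x. coercive_family c I M \<rho> \<Longrightarrow>
      (\<And>k. k \<in> I \<Longrightarrow> norm (M k) \<le> b + 1 \<and> norm (\<zeta> k) \<le> b + 1 \<and> \<bar>\<rho> k\<bar> \<le> b + 1) \<Longrightarrow>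
      total_grad \<theta> I M \<zeta> \<rho> x = 0 \<Longrightarrow> norm x \<le> E"
  proof (rule total_grad_zero_bound[where 'n = 'n and I = I and c = c and b = "b + 1" and \<Theta> = \<theta>], goal_cases)
    case (1 E)
    have in_Icc: "\<theta> \<in> {0..\<theta>}" using \<theta> by simp
    show thesis by (rule that[OF 1(2)[OF _ in_Icc]])
  qed
  \<comment> \<open>One bound for the data, their approximations and the approximate critical points.\<close>
  define bb where "bb = max (b + 1) E"
  have nb: "norm (P k t) \<le> b + 1 \<and> norm (P' k t) \<le> b + 1 \<and> norm (\<xi>n n k t) \<le> b + 1 \<and> \<bar>rn n k t\<bar> \<le> b + 1"
    if k: "k \<in> I" and t: "t \<in> {0..T}" for n k t
  proof -
    have "norm (\<xi>n n k t) \<le> b + 1"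
      using \<xi>d[OF that, of n] inverse_Suc_le_one[of n] b[OF that] norm_triangle_sub[of "\<xi>n n k t" "\<xi> k t"] by linarith
    moreover have "norm (rn n k t) \<le> b + 1"
      using rd[OF that, of n] inverse_Suc_le_one[of n] b[OF that] norm_triangle_sub[of "rn n k t" "r k t"]
      unfolding real_norm_def by linarith
    ultimately show ?thesis using b[OF that] by simp
  qed
  have XE: "norm (X n t) \<le> E" if t: "t \<in> {0..T}" for n t
    unfolding X_def using quadratic_family.critical_point_zero[OF bank \<theta> t] nb[OF _ t]
    by (intro E[OF quadratic_family.family[OF bank t]]) auto
  have nbb: "k \<in> I \<Longrightarrow> norm (P k t) \<le> bb \<and> norm (P' k t) \<le> bb \<and> norm (\<xi>n n k t) \<le> bb \<and> \<bar>rn n k t\<bar> \<le> bb"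
    "norm (X n t) \<le> bb" if t: "t \<in> {0..T}" for n k t
    using nb[OF _ t, of k n] XE[OF t, of n] unfolding bb_def by (auto intro: max.coboundedI1 max.coboundedI2)
  obtain K where K0: "0 \<le> K" and
    K1: "\<And>(M :: 'k \<Rightarrow> real^'n^'n) M' \<zeta> \<rho> x \<eta> h.
      (\<And>k. k \<in> I \<Longrightarrow> norm (M k) \<le> bb \<and> norm (M' k) \<le> bb \<and> norm (\<zeta> k) \<le> bb \<and> \<bar>\<rho> k\<bar> \<le> bb) \<Longrightarrow> norm x \<le> bb \<Longrightarrow>
      norm (total_grad_dt \<theta> I M \<zeta> \<rho> x M' \<eta> h) \<le> K * (\<Sum>k\<in>I. 1 + norm (\<eta> k) + \<bar>h k\<bar>)" and
    K2: "\<And>(M :: 'k \<Rightarrow> real^'n^'n) M' \<zeta> \<rho> x \<eta> h \<eta>' h'.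
      (\<And>k. k \<in> I \<Longrightarrow> norm (M k) \<le> bb \<and> norm (M' k) \<le> bb \<and> norm (\<zeta> k) \<le> bb \<and> \<bar>\<rho> k\<bar> \<le> bb) \<Longrightarrow> norm x \<le> bb \<Longrightarrow>
      norm (total_grad_dt \<theta> I M \<zeta> \<rho> x M' \<eta> h - total_grad_dt \<theta> I M \<zeta> \<rho> x M' \<eta>' h')
         \<le> K * (\<Sum>k\<in>I. norm (\<eta> k - \<eta>' k) + \<bar>h k - h' k\<bar>)"
  proof (rule total_grad_dt_growth[where 'n = 'n and I = I and b = bb and \<Theta> = \<theta>], goal_cases)
    case (1 K)
    have in_Icc: "\<theta> \<in> {0..\<theta>}" using \<theta> by simp
    show thesis by (rule that[OF 1(2) 1(3)[OF in_Icc] 1(4)[OF in_Icc]])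
  qed
  define D where "D t = K / c * (\<Sum>k\<in>I. 1 + norm (g k t) + \<bar>h k t\<bar>)" for t
  have Dint: "D integrable_on {0..T}"
    unfolding D_def by (rule integrable_on_mult_right[OF dominating_integrable])
  have VD: "norm (V n t) \<le> D t" if t: "t \<in> {0..T}" for n t
  proof -
    let ?st = "total_grad_dt \<theta> I (\<lambda>k. P k t) (\<lambda>k. \<xi>n n k t) (\<lambda>k. rn n k t) (X n t) (\<lambda>k. P' k t) (\<lambda>k. g k t) (\<lambda>k. h k t)"
    have "c * norm (V n t) \<le> norm (- ?st)"
      unfolding V_def by (rule hess_solve_norm_le[OF quadratic_family.family[OF bank t] \<theta>])
    also have "\<dots> = norm ?st" by (rule norm_minus_cancel)
    also have "\<dots> \<le> K * (\<Sum>k\<in>I. 1 + norm (g k t) + \<bar>h k t\<bar>)"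
      by (rule K1[OF nbb(1)[OF t] nbb(2)[OF t]])
    finally have "c * norm (V n t) \<le> K * (\<Sum>k\<in>I. 1 + norm (g k t) + \<bar>h k t\<bar>)" .
    then show ?thesis using c by (simp add: D_def field_simps)
  qed
  have uD: "norm (?u t) \<le> D t" if t: "t \<in> {0..T}" for t
    by (rule Lim_bounded[OF tendsto_norm[OF Vlim[OF t]], of 0]) (use VD[OF t] in blast)
  have UV: "norm (U n t - V n t) \<le> K / c * (\<Sum>k\<in>I. norm (G k n t - g k t) + norm (H k n t - h k t))"
    if t: "t \<in> {0..T}" for n t
  proof -
    let ?st = "total_grad_dt \<theta> I (\<lambda>k. P k t) (\<lambda>k. \<xi>n n k t) (\<lambda>k. rn n k t) (X n t) (\<lambda>k. P' k t)"
    have minus_norm: "norm (- v - - w) = norm (v - w)" for v w :: "real^'n" by (simp add: norm_minus_commute)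
    have "c * norm (U n t - V n t) \<le> norm (- ?st (\<lambda>k. G k n t) (\<lambda>k. H k n t) - - ?st (\<lambda>k. g k t) (\<lambda>k. h k t))"
      unfolding U_def V_def critical_velocity_def X_def by (rule hess_solve_diff_le[OF quadratic_family.family[OF bank t] \<theta>])
    also have "\<dots> = norm (?st (\<lambda>k. G k n t) (\<lambda>k. H k n t) - ?st (\<lambda>k. g k t) (\<lambda>k. h k t))"
      by (rule minus_norm)
    also have "\<dots> \<le> K * (\<Sum>k\<in>I. norm (G k n t - g k t) + \<bar>H k n t - h k t\<bar>)"
      by (rule K2[OF nbb(1)[OF t] nbb(2)[OF t]])
    finally show ?thesis using c by (simp add: field_simps)
  qed
  have gm: "g k \<in> borel_measurable (lebesgue_on {0..T})" if "k \<in> I" for k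
    by (rule absolutely_integrable_imp_borel_measurable[OF g_int[OF that]]) simp
  have hm: "h k \<in> borel_measurable (lebesgue_on {0..T})" if "k \<in> I" for k
    by (rule absolutely_integrable_imp_borel_measurable[OF h_int[OF that]]) simp
  have um: "?u \<in> borel_measurable (lebesgue_on {0..T})"
    unfolding critical_velocity_def by (rule hess_solve_total_grad_dt_measurable[OF \<theta> gm hm])
  have Vm: "V n \<in> borel_measurable (lebesgue_on {0..T})" for n
    unfolding V_def X_def by (rule quadratic_family.hess_solve_total_grad_dt_measurable[OF bank \<theta> gm hm])
  show ui: "?u absolutely_integrable_on {0..T}"
    by (rule measurable_bounded_by_integrable_imp_absolutely_integrable[OF um _ Dint uD]) simp
  have Vi: "V n absolutely_integrable_on {0..T}" for n
    by (rule measurable_bounded_by_integrable_imp_absolutely_integrable[OF Vm _ Dint VD]) simp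
  have Uc: "continuous_on {0..T} (U n)" for n
    unfolding U_def by (rule quadratic_family.critical_velocity_cont[OF bank \<theta> G(1) H(1)])
  note Ui = absolutely_integrable_continuous_real[OF Uc]
  have VL: "(\<lambda>n. integral {0..T} (\<lambda>t. norm (V n t - ?u t))) \<longlonglongrightarrow> 0"
  proof -
    have "(\<lambda>n. integral {0..T} (\<lambda>t. norm (V n t - ?u t))) \<longlonglongrightarrow> integral {0..T} (\<lambda>t. 0)"
    proof (rule dominated_convergence(2)[where h = "\<lambda>t. D t + D t"])
      show "(\<lambda>t. norm (V n t - ?u t)) integrable_on {0..T}" for n by (rule norm_diff_integrable[OF Vi ui])
      show "(\<lambda>t. D t + D t) integrable_on {0..T}" by (intro integrable_add Dint)
      show "norm (norm (V n t - ?u t)) \<le> D t + D t" if t: "t \<in> {0..T}" for n t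
        using norm_triangle_ineq4[of "V n t" "?u t"] VD[OF t, of n] uD[OF t] by simp
      show "(\<lambda>n. norm (V n t - ?u t)) \<longlonglongrightarrow> 0" if t: "t \<in> {0..T}" for t
        by (rule tendsto_norm_zero[OF LIM_zero[OF Vlim[OF t]]])
    qed
    then show ?thesis by simp
  qed
  have UL: "integral {0..T} (\<lambda>t. norm (U n t - ?u t))
      \<le> K / c * (real (card I) * (2 * inverse (real (Suc n)))) + integral {0..T} (\<lambda>t. norm (V n t - ?u t))" for n
  proof -
    have gk: "(\<lambda>t. norm (G k n t - g k t)) integrable_on {0..T}" "(\<lambda>t. norm (H k n t - h k t)) integrable_on {0..T}"
      if "k \<in> I" for k
      by (rule norm_diff_integrable[OF Gi[OF that] g_int[OF that]], rule norm_diff_integrable[OF Hi[OF that] h_int[OF that]])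
    have si: "(\<lambda>t. K / c * (\<Sum>k\<in>I. norm (G k n t - g k t) + norm (H k n t - h k t))) integrable_on {0..T}"
      by (intro integrable_on_mult_right integrable_sum fin integrable_add gk)
    have "integral {0..T} (\<lambda>t. norm (U n t - ?u t))
      \<le> integral {0..T} (\<lambda>t. K / c * (\<Sum>k\<in>I. norm (G k n t - g k t) + norm (H k n t - h k t)) + norm (V n t - ?u t))"
    proof (rule integral_le)
      show "(\<lambda>t. norm (U n t - ?u t)) integrable_on {0..T}" by (rule norm_diff_integrable[OF Ui ui])
      show "(\<lambda>t. K / c * (\<Sum>k\<in>I. norm (G k n t - g k t) + norm (H k n t - h k t)) + norm (V n t - ?u t)) integrable_on {0..T}"
        by (rule integrable_add[OF si norm_diff_integrable[OF Vi ui]])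
      show "norm (U n t - ?u t) \<le> K / c * (\<Sum>k\<in>I. norm (G k n t - g k t) + norm (H k n t - h k t)) + norm (V n t - ?u t)"
        if t: "t \<in> {0..T}" for t
        using norm_triangle_ineq[of "U n t - V n t" "V n t - ?u t"] UV[OF t, of n] by simp
    qed
    also have "\<dots> = integral {0..T} (\<lambda>t. K / c * (\<Sum>k\<in>I. norm (G k n t - g k t) + norm (H k n t - h k t)))
        + integral {0..T} (\<lambda>t. norm (V n t - ?u t))"
      by (rule integral_add[OF si norm_diff_integrable[OF Vi ui]])
    also have "integral {0..T} (\<lambda>t. K / c * (\<Sum>k\<in>I. norm (G k n t - g k t) + norm (H k n t - h k t)))
       = K / c * (\<Sum>k\<in>I. integral {0..T} (\<lambda>t. norm (G k n t - g k t)) + integral {0..T} (\<lambda>t. norm (H k n t - h k t)))"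
      unfolding integral_mult_right
      by (subst integral_sum[OF fin], rule integrable_add[OF gk])
        (simp_all add: integral_add[OF gk] del: real_norm_def cong: sum.cong)
    also have "\<dots> \<le> K / c * (\<Sum>k\<in>I. 2 * inverse (real (Suc n)))"
    proof (intro mult_left_mono sum_mono)
      show "integral {0..T} (\<lambda>t. norm (G k n t - g k t)) + integral {0..T} (\<lambda>t. norm (H k n t - h k t)) \<le> 2 * inverse (real (Suc n))"
        if "k \<in> I" for k using G(2)[OF that, of n] H(3)[OF that, of n] by linarith
    qed (use K0 c in simp)
    finally show ?thesis by simp
  qed
  show "has_weak_deriv {0<..<T} ?x ?u"
  proof (rule has_weak_deriv_limit[where F = X and U = U and B = E])
    have Xd: "(X n has_vector_derivative U n t) (at t within {0..T})" if "t \<in> {0..T}" for n t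
      unfolding X_def U_def by (rule quadratic_family.critical_point_has_vector_derivative[OF bank \<theta> G(1) H(1) that])
    show "has_weak_deriv {0<..<T} (X n) (U n)" for n
      by (rule has_weak_deriv_of_C1[OF less_imp_le[OF T] Xd Uc])
    have "continuous_on {0..T} (X n)" for n unfolding X_def by (rule quadratic_family.critical_point_cont[OF bank \<theta>])
    then show "X n \<in> borel_measurable (lebesgue_on {0..T})" for n
      by (rule continuous_imp_measurable_on_sets_lebesgue) simp
    show "norm (X n t) \<le> E" if "t \<in> {0..T}" for n t by (rule XE[OF that])
    show "(\<lambda>n. X n t) \<longlonglongrightarrow> ?x t" if "t \<in> {0..T}" for t by (rule Xlim[OF that])
    show "U n absolutely_integrable_on {0..T}" for n by (rule Ui)
    show "?u absolutely_integrable_on {0..T}" by (rule ui)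
    show "(\<lambda>n. integral {0..T} (\<lambda>t. norm (U n t - ?u t))) \<longlonglongrightarrow> 0"
    proof (rule Lim_null_comparison[OF always_eventually])
      show "\<forall>n. norm (integral {0..T} (\<lambda>t. norm (U n t - ?u t)))
        \<le> K / c * (real (card I) * (2 * inverse (real (Suc n)))) + integral {0..T} (\<lambda>t. norm (V n t - ?u t))"
      proof
        fix n
        have "0 \<le> integral {0..T} (\<lambda>t. norm (U n t - ?u t))" by (rule integral_nonneg[OF norm_diff_integrable[OF Ui ui]]) simp
        then show "norm (integral {0..T} (\<lambda>t. norm (U n t - ?u t)))
        \<le> K / c * (real (card I) * (2 * inverse (real (Suc n)))) + integral {0..T} (\<lambda>t. norm (V n t - ?u t))"
          using UL[of n] unfolding real_norm_def by linarith
      qed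
      have "(\<lambda>n. K / c * (real (card I) * (2 * inverse (real (Suc n)))) + integral {0..T} (\<lambda>t. norm (V n t - ?u t)))
         \<longlonglongrightarrow> K / c * (real (card I) * (2 * 0)) + 0"
        by (intro tendsto_add tendsto_mult tendsto_const LIMSEQ_inverse_real_of_nat VL)
      then show "(\<lambda>n. K / c * (real (card I) * (2 * inverse (real (Suc n)))) + integral {0..T} (\<lambda>t. norm (V n t - ?u t))) \<longlonglongrightarrow> 0"
        by simp
    qed
  qed
qed

end

section \<open>Limits in the Sobolev and Lebesgue norms\<close>

lemma absolutely_integrable_imp_Lp_space_1:
  fixes f :: "real \<Rightarrow> real^'n"
  assumes "f absolutely_integrable_on {0..T}"
  shows "f \<in> Lp_space 1 {0<..<T}"
proof -
  have i: "integrable (lebesgue_on {0<..<T}) f" using assms by (simp add: integrable_lebesgue_on_Ioo_iff)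
  then show ?thesis unfolding Lp_space_def using integrable_norm[OF i] by (simp add: borel_measurable_integrable)
qed

lemma Lp_space_1_imp_absolutely_integrable:
  fixes f :: "real \<Rightarrow> real^'n"
  assumes "f \<in> Lp_space 1 {0<..<T}"
  shows "f absolutely_integrable_on {0..T}"
proof -
  have "integrable (lebesgue_on {0<..<T}) f"
    by (rule integrable_norm_cancel) (use assms in \<open>simp_all add: Lp_space_def\<close>)
  then show ?thesis by (simp add: integrable_lebesgue_on_Ioo_iff)
qed

lemma Lp_norm_1:
  fixes f :: "real \<Rightarrow> real^'n"
  assumes "f absolutely_integrable_on {0..T}"
  shows "Lp_norm 1 {0<..<T} f = integral {0..T} (\<lambda>t. norm (f t))"
proof -
  have "(\<lambda>t. norm (f t)) absolutely_integrable_on {0..T}" by (rule set_integrable_norm[OF assms])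
  then show ?thesis by (simp add: Lp_norm_def integral_lebesgue_on_Ioo)
qed

lemma has_weak_deriv_cong:
  assumes "has_weak_deriv S f g" "S \<in> sets lebesgue" "\<And>t. t \<in> S \<Longrightarrow> f t = f' t" "\<And>t. t \<in> S \<Longrightarrow> g t = g' t"
  shows "has_weak_deriv S f' g'"
  unfolding has_weak_deriv_def
proof
  fix \<phi> assume p: "\<phi> \<in> test_functions S"
  have "(\<integral>t. deriv \<phi> t *\<^sub>R f' t \<partial>lebesgue_on S) = (\<integral>t. deriv \<phi> t *\<^sub>R f t \<partial>lebesgue_on S)"
    "(\<integral>t. \<phi> t *\<^sub>R g' t \<partial>lebesgue_on S) = (\<integral>t. \<phi> t *\<^sub>R g t \<partial>lebesgue_on S)"
    using assms by (auto intro!: Bochner_Integration.integral_cong)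
  then show "(\<integral>t. deriv \<phi> t *\<^sub>R f' t \<partial>lebesgue_on S) = - (\<integral>t. \<phi> t *\<^sub>R g' t \<partial>lebesgue_on S)"
    using has_weak_derivD[OF assms(1) p] by simp
qed

lemma has_weak_deriv_diff:
  fixes f1 f2 g1 g2 :: "real \<Rightarrow> real^'n"
  assumes wd: "has_weak_deriv {0<..<T} f1 g1" "has_weak_deriv {0<..<T} f2 g2"
    and f: "f1 absolutely_integrable_on {0..T}" "f2 absolutely_integrable_on {0..T}"
    and g: "g1 absolutely_integrable_on {0..T}" "g2 absolutely_integrable_on {0..T}"
  shows "has_weak_deriv {0<..<T} (\<lambda>t. f1 t - f2 t) (\<lambda>t. g1 t - g2 t)"
  unfolding has_weak_deriv_def
proof
  fix \<phi> assume p: "\<phi> \<in> test_functions {0<..<T}"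
  note prod = continuous_scaleR_absolutely_integrable[OF _ test_functionD(3)[OF p], folded integrable_lebesgue_on_Ioo_iff]
    continuous_scaleR_absolutely_integrable[OF _ test_functionD(2)[OF p], folded integrable_lebesgue_on_Ioo_iff]
  show "(\<integral>t. deriv \<phi> t *\<^sub>R (f1 t - f2 t) \<partial>lebesgue_on {0<..<T}) = - (\<integral>t. \<phi> t *\<^sub>R (g1 t - g2 t) \<partial>lebesgue_on {0<..<T})"
    unfolding scaleR_diff_right
    by (simp add: Bochner_Integration.integral_diff prod f[folded integrable_lebesgue_on_Ioo_iff]
        g[folded integrable_lebesgue_on_Ioo_iff] has_weak_derivD[OF wd(1) p] has_weak_derivD[OF wd(2) p])
qed

text \<open>Almost everywhere uniqueness identifies the weak derivative selected in the norm with the given one.\<close>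
lemma W1p_1:
  fixes f u :: "real \<Rightarrow> real^'n"
  assumes T: "0 < T" and f: "f absolutely_integrable_on {0..T}" and u: "u absolutely_integrable_on {0..T}"
    and wd: "has_weak_deriv {0<..<T} f u"
  shows "f \<in> W1p_space 1 {0<..<T}"
    and "W1p_norm 1 {0<..<T} f = integral {0..T} (\<lambda>t. norm (f t)) + integral {0..T} (\<lambda>t. norm (u t))"
proof -
  show "f \<in> W1p_space 1 {0<..<T}"
    unfolding W1p_space_def using absolutely_integrable_imp_Lp_space_1[OF f] absolutely_integrable_imp_Lp_space_1[OF u] wd by blast
  define g where "g = weak_deriv 1 {0<..<T} f"
  have g: "g \<in> Lp_space 1 {0<..<T} \<and> has_weak_deriv {0<..<T} f g"
    unfolding g_def weak_deriv_def
    by (rule someI_ex[of "\<lambda>g. g \<in> Lp_space 1 {0<..<T} \<and> has_weak_deriv {0<..<T} f g"])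
      (use absolutely_integrable_imp_Lp_space_1[OF u] wd in blast)
  then have gi: "g absolutely_integrable_on {0..T}" by (blast intro: Lp_space_1_imp_absolutely_integrable)
  have "integral {0..T} (\<lambda>t. norm (g t)) = integral {0..T} (\<lambda>t. norm (u t))"
    by (rule integral_spike[OF weak_deriv_unique_ae[OF T u gi wd]]) (use g in auto)
  with Lp_norm_1[OF gi] have "Lp_norm 1 {0<..<T} g = integral {0..T} (\<lambda>t. norm (u t))" by (rule trans)
  with Lp_norm_1[OF f] show "W1p_norm 1 {0<..<T} f = integral {0..T} (\<lambda>t. norm (f t)) + integral {0..T} (\<lambda>t. norm (u t))"
    unfolding W1p_norm_def g_def[symmetric] by (rule arg_cong2[where f = "(+)"])
qed

lemma continuous_Lp:
  fixes f :: "real \<Rightarrow> real^'n"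
  assumes f: "continuous_on {0..T} f"
  shows "f \<in> Lp_space p {0<..<T}"
    and "Lp_norm p {0<..<T} f = root p (integral {0..T} (\<lambda>t. norm (f t) ^ p))"
proof -
  have i: "f absolutely_integrable_on {0..T}" by (rule absolutely_integrable_continuous_real[OF f])
  have ip: "(\<lambda>t. norm (f t) ^ p) absolutely_integrable_on {0..T}"
    by (intro absolutely_integrable_continuous_real continuous_intros f)
  have "integrable (lebesgue_on {0<..<T}) f" using i by (simp add: integrable_lebesgue_on_Ioo_iff)
  moreover have "integrable (lebesgue_on {0<..<T}) (\<lambda>t. norm (f t) ^ p)"
    using ip by (simp add: integrable_lebesgue_on_Ioo_iff)
  ultimately show "f \<in> Lp_space p {0<..<T}" unfolding Lp_space_def by (simp add: borel_measurable_integrable)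
  show "Lp_norm p {0<..<T} f = root p (integral {0..T} (\<lambda>t. norm (f t) ^ p))"
    unfolding Lp_norm_def integral_lebesgue_on_Ioo[OF ip] ..
qed

lemma Lp_norm_le_of_uniform_bound:
  fixes f :: "real \<Rightarrow> real^'n"
  assumes f: "continuous_on {0..T} f" and T: "0 \<le> T" and p: "0 < p"
    and le: "\<And>t. t \<in> {0..T} \<Longrightarrow> norm (f t) \<le> \<delta>" and \<delta>: "0 \<le> \<delta>"
  shows "0 \<le> Lp_norm p {0<..<T} f" "Lp_norm p {0<..<T} f \<le> root p T * \<delta>"
proof -
  have i: "(\<lambda>t. norm (f t) ^ p) integrable_on {0..T}"
    by (intro integrable_continuous_real continuous_intros f)
  have "0 \<le> integral {0..T} (\<lambda>t. norm (f t) ^ p)" by (rule integral_nonneg[OF i]) simp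
  then show "0 \<le> Lp_norm p {0<..<T} f" unfolding continuous_Lp(2)[OF f] by (rule real_root_ge_zero)
  have "integral {0..T} (\<lambda>t. norm (f t) ^ p) \<le> integral {0..T} (\<lambda>t. \<delta> ^ p)"
    by (rule integral_le[OF i integrable_const_ivl]) (rule power_mono[OF le norm_ge_zero])
  also have "\<dots> = T * \<delta> ^ p" using T by simp
  finally have "root p (integral {0..T} (\<lambda>t. norm (f t) ^ p)) \<le> root p (T * \<delta> ^ p)"
    using p by simp
  also have "\<dots> = root p T * \<delta>" using p \<delta> by (simp add: real_root_mult real_root_power_cancel)
  finally show "Lp_norm p {0<..<T} f \<le> root p T * \<delta>" unfolding continuous_Lp(2)[OF f] .
qed

context quadratic_family
begin

lemma critical_point_tendsto_parameter:
  assumes "\<forall>\<^sub>F i in F. 0 \<le> \<theta> i" "(\<theta> \<longlongrightarrow> \<theta>l) F" "0 \<le> \<theta>l" "t \<in> {0..T}"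
  shows "((\<lambda>i. critical_point (\<theta> i) I P \<xi> r t) \<longlongrightarrow> critical_point \<theta>l I P \<xi> r t) F"
proof (rule total_grad_zero_tendsto[where c = c and I = I and \<theta> = \<theta> and \<theta>l = \<theta>l
      and M = "\<lambda>_ k. P k t" and \<xi> = "\<lambda>_ k. \<xi> k t" and \<rho> = "\<lambda>_ k. r k t"])
  show "\<forall>\<^sub>F i in F. total_grad (\<theta> i) I (\<lambda>k. P k t) (\<lambda>k. \<xi> k t) (\<lambda>k. r k t) (critical_point (\<theta> i) I P \<xi> r t) = 0"
    using assms(1) by eventually_elim (rule critical_point_zero[OF _ assms(4)])
qed (use assms c family[OF assms(4)] critical_point_zero[OF assms(3,4)] in auto)

lemma critical_velocity_tendsto_parameter:
  assumes "\<forall>\<^sub>F i in F. 0 \<le> \<theta> i" "(\<theta> \<longlongrightarrow> \<theta>l) F" "0 \<le> \<theta>l" "t \<in> {0..T}"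
  shows "((\<lambda>i. critical_velocity (\<theta> i) I P \<xi> r P' g h t) \<longlongrightarrow> critical_velocity \<theta>l I P \<xi> r P' g h t) F"
  unfolding critical_velocity_def
proof (rule hess_solve_tendsto[where c = c])
  show "((\<lambda>i. - total_grad_dt (\<theta> i) I (\<lambda>k. P k t) (\<lambda>k. \<xi> k t) (\<lambda>k. r k t) (critical_point (\<theta> i) I P \<xi> r t) (\<lambda>k. P' k t) (\<lambda>k. g k t) (\<lambda>k. h k t))
    \<longlongrightarrow> - total_grad_dt \<theta>l I (\<lambda>k. P k t) (\<lambda>k. \<xi> k t) (\<lambda>k. r k t) (critical_point \<theta>l I P \<xi> r t) (\<lambda>k. P' k t) (\<lambda>k. g k t) (\<lambda>k. h k t)) F"
    by (intro tendsto_minus total_grad_dt_tendsto tendsto_const critical_point_tendsto_parameter assms)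
qed (use assms family[OF assms(4)] critical_point_tendsto_parameter[OF assms] in auto)

lemma critical_point_velocity_uniform_bounds:
  assumes \<Theta>: "0 \<le> \<Theta>"
  shows "\<exists>E D. D integrable_on {0..T} \<and> (\<forall>\<theta> t. 0 \<le> \<theta> \<longrightarrow> \<theta> \<le> \<Theta> \<longrightarrow> t \<in> {0..T} \<longrightarrow>
     norm (critical_point \<theta> I P \<xi> r t) \<le> E \<and> norm (critical_velocity \<theta> I P \<xi> r P' g h t) \<le> D t)"
proof -
  obtain b where b: "\<And>k t. k \<in> I \<Longrightarrow> t \<in> {0..T} \<Longrightarrow>
      norm (P k t) \<le> b \<and> norm (P' k t) \<le> b \<and> norm (\<xi> k t) \<le> b \<and> \<bar>r k t\<bar> \<le> b"
    using data_bounded by blast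
  show ?thesis
  proof (rule total_grad_zero_bound[where 'n = 'n and I = I and c = c and b = b and \<Theta> = \<Theta>])
   fix E assume E': "\<And>\<theta> (M :: 'k \<Rightarrow> real^'n^'n) \<xi> \<rho> x. coercive_family c I M \<rho> \<Longrightarrow> \<theta> \<in> {0..\<Theta>} \<Longrightarrow>
      (\<And>k. k \<in> I \<Longrightarrow> norm (M k) \<le> b \<and> norm (\<xi> k) \<le> b \<and> \<bar>\<rho> k\<bar> \<le> b) \<Longrightarrow> total_grad \<theta> I M \<xi> \<rho> x = 0 \<Longrightarrow> norm x \<le> E"
   have E: "norm (critical_point \<theta> I P \<xi> r t) \<le> E" if "0 \<le> \<theta>" "\<theta> \<le> \<Theta>" "t \<in> {0..T}" for \<theta> t
     by (rule E'[OF family[OF that(3)] _ _ critical_point_zero[OF that(1,3)]]) (use that b[OF _ that(3)] in auto)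
   define bb where "bb = max b E"
   show ?thesis
   proof (rule total_grad_dt_growth[where 'n = 'n and I = I and b = bb and \<Theta> = \<Theta>])
    fix K assume K: "\<And>\<theta> (M :: 'k \<Rightarrow> real^'n^'n) M' \<xi> \<rho> x \<eta> h. \<theta> \<in> {0..\<Theta>} \<Longrightarrow>
      (\<And>k. k \<in> I \<Longrightarrow> norm (M k) \<le> bb \<and> norm (M' k) \<le> bb \<and> norm (\<xi> k) \<le> bb \<and> \<bar>\<rho> k\<bar> \<le> bb) \<Longrightarrow> norm x \<le> bb \<Longrightarrow>
      norm (total_grad_dt \<theta> I M \<xi> \<rho> x M' \<eta> h) \<le> K * (\<Sum>k\<in>I. 1 + norm (\<eta> k) + \<bar>h k\<bar>)"
    define D where "D t = K / c * (\<Sum>k\<in>I. 1 + norm (g k t) + \<bar>h k t\<bar>)" for t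
    have D: "norm (critical_velocity \<theta> I P \<xi> r P' g h t) \<le> D t" if \<theta>: "0 \<le> \<theta>" "\<theta> \<le> \<Theta>" and t: "t \<in> {0..T}" for \<theta> t
    proof -
      let ?st = "total_grad_dt \<theta> I (\<lambda>k. P k t) (\<lambda>k. \<xi> k t) (\<lambda>k. r k t) (critical_point \<theta> I P \<xi> r t) (\<lambda>k. P' k t) (\<lambda>k. g k t) (\<lambda>k. h k t)"
      have "c * norm (critical_velocity \<theta> I P \<xi> r P' g h t) \<le> norm (- ?st)"
        unfolding critical_velocity_def by (rule hess_solve_norm_le[OF family[OF t] \<theta>(1)])
      also have "\<dots> = norm ?st" by (rule norm_minus_cancel)
      also have "\<dots> \<le> K * (\<Sum>k\<in>I. 1 + norm (g k t) + \<bar>h k t\<bar>)"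
      proof (rule K)
        show "\<theta> \<in> {0..\<Theta>}" using \<theta> by simp
        show "norm (P k t) \<le> bb \<and> norm (P' k t) \<le> bb \<and> norm (\<xi> k t) \<le> bb \<and> \<bar>r k t\<bar> \<le> bb" if "k \<in> I" for k
          using b[OF that t] unfolding bb_def by (auto intro: max.coboundedI1)
        show "norm (critical_point \<theta> I P \<xi> r t) \<le> bb" using E[OF \<theta> t] unfolding bb_def by (auto intro: max.coboundedI2)
      qed
      finally show ?thesis using c by (simp add: D_def field_simps)
    qed
    have "D integrable_on {0..T}"
      unfolding D_def by (rule integrable_on_mult_right[OF dominating_integrable])
    with E D show ?thesis by blast
   qed
  qed
qed

text \<open>Dominated convergence along sequences of parameters; a convergent sequence is bounded, so the
  bounds of the previous lemma apply to all its members.\<close>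
lemma critical_point_velocity_L1_tendsto:
  fixes \<theta> :: "nat \<Rightarrow> real"
  assumes \<theta>: "\<And>i. 0 \<le> \<theta> i" "\<theta> \<longlonglongrightarrow> \<theta>l" and \<theta>l: "0 \<le> \<theta>l"
  shows "(\<lambda>i. integral {0..T} (\<lambda>t. norm (critical_point (\<theta> i) I P \<xi> r t - critical_point \<theta>l I P \<xi> r t))) \<longlonglongrightarrow> 0"
    and "(\<lambda>i. integral {0..T} (\<lambda>t. norm (critical_velocity (\<theta> i) I P \<xi> r P' g h t - critical_velocity \<theta>l I P \<xi> r P' g h t))) \<longlonglongrightarrow> 0"
proof -
  have "Bseq \<theta>" using \<theta>(2) by (rule convergent_imp_Bseq[OF convergentI])
  then obtain \<Theta>0 where \<Theta>0: "\<And>i. \<theta> i \<le> \<Theta>0" unfolding Bseq_def by (metis abs_le_D1 real_norm_def)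
  define \<Theta> where "\<Theta> = max \<Theta>0 \<theta>l"
  have \<Theta>: "0 \<le> \<Theta>" "\<theta>l \<le> \<Theta>" "\<And>i. \<theta> i \<le> \<Theta>" using \<theta>l \<Theta>0 by (auto simp: \<Theta>_def intro: max.coboundedI1)
  obtain E D where Dint: "D integrable_on {0..T}" and ED: "\<And>\<theta> t. 0 \<le> \<theta> \<Longrightarrow> \<theta> \<le> \<Theta> \<Longrightarrow> t \<in> {0..T} \<Longrightarrow>
     norm (critical_point \<theta> I P \<xi> r t) \<le> E \<and> norm (critical_velocity \<theta> I P \<xi> r P' g h t) \<le> D t"
    using critical_point_velocity_uniform_bounds[OF \<Theta>(1)] by blast
  have nonneg: "\<forall>\<^sub>F i in sequentially. 0 \<le> \<theta> i" using \<theta>(1) by simp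
  have "(\<lambda>i. integral {0..T} (\<lambda>t. norm (critical_point (\<theta> i) I P \<xi> r t - critical_point \<theta>l I P \<xi> r t))) \<longlonglongrightarrow> integral {0..T} (\<lambda>t. 0)"
  proof (rule dominated_convergence(2)[where h = "\<lambda>t. E + E"])
    show "(\<lambda>t. norm (critical_point (\<theta> i) I P \<xi> r t - critical_point \<theta>l I P \<xi> r t)) integrable_on {0..T}" for i
      by (intro norm_diff_integrable absolutely_integrable_continuous_real critical_point_cont \<theta> \<theta>l)
    show "norm (norm (critical_point (\<theta> i) I P \<xi> r t - critical_point \<theta>l I P \<xi> r t)) \<le> E + E" if t: "t \<in> {0..T}" for i t
      using norm_triangle_ineq4[of "critical_point (\<theta> i) I P \<xi> r t" "critical_point \<theta>l I P \<xi> r t"] ED[OF \<theta>(1) \<Theta>(3) t, of i] ED[OF \<theta>l \<Theta>(2) t]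
      unfolding real_norm_def abs_norm_cancel by linarith
    show "(\<lambda>i. norm (critical_point (\<theta> i) I P \<xi> r t - critical_point \<theta>l I P \<xi> r t)) \<longlonglongrightarrow> 0" if t: "t \<in> {0..T}" for t
      by (rule tendsto_norm_zero[OF LIM_zero[OF critical_point_tendsto_parameter[OF nonneg \<theta>(2) \<theta>l t]]])
  qed (rule integrable_const_ivl)
  then show "(\<lambda>i. integral {0..T} (\<lambda>t. norm (critical_point (\<theta> i) I P \<xi> r t - critical_point \<theta>l I P \<xi> r t))) \<longlonglongrightarrow> 0" by simp
  have "(\<lambda>i. integral {0..T} (\<lambda>t. norm (critical_velocity (\<theta> i) I P \<xi> r P' g h t - critical_velocity \<theta>l I P \<xi> r P' g h t))) \<longlonglongrightarrow> integral {0..T} (\<lambda>t. 0)"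
  proof (rule dominated_convergence(2)[where h = "\<lambda>t. D t + D t"])
    show "(\<lambda>t. norm (critical_velocity (\<theta> i) I P \<xi> r P' g h t - critical_velocity \<theta>l I P \<xi> r P' g h t)) integrable_on {0..T}" for i
      by (intro norm_diff_integrable critical_point_weak_deriv(2) \<theta> \<theta>l)
    show "norm (norm (critical_velocity (\<theta> i) I P \<xi> r P' g h t - critical_velocity \<theta>l I P \<xi> r P' g h t)) \<le> D t + D t" if t: "t \<in> {0..T}" for i t
      using norm_triangle_ineq4[of "critical_velocity (\<theta> i) I P \<xi> r P' g h t" "critical_velocity \<theta>l I P \<xi> r P' g h t"]
        ED[OF \<theta>(1) \<Theta>(3) t, of i] ED[OF \<theta>l \<Theta>(2) t]
      unfolding real_norm_def abs_norm_cancel by linarith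
    show "(\<lambda>i. norm (critical_velocity (\<theta> i) I P \<xi> r P' g h t - critical_velocity \<theta>l I P \<xi> r P' g h t)) \<longlonglongrightarrow> 0" if t: "t \<in> {0..T}" for t
      by (rule tendsto_norm_zero[OF LIM_zero[OF critical_velocity_tendsto_parameter[OF nonneg \<theta>(2) \<theta>l t]]])
  qed (intro integrable_add Dint)
  then show "(\<lambda>i. integral {0..T} (\<lambda>t. norm (critical_velocity (\<theta> i) I P \<xi> r P' g h t - critical_velocity \<theta>l I P \<xi> r P' g h t))) \<longlonglongrightarrow> 0" by simp
qed

context
  fixes V :: "'k \<Rightarrow> real \<Rightarrow> real^'n \<Rightarrow> real"
  assumes V: "\<And>k t x. k \<in> I \<Longrightarrow> V k t x = quad_value (P k t) (\<xi> k t) (r k t) x"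
begin

lemma exp_estimator_eq_critical_point:
  assumes "0 < \<theta>" "t \<in> {0..T}"
  shows "exp_estimator I V \<theta> t = critical_point \<theta> I P \<xi> r t"
  by (rule critical_point_unique[OF less_imp_le[OF assms(1)] assms(2)
      total_grad_exp_estimator[where V = V and t = t and \<xi> = "\<lambda>k. \<xi> k t", OF family[OF assms(2)] V assms(1)]])

lemma mean_estimator_eq_critical_point:
  assumes "t \<in> {0..T}"
  shows "mean_estimator I V t = critical_point 0 I P \<xi> r t"
  by (rule critical_point_unique[OF order_refl assms(1)
      total_grad_mean_estimator[where V = V and t = t and \<xi> = "\<lambda>k. \<xi> k t", OF family[OF assms] V]])

lemma exp_mean_difference:
  assumes \<theta>: "0 < \<theta>"
  defines "f \<equiv> \<lambda>t. exp_estimator I V \<theta> t - mean_estimator I V t"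
  shows "f \<in> W1p_space 1 {0<..<T}"
    and "W1p_norm 1 {0<..<T} f = integral {0..T} (\<lambda>t. norm (critical_point \<theta> I P \<xi> r t - critical_point 0 I P \<xi> r t))
      + integral {0..T} (\<lambda>t. norm (critical_velocity \<theta> I P \<xi> r P' g h t - critical_velocity 0 I P \<xi> r P' g h t))"
proof -
  let ?e = "\<lambda>t. critical_point \<theta> I P \<xi> r t - critical_point 0 I P \<xi> r t"
  let ?d = "\<lambda>t. critical_velocity \<theta> I P \<xi> r P' g h t - critical_velocity 0 I P \<xi> r P' g h t"
  have \<theta>': "0 \<le> \<theta>" using \<theta> by simp
  have fe: "f t = ?e t" if "t \<in> {0..T}" for t
    using that \<theta> by (simp add: f_def exp_estimator_eq_critical_point mean_estimator_eq_critical_point)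
  have ec: "continuous_on {0..T} ?e" by (intro continuous_on_diff critical_point_cont \<theta>' order_refl)
  have ei: "critical_point \<theta>' I P \<xi> r absolutely_integrable_on {0..T}" if "0 \<le> \<theta>'" for \<theta>'
    by (rule absolutely_integrable_continuous_real[OF critical_point_cont[OF that]])
  have "has_weak_deriv {0<..<T} ?e ?d"
    by (intro has_weak_deriv_diff critical_point_weak_deriv ei \<theta>' order_refl)
  then have wd: "has_weak_deriv {0<..<T} f ?d"
    by (rule has_weak_deriv_cong) (use fe in auto)
  have "continuous_on {0..T} f" by (rule continuous_on_eq[OF ec]) (simp add: fe)
  then have fi: "f absolutely_integrable_on {0..T}" by (rule absolutely_integrable_continuous_real)
  have di: "?d absolutely_integrable_on {0..T}" by (intro set_integral_diff critical_point_weak_deriv \<theta>' order_refl)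
  show "f \<in> W1p_space 1 {0<..<T}" by (rule W1p_1(1)[OF T fi di wd])
  have "integral {0..T} (\<lambda>t. norm (f t)) = integral {0..T} (\<lambda>t. norm (?e t))"
    by (rule integral_cong) (simp add: fe)
  then show "W1p_norm 1 {0<..<T} f = integral {0..T} (\<lambda>t. norm (?e t)) + integral {0..T} (\<lambda>t. norm (?d t))"
    unfolding W1p_1(2)[OF T fi di wd] by simp
qed

lemma exp_mean_W1p_tendsto:
  "((\<lambda>\<theta>. W1p_norm 1 {0<..<T} (\<lambda>t. exp_estimator I V \<theta> t - mean_estimator I V t)) \<longlongrightarrow> 0) (at_right 0)"
  unfolding tendsto_at_iff_sequentially
proof (intro allI impI)
  fix X :: "nat \<Rightarrow> real" assume X: "\<forall>i. X i \<in> {0<..} - {0}" and lim: "X \<longlonglongrightarrow> 0"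
  have pos: "0 < X i" for i using X by auto
  have "(\<lambda>i. integral {0..T} (\<lambda>t. norm (critical_point (X i) I P \<xi> r t - critical_point 0 I P \<xi> r t))
      + integral {0..T} (\<lambda>t. norm (critical_velocity (X i) I P \<xi> r P' g h t - critical_velocity 0 I P \<xi> r P' g h t))) \<longlonglongrightarrow> 0 + 0"
    by (intro tendsto_add critical_point_velocity_L1_tendsto lim less_imp_le[OF pos] order_refl)
  then show "((\<lambda>\<theta>. W1p_norm 1 {0<..<T} (\<lambda>t. exp_estimator I V \<theta> t - mean_estimator I V t)) \<circ> X) \<longlonglongrightarrow> 0"
    unfolding comp_def exp_mean_difference(2)[OF pos] by simp
qed

lemma exp_minimax_dist:
  assumes "0 < \<theta>" "t \<in> {0..T}"
  shows "norm (exp_estimator I V \<theta> t - minimax_estimator I V t) \<le> sqrt (2 * ln (real (card I)) / (c * \<theta>))"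
  by (rule exp_estimator_near_minimax[where V = V and t = t and \<xi> = "\<lambda>k. \<xi> k t", OF family[OF assms(2)] V assms(1)])

lemma sqrt_rate_tendsto: "((\<lambda>\<theta>. sqrt (2 * ln (real (card I)) / (c * \<theta>))) \<longlongrightarrow> 0) at_top"
proof -
  have "((\<lambda>\<theta>. 2 * ln (real (card I)) / (c * \<theta>)) \<longlongrightarrow> 0) at_top"
    by (intro tendsto_divide_0[OF tendsto_const] filterlim_at_top_imp_at_infinity
        filterlim_tendsto_pos_mult_at_top[OF tendsto_const c filterlim_ident])
  then show ?thesis using tendsto_real_sqrt by fastforce
qed

text \<open>The minimax estimator inherits continuity in time as a uniform limit of the exponential estimators.\<close>
lemma minimax_estimator_cont: "continuous_on {0..T} (minimax_estimator I V)"
proof (rule uniform_limit_theorem[where F = at_top and f = "\<lambda>\<theta>. critical_point \<theta> I P \<xi> r"])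
  show "\<forall>\<^sub>F \<theta> in at_top. continuous_on {0..T} (critical_point \<theta> I P \<xi> r)"
    using eventually_ge_at_top[of 0] by eventually_elim (rule critical_point_cont)
  show "uniform_limit {0..T} (\<lambda>\<theta>. critical_point \<theta> I P \<xi> r) (minimax_estimator I V) at_top"
  proof (rule uniform_limitI)
    fix e :: real assume e: "0 < e"
    have "\<forall>\<^sub>F \<theta> in at_top. sqrt (2 * ln (real (card I)) / (c * \<theta>)) < e"
      by (rule order_tendstoD(2)[OF sqrt_rate_tendsto e])
    then show "\<forall>\<^sub>F \<theta> in at_top. \<forall>t\<in>{0..T}. dist (critical_point \<theta> I P \<xi> r t) (minimax_estimator I V t) < e"
      using eventually_gt_at_top[of 0]
    proof eventually_elim
      case (elim \<theta>)
      show ?case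
      proof
        fix t assume t: "t \<in> {0..T}"
        show "dist (critical_point \<theta> I P \<xi> r t) (minimax_estimator I V t) < e"
          using exp_minimax_dist[OF elim(2) t] elim(1) exp_estimator_eq_critical_point[OF elim(2) t] by (simp add: dist_norm)
      qed
    qed
  qed
qed simp

lemma exp_minimax_cont:
  assumes "0 < \<theta>"
  shows "continuous_on {0..T} (\<lambda>t. exp_estimator I V \<theta> t - minimax_estimator I V t)"
proof -
  have "continuous_on {0..T} (\<lambda>t. critical_point \<theta> I P \<xi> r t - minimax_estimator I V t)"
    using assms by (intro continuous_on_diff critical_point_cont minimax_estimator_cont) simp
  then show ?thesis by (rule continuous_on_eq) (simp add: exp_estimator_eq_critical_point[OF assms])
qed

lemma exp_minimax_Lp_tendsto:
  assumes p: "1 \<le> p"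
  shows "((\<lambda>\<theta>. Lp_norm p {0<..<T} (\<lambda>t. exp_estimator I V \<theta> t - minimax_estimator I V t)) \<longlongrightarrow> 0) at_top"
proof (rule Lim_null_comparison)
  have N: "1 \<le> real (card I)" using fin ne by (simp add: card_gt_0_iff Suc_le_eq)
  show "\<forall>\<^sub>F \<theta> in at_top. norm (Lp_norm p {0<..<T} (\<lambda>t. exp_estimator I V \<theta> t - minimax_estimator I V t))
      \<le> root p T * sqrt (2 * ln (real (card I)) / (c * \<theta>))"
    using eventually_gt_at_top[of 0]
  proof eventually_elim
    case (elim \<theta>)
    have "0 \<le> sqrt (2 * ln (real (card I)) / (c * \<theta>))" using N c elim by simp
    note le = Lp_norm_le_of_uniform_bound[OF exp_minimax_cont[OF elim] less_imp_le[OF T] _ exp_minimax_dist[OF elim] this, of p]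
    then show ?case using p by simp
  qed
  show "((\<lambda>\<theta>. root p T * sqrt (2 * ln (real (card I)) / (c * \<theta>))) \<longlongrightarrow> 0) at_top"
    by (rule tendsto_mult_right_zero[OF sqrt_rate_tendsto])
qed

end

end

section \<open>The observer bank\<close>

lemma Lp_space_2_imp:
  fixes y :: "real \<Rightarrow> real^'n"
  assumes "y \<in> Lp_space 2 {0<..<T}"
  shows "y absolutely_integrable_on {0..T}" "(\<lambda>t. (norm (y t))\<^sup>2) integrable_on {0..T}"
proof -
  have m: "y \<in> borel_measurable (lebesgue_on {0<..<T})" and i: "integrable (lebesgue_on {0<..<T}) (\<lambda>t. (norm (y t))\<^sup>2)"
    using assms by (auto simp: Lp_space_def)
  from i have i2: "(\<lambda>t. (norm (y t))\<^sup>2) absolutely_integrable_on {0..T}"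
    by (simp only: integrable_lebesgue_on_Ioo_iff)
  then show "(\<lambda>t. (norm (y t))\<^sup>2) integrable_on {0..T}" by (rule set_lebesgue_integral_eq_integral(1))
  have one: "integrable (lebesgue_on {0<..<T}) (\<lambda>t. 1 :: real)"
    unfolding integrable_lebesgue_on_Ioo_iff by (rule absolutely_integrable_continuous_real) simp
  have "integrable (lebesgue_on {0<..<T}) y"
  proof (rule Bochner_Integration.integrable_bound[OF Bochner_Integration.integrable_add[OF one i] m])
    have "norm (y t) \<le> norm (1 + (norm (y t))\<^sup>2)" for t
    proof -
      have "0 \<le> (norm (y t) - 1)\<^sup>2 + (norm (y t))\<^sup>2 + 1" by simp
      then have "norm (y t) \<le> 1 + (norm (y t))\<^sup>2" by (simp add: power2_eq_square algebra_simps)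
      then show ?thesis by simp
    qed
    then show "AE t in lebesgue_on {0<..<T}. norm (y t) \<le> norm (1 + (norm (y t))\<^sup>2)" by simp
  qed
  then show "y absolutely_integrable_on {0..T}" by (simp only: integrable_lebesgue_on_Ioo_iff)
qed

lemma matvec_absolutely_integrable:
  fixes M :: "real \<Rightarrow> real^'n^'m" and f :: "real \<Rightarrow> real^'n"
  assumes M: "continuous_on {0..T} M" and f: "f absolutely_integrable_on {0..T}"
  shows "(\<lambda>t. M t *v f t) absolutely_integrable_on {0..T}"
proof (rule absolutely_integrable_bounded_measurable_product[where h = "(*v)" and f = M, OF _ _ _ _ f])
  show "bilinear ((*v) :: real^'n^'m \<Rightarrow> real^'n \<Rightarrow> real^'m)"
    by (simp add: bilinear_conv_bounded_bilinear bounded_bilinear_matrix_vector_mult)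
  show "bounded (M ` {0..T})" using M by (simp add: compact_continuous_image compact_imp_bounded)
  show "M \<in> borel_measurable (lebesgue_on {0..T})"
    by (intro continuous_imp_measurable_on_sets_lebesgue M) simp
qed simp

lemma riccati_solution_continuous:
  assumes "riccati_solution T A B C \<Gamma> R Q Pm"
  shows "continuous_on {0..T} Pm"
  using assms unfolding riccati_solution_def
  by (auto intro: has_vector_derivative_imp_continuous_on)

lemma riccati_inverse:
  fixes Pm :: "real \<Rightarrow> real^'n^'n" and B :: "real^'m^'n" and C :: "real^'n^'r"
  assumes ric: "riccati_solution T A B C \<Gamma> R Q Pm"
    and pd: "sym_pos_def \<Gamma>" "sym_pos_def R" "sym_pos_def Q"
  shows "\<exists>c P'. 0 < c \<and> continuous_on {0..T} P' \<and> (\<forall>t\<in>{0..T}.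
     transpose (matrix_inv (Pm t)) = matrix_inv (Pm t) \<and> (\<forall>x. c * (norm x)\<^sup>2 \<le> wnorm_sq (matrix_inv (Pm t)) x) \<and>
     ((\<lambda>s. matrix_inv (Pm s)) has_vector_derivative P' t) (at t within {0..T}))"
proof -
  obtain c where c: "0 < c" "\<And>t x. t \<in> {0..T} \<Longrightarrow> c * (norm x)\<^sup>2 \<le> wnorm_sq (Pm t) x"
    using riccati_solution_uniformly_positive[OF ric pd] by blast
  have symQ: "transpose (matrix_inv Q) = matrix_inv Q"
    using sym_pos_def_matrix_inv[OF pd(3)] by (simp add: sym_pos_def_def)
  have sym: "transpose (Pm t) = Pm t" if "t \<in> {0..T}" for t
    using pd symQ by (intro riccati_solution_symmetric[OF ric _ _ _ that]) (auto simp: sym_pos_def_def)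
  have Pc: "continuous_on {0..T} Pm" by (rule riccati_solution_continuous[OF ric])
  obtain K0 where K0: "0 \<le> K0" "\<And>t. t \<in> {0..T} \<Longrightarrow> norm (Pm t) \<le> K0"
    using continuous_on_Icc_bounded[OF Pc] by blast
  define K where "K = K0 + 1"
  have K: "0 < K" "\<And>t. t \<in> {0..T} \<Longrightarrow> norm (Pm t) \<le> K" using K0 by (auto simp: K_def add_increasing2)
  define F where "F t = A ** Pm t + Pm t ** transpose A - Pm t ** transpose C ** matrix_inv Q ** C ** Pm t
     + B ** R ** transpose B" for t
  have F: "(Pm has_vector_derivative F t) (at t within {0..T})" if "t \<in> {0..T}" for t
    using ric that by (simp add: riccati_solution_def F_def)
  define P' where "P' t = - (matrix_inv (Pm t) ** F t ** matrix_inv (Pm t))" for t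
  have der: "((\<lambda>s. matrix_inv (Pm s)) has_vector_derivative P' t) (at t within {0..T})" if t: "t \<in> {0..T}" for t
    unfolding P'_def by (rule matrix_inv_has_vector_derivative[OF c F[OF t] t])
  have ic: "continuous_on {0..T} (\<lambda>s. matrix_inv (Pm s))"
    using der by (rule has_vector_derivative_imp_continuous_on)
  have "continuous_on {0..T} P'"
    unfolding P'_def F_def by (intro continuous_intros ic Pc)
  moreover have "transpose (matrix_inv (Pm t)) = matrix_inv (Pm t)" if t: "t \<in> {0..T}" for t
    by (rule symmetric_matrix_inv[OF c(1) c(2)[OF t] sym[OF t]])
  moreover have "c / K\<^sup>2 * (norm x)\<^sup>2 \<le> wnorm_sq (matrix_inv (Pm t)) x" if t: "t \<in> {0..T}" for t x
    by (rule coercive_matrix_inv(3)[OF c(1) c(2)[OF t] K(2)[OF t]])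
  moreover have "0 < c / K\<^sup>2" using c(1) K(1) by simp
  ultimately show ?thesis using der by blast
qed

text \<open>The defining weak equation of the observer has an integrable right-hand side, so the continuous
  representative is its indefinite integral.\<close>
lemma observer_indefinite_integral:
  fixes Pm :: "real \<Rightarrow> real^'n^'n" and C :: "real^'n^'r"
  assumes T: "0 < T" and y: "y \<in> Lp_space 2 {0<..<T}" and Pm: "continuous_on {0..T} Pm"
    and obs: "observer T A C Q x\<^sub>0 y Pm xh"
  defines "g \<equiv> \<lambda>t. A *v xh t + (Pm t ** transpose C ** matrix_inv Q) *v (y t - C *v xh t)"
  shows "g absolutely_integrable_on {0..T}" and "\<And>t. t \<in> {0..T} \<Longrightarrow> xh t = xh 0 + integral {0..t} g"
proof -
  have xc: "continuous_on {0..T} xh" and wd: "has_weak_deriv {0<..<T} xh g"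
    using obs by (simp_all add: observer_def g_def)
  show gi: "g absolutely_integrable_on {0..T}"
    unfolding g_def
    by (intro set_integral_add matvec_absolutely_integrable set_integral_diff Lp_space_2_imp(1)[OF y]
        absolutely_integrable_continuous_real continuous_intros xc Pm)
  show "xh t = xh 0 + integral {0..t} g" if "t \<in> {0..T}" for t
    by (rule weak_deriv_imp_indefinite_integral[OF T xc gi wd that])
qed

lemma residual_indefinite_integral:
  fixes C :: "real^'n^'r" and xh :: "real \<Rightarrow> real^'n"
  assumes y: "y \<in> Lp_space 2 {0<..<T}" and xc: "continuous_on {0..T} xh" and Q: "sym_pos_def Q"
  defines "h \<equiv> \<lambda>s. wnorm_sq (matrix_inv Q) (y s - C *v xh s)"
  shows "h absolutely_integrable_on {0..T}" and "\<And>t. 0 \<le> h t"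
    and "\<And>t. t \<in> {0..T} \<Longrightarrow> residual C Q y xh t = integral {0..t} h"
proof -
  define d where "d s = y s - C *v xh s" for s
  have cc: "continuous_on {0..T} (\<lambda>s. C *v xh s)" by (intro continuous_intros xc)
  have di: "d absolutely_integrable_on {0..T}"
    unfolding d_def by (intro set_integral_diff Lp_space_2_imp(1)[OF y] absolutely_integrable_continuous_real cc)
  have dm: "d \<in> borel_measurable (lebesgue_on {0..T})"
    by (rule absolutely_integrable_imp_borel_measurable[OF di]) simp
  obtain b where b: "0 \<le> b" "\<And>t. t \<in> {0..T} \<Longrightarrow> norm (C *v xh t) \<le> b"
    using continuous_on_Icc_bounded[OF cc] by blast
  let ?N = "norm (matrix_inv Q)"
  show hi: "h absolutely_integrable_on {0..T}"
  proof (rule measurable_bounded_by_integrable_imp_absolutely_integrable[where g = "\<lambda>t. ?N * (2 * (norm (y t))\<^sup>2 + 2 * b\<^sup>2)"])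
    show "h \<in> borel_measurable (lebesgue_on {0..T})"
      unfolding h_def wnorm_sq_def d_def[symmetric]
      by (intro borel_measurable_inner borel_measurable_matvec dm borel_measurable_const)
    show "(\<lambda>t. ?N * (2 * (norm (y t))\<^sup>2 + 2 * b\<^sup>2)) integrable_on {0..T}"
      by (intro integrable_on_mult_right integrable_add Lp_space_2_imp(2)[OF y] integrable_const_ivl)
    fix t assume t: "t \<in> {0..T}"
    have "\<bar>h t\<bar> \<le> norm (d t) * (?N * norm (d t))"
      unfolding h_def wnorm_sq_def d_def[symmetric]
      by (rule order_trans[OF Cauchy_Schwarz_ineq2]) (intro mult_left_mono norm_matrix_vector_mult_le norm_ge_zero)
    also have "\<dots> = ?N * (norm (d t))\<^sup>2" by (simp add: power2_eq_square mult_ac)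
    also have "\<dots> \<le> ?N * (2 * (norm (y t))\<^sup>2 + 2 * b\<^sup>2)"
    proof (rule mult_left_mono)
      have "norm (d t) \<le> norm (y t) + b"
        using norm_triangle_ineq4[of "y t" "C *v xh t"] b(2)[OF t] by (simp add: d_def)
      then have "(norm (d t))\<^sup>2 \<le> (norm (y t) + b)\<^sup>2" by (intro power_mono) auto
      also have "\<dots> \<le> 2 * (norm (y t))\<^sup>2 + 2 * b\<^sup>2"
        using zero_le_power2[of "norm (y t) - b"] by (simp add: power2_eq_square algebra_simps)
      finally show "(norm (d t))\<^sup>2 \<le> 2 * (norm (y t))\<^sup>2 + 2 * b\<^sup>2" .
    qed simp
    finally show "norm (h t) \<le> ?N * (2 * (norm (y t))\<^sup>2 + 2 * b\<^sup>2)" by simp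
  qed simp
  have "0 \<le> wnorm_sq (matrix_inv Q) v" for v
    using sym_pos_def_matrix_inv[OF Q] by (cases "v = 0") (auto simp: sym_pos_def_def wnorm_sq_def less_imp_le)
  then show "0 \<le> h t" for t by (simp add: h_def)
  show "residual C Q y xh t = integral {0..t} h" if "t \<in> {0..T}" for t
    unfolding residual_def h_def[symmetric]
    by (rule set_lebesgue_integral_eq_integral(2)[OF absolutely_integrable_on_subinterval[OF hi]]) (use that in auto)
qed

theorem proposition4p4:
  fixes T :: real and p :: nat
    and B :: "real ^ 'm ^ 'n" and C :: "real ^ 'n ^ 'r" and x\<^sub>0 :: "real ^ 'n"
    and SA :: "'a set" and SG :: "'g set" and SR :: "'w set" and SQ :: "'q set"
    and A :: "'a \<Rightarrow> real ^ 'n ^ 'n" and \<Gamma> :: "'g \<Rightarrow> real ^ 'n ^ 'n"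
    and R :: "'w \<Rightarrow> real ^ 'm ^ 'm" and Q :: "'q \<Rightarrow> real ^ 'r ^ 'r"
    and y :: "real \<Rightarrow> real ^ 'r"
    and Pm :: "'a \<times> 'g \<times> 'w \<times> 'q \<Rightarrow> real \<Rightarrow> real ^ 'n ^ 'n"
    and xh :: "'a \<times> 'g \<times> 'w \<times> 'q \<Rightarrow> real \<Rightarrow> real ^ 'n"
  defines "SS \<equiv> SA \<times> SG \<times> SR \<times> SQ"
    and "V \<equiv> \<lambda>(a, g, w, q). value_fun C (Q q) y (Pm (a, g, w, q)) (xh (a, g, w, q))"
  assumes "0 < T"
    and "finite SA" "SA \<noteq> {}" and "finite SG" "SG \<noteq> {}"
    and "finite SR" "SR \<noteq> {}" and "finite SQ" "SQ \<noteq> {}"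
    and "\<And>g. g \<in> SG \<Longrightarrow> sym_pos_def (\<Gamma> g)"
    and "\<And>w. w \<in> SR \<Longrightarrow> sym_pos_def (R w)"
    and "\<And>q. q \<in> SQ \<Longrightarrow> sym_pos_def (Q q)"
    and "y \<in> Lp_space 2 {0<..<T}"
    and "\<And>a g w q. (a, g, w, q) \<in> SS \<Longrightarrow>
           riccati_solution T (A a) B C (\<Gamma> g) (R w) (Q q) (Pm (a, g, w, q))"
    and "\<And>a g w q. (a, g, w, q) \<in> SS \<Longrightarrow>
           observer T (A a) C (Q q) x\<^sub>0 y (Pm (a, g, w, q)) (xh (a, g, w, q))"
    and "1 \<le> p"
  shows "(\<forall>\<theta>>0. (\<lambda>t. exp_estimator SS V \<theta> t - mean_estimator SS V t)
                   \<in> W1p_space 1 {0<..<T}) \<and>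
         ((\<lambda>\<theta>. W1p_norm 1 {0<..<T} (\<lambda>t. exp_estimator SS V \<theta> t - mean_estimator SS V t))
            \<longlongrightarrow> 0) (at_right 0) \<and>
         (\<forall>\<theta>>0. (\<lambda>t. exp_estimator SS V \<theta> t - minimax_estimator SS V t)
                   \<in> Lp_space p {0<..<T}) \<and>
         ((\<lambda>\<theta>. Lp_norm p {0<..<T} (\<lambda>t. exp_estimator SS V \<theta> t - minimax_estimator SS V t))
            \<longlongrightarrow> 0) at_top"
proof -
  note T = \<open>0 < T\<close> and y = \<open>y \<in> Lp_space 2 {0<..<T}\<close>
  define Ak where "Ak k = (case k of (a, g, w, q) \<Rightarrow> A a)" for k :: "'a \<times> 'g \<times> 'w \<times> 'q"
  define Qk where "Qk k = (case k of (a, g, w, q) \<Rightarrow> Q q)" for k :: "'a \<times> 'g \<times> 'w \<times> 'q"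
  have fin: "finite SS" "SS \<noteq> {}"
    using \<open>finite SA\<close> \<open>SA \<noteq> {}\<close> \<open>finite SG\<close> \<open>SG \<noteq> {}\<close> \<open>finite SR\<close> \<open>SR \<noteq> {}\<close> \<open>finite SQ\<close> \<open>SQ \<noteq> {}\<close>
    by (simp_all add: SS_def)
  have ric: "\<exists>\<Gamma>' R'. riccati_solution T (Ak k) B C \<Gamma>' R' (Qk k) (Pm k) \<and> sym_pos_def \<Gamma>' \<and> sym_pos_def R'"
    and Qpd: "sym_pos_def (Qk k)" and obs: "observer T (Ak k) C (Qk k) x\<^sub>0 y (Pm k) (xh k)" if k: "k \<in> SS" for k
  proof -
    obtain a g w q where kq: "k = (a, g, w, q)" by (cases k)
    with k have "g \<in> SG" "w \<in> SR" "q \<in> SQ" "(a, g, w, q) \<in> SS" by (auto simp: SS_def)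
    note in_sets = this
    have "riccati_solution T (Ak k) B C (\<Gamma> g) (R w) (Qk k) (Pm k)"
      using assms(16)[OF in_sets(4)] by (simp add: kq Ak_def Qk_def)
    then show "\<exists>\<Gamma>' R'. riccati_solution T (Ak k) B C \<Gamma>' R' (Qk k) (Pm k) \<and> sym_pos_def \<Gamma>' \<and> sym_pos_def R'"
      using assms(12)[OF in_sets(1)] assms(13)[OF in_sets(2)] by blast
    show "sym_pos_def (Qk k)" using assms(14)[OF in_sets(3)] by (simp add: kq Qk_def)
    show "observer T (Ak k) C (Qk k) x\<^sub>0 y (Pm k) (xh k)"
      using assms(17)[OF in_sets(4)] by (simp add: kq Ak_def Qk_def)
  qed
  have Pc: "continuous_on {0..T} (Pm k)" if "k \<in> SS" for k
    using ric[OF that] riccati_solution_continuous by blast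
  have xc: "continuous_on {0..T} (xh k)" if "k \<in> SS" for k using obs[OF that] by (simp add: observer_def)
  have "\<exists>c P'. 0 < c \<and> continuous_on {0..T} P' \<and> (\<forall>t\<in>{0..T}.
     transpose (matrix_inv (Pm k t)) = matrix_inv (Pm k t) \<and> (\<forall>x. c * (norm x)\<^sup>2 \<le> wnorm_sq (matrix_inv (Pm k t)) x) \<and>
     ((\<lambda>s. matrix_inv (Pm k s)) has_vector_derivative P' t) (at t within {0..T}))" if "k \<in> SS" for k
    using ric[OF that] Qpd[OF that] riccati_inverse by blast
  then obtain ck P' where ck: "\<And>k. k \<in> SS \<Longrightarrow> 0 < ck k" and P'c: "\<And>k. k \<in> SS \<Longrightarrow> continuous_on {0..T} (P' k)"
    and Pk: "\<And>k t. k \<in> SS \<Longrightarrow> t \<in> {0..T} \<Longrightarrow> transpose (matrix_inv (Pm k t)) = matrix_inv (Pm k t) \<and>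
      (\<forall>x. ck k * (norm x)\<^sup>2 \<le> wnorm_sq (matrix_inv (Pm k t)) x) \<and>
     ((\<lambda>s. matrix_inv (Pm k s)) has_vector_derivative P' k t) (at t within {0..T})"
    by metis
  define c where "c = Min (ck ` SS)"
  have c: "0 < c" using fin ck by (simp add: c_def)
  have cle: "c \<le> ck k" if "k \<in> SS" for k using fin that by (simp add: c_def)
  define g where "g k t = Ak k *v xh k t + (Pm k t ** transpose C ** matrix_inv (Qk k)) *v (y t - C *v xh k t)" for k t
  define h where "h k s = wnorm_sq (matrix_inv (Qk k)) (y s - C *v xh k s)" for k s
  note og = observer_indefinite_integral[OF T y Pc obs, folded g_def]
  note rh = residual_indefinite_integral[OF y xc Qpd, folded h_def]
  interpret quadratic_family T c SS "\<lambda>k t. matrix_inv (Pm k t)" P' xh g "\<lambda>k. residual C (Qk k) y (xh k)" h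
  proof
    show "c * (norm x)\<^sup>2 \<le> wnorm_sq (matrix_inv (Pm k t)) x" if "k \<in> SS" "t \<in> {0..T}" for k t x
      using Pk[OF that] mult_right_mono[OF cle[OF that(1)], of "(norm x)\<^sup>2"] by (meson order_trans zero_le_power2)
    show "g k absolutely_integrable_on {0..T}" if "k \<in> SS" for k using og(1)[OF that that] unfolding g_def .
    show "xh k t = xh k 0 + integral {0..t} (g k)" if "k \<in> SS" "t \<in> {0..T}" for k t
      using og(2)[OF that(1) that(1) that(2)] unfolding g_def .
    show "h k absolutely_integrable_on {0..T}" if "k \<in> SS" for k using rh(1)[OF that that] unfolding h_def .
    show "0 \<le> h k t" if "k \<in> SS" "t \<in> {0..T}" for k t using rh(2)[OF that(1) that(1)] unfolding h_def .
    show "residual C (Qk k) y (xh k) t = integral {0..t} (h k)" if "k \<in> SS" "t \<in> {0..T}" for k t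
      using rh(3)[OF that(1) that(1) that(2)] unfolding h_def .
  qed (use T fin c Pk P'c in auto)
  have V: "V k t x = quad_value (matrix_inv (Pm k t)) (xh k t) (residual C (Qk k) y (xh k) t) x" if "k \<in> SS" for k t x
    by (cases k) (simp add: V_def Qk_def value_fun_def quad_value_def)
  show ?thesis
    using exp_mean_difference(1)[OF V] exp_mean_W1p_tendsto[OF V] continuous_Lp(1)[OF exp_minimax_cont[OF V]]
      exp_minimax_Lp_tendsto[OF V \<open>1 \<le> p\<close>] by blast
qed

end
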